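(* Let $H,A,a,\rho,\mu,\alpha,\beta,\gamma,\alpha_1,g,\zeta$, the Hilbert space $\mathcal H$, the operator $\mathcal A$ and the semigroup $e^{\mathcal A t}$ be as in the context, and assume that $g$ satisfies (A1) and (A2). Then $e^{\mathcal A t}$ is polynomially stable with decay rate $t^{-\frac1{2-2a}}$ under smooth initial conditions; that is, for initial data $(v_0,v_1,p_0,p_1,\eta_0)\in\mathcal D(\mathcal A)$ the solution satisfies $$\|(v,v_t,p,p_t,\eta)\|_{\mathcal H}\le C\,t^{-\frac{1}{2-2a}}\,\|(v_0,v_1,p_0,p_1,\eta_0)\|_{\mathcal D(\mathcal A)},\qquad \forall\, t\ge 1,$$ where $C>0$ is some constant and $\|\cdot\|_{\mathcal D(\mathcal A)}$ is the graph norm of $\mathcal A$.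
   Context: Setting. $(H,\langle\cdot,\cdot\rangle,\|\cdot\|)$ is a complex Hilbert space and $A:\mathcal D(A)\to H$ is a strictly positive self-adjoint operator with compact resolvent, with eigenvalues $0<\xi_1<\xi_2<\cdots$, $\xi_k\to+\infty$, and eigenvectors $A\Psi_k=\xi_k\Psi_k$, where $\{\Psi_k\}_{k\in\mathbb N}$ is an orthonormal basis of $H$. Fractional powers are defined spectrally: $A^{\vartheta}f=\sum_k \xi_k^{\vartheta}\langle f,\Psi_k\rangle\Psi_k$ on $D(A^\vartheta)=\{f\in H:\sum_k\xi_k^{2\vartheta}|\langle f,\Psi_k\rangle|^2<\infty\}$ for $\vartheta\in[0,1]$; more generally, for $r\in\mathbb R$ one considers the scale of Hilbert spaces $D(A^{r/2})$ with inner product $\langle A^{r/2}\cdot,A^{r/2}\cdot\rangle$. Parameters: $a\in[0,1)$; $\rho,\mu,\alpha,\beta,\gamma>0$ with $\alpha_1:=\alpha-\gamma^2\beta>0$. Kernel $g:\mathbb R_+\to\mathbb R$: (A1) $g\in L^1(\mathbb R_+)\cap H^1(\mathbb R_+)$, $g(s)>0$ for $s\in\mathbb R_+$, and $0<\zeta:=\int_0^\infty g(s)\,ds<\infty$; (A2) $g'(s)<0$ for all $s\in\mathbb R_+$, and there are constants $k_0,k_1>0$ with $-k_0g(s)\le g'(s)\le -k_1g(s)$. In this setting it is asserted (not imposed as a separate hypothesis), from the compactness of the embeddings $D(A^{r_1/2})\hookrightarrow D(A^{r_2/2})$ for $r_1>r_2$, that for $a\in[0,1)$ there is a constant $\kappa\in(0,\alpha_1)$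 with $\alpha_1\|A^{1/2}u\|^2-\zeta\|A^{a/2}u\|^2>\kappa\|A^{1/2}u\|^2$ for all $0\neq u\in D(A^{1/2})$; by this, the space $\mathcal H$ below is a Hilbert space. The underlying system is $$\rho v_{tt}=-\alpha Av+\gamma\beta Ap+\int_0^\infty g(s)A^av(t-s)ds,\qquad \mu p_{tt}=-\beta Ap+\gamma\beta Av,\qquad t>0,$$ with $v(0)=v_0$, $v_t(0)=v_1$, $p(0)=p_0$, $p_t(0)=p_1$, $v(-s)=h(s)$ for $s>0$. With $\eta(t,s)=v(t)-v(t-s)$ it is rewritten as $X'(t)=\mathcal AX(t)$, $X(0)=X_0$, for $X=(v,v_t,p,p_t,\eta)$ and $X_0=(v_0,v_1,p_0,p_1,\eta_0)$. $L^2_g(\mathbb R_+,D(A^{a/2}))$ is the space of functions $w$ with $w(s)\in D(A^{a/2})$ for $s\in\mathbb R_+$ and $\int_0^\infty g(s)\|A^{a/2}w(s)\|^2ds<\infty$. State space: $\mathcal H=(D(A^{1/2})\times H)^2\times L^2_g(\mathbb R_+,D(A^{a/2}))$ with inner product $$\langle(v,u,p,q,\eta),(\tilde v,\tilde u,\tilde p,\tilde q,\tilde\eta)\rangle_{\mathcal H}=\alpha_1\langle A^{1/2}v,A^{1/2}\tilde v\rangle-\zeta\langle A^{a/2}v,A^{a/2}\tilde v\rangle+\rho\langle u,\tilde u\rangle+\beta\langle\gamma A^{1/2}v-A^{1/2}p,\gamma A^{1/2}\tilde v-A^{1/2}\tilde p\rangle+\mu\langle q,\tilde q\rangle+\int_0^\infty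 g(s)\langle A^{a/2}\eta(s),A^{a/2}\tilde\eta(s)\rangle ds.$$ Operator: $$\mathcal A(v,u,p,q,\eta)=\Big(u,\ \tfrac1\rho\big(-\alpha Av+\gamma\beta Ap+\zeta A^av-\textstyle\int_0^\infty g(s)A^a\eta(s)ds\big),\ q,\ \tfrac1\mu(-\beta Ap+\gamma\beta Av),\ u-\eta_s\Big)$$ with domain $$\mathcal D(\mathcal A)=\big(D(A)\times D(A^{1/2})\big)^2\times L^2_g(\mathbb R_+,D(A^{a/2})),$$ where the memory component is understood to satisfy $\eta(0)=0$ and $\eta_s\in L^2_g(\mathbb R_+,D(A^{a/2}))$. The operator $\mathcal A$ generates a $C_0$-semigroup of contractions $e^{\mathcal At}$ on $\mathcal H$.
   Formalization: The κ-inequality, false in general (g=ce^{-s}, c large), is assumed, as the inner product of the state space needs it; D(A) of the system also requires the integral of g·η to lie in D(A^a), so the operator is defined; "generates" means its closure is the generator. *)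

theory Defs
  imports "HOL-Analysis.Analysis"
begin

section \<open>Complex Hilbert spaces\<close>

text \<open>The inner product is linear in the first argument.\<close>

class complex_hilbert = banach +
  fixes scaleC :: "complex \<Rightarrow> 'a \<Rightarrow> 'a" (infixr "*\<^sub>C" 75)
    and cinner :: "'a \<Rightarrow> 'a \<Rightarrow> complex"
  assumes scaleC_add_right: "c *\<^sub>C (x + y) = c *\<^sub>C x + c *\<^sub>C y"
    and scaleC_add_left: "(c + d) *\<^sub>C x = c *\<^sub>C x + d *\<^sub>C x"
    and scaleC_scaleC: "c *\<^sub>C d *\<^sub>C x = (c * d) *\<^sub>C x"
    and scaleR_eq_scaleC: "r *\<^sub>R x = complex_of_real r *\<^sub>C x"
    and cinner_add_left: "cinner (x + y) z = cinner x z + cinner y z"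
    and cinner_scaleC_left: "cinner (c *\<^sub>C x) z = c * cinner x z"
    and cinner_commute: "cinner x y = cnj (cinner y x)"
    and norm_eq_sqrt_cinner: "norm x = sqrt (Re (cinner x x))"

section \<open>Unbounded operators on a Hilbert space\<close>

definition linear_operator :: "'h::complex_hilbert set \<Rightarrow> ('h \<Rightarrow> 'h) \<Rightarrow> bool" where
  "linear_operator D A \<longleftrightarrow> 0 \<in> D \<and>
     (\<forall>x\<in>D. \<forall>y\<in>D. x + y \<in> D \<and> A (x + y) = A x + A y) \<and>
     (\<forall>x\<in>D. \<forall>c. c *\<^sub>C x \<in> D \<and> A (c *\<^sub>C x) = c *\<^sub>C A x)"

text \<open>The right-hand side of the inner equivalence says that \<open>y\<close> is in the domain of the
  adjoint, with image \<open>z\<close>; so the last conjunct is equality of \<open>A\<close> and its adjoint,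
  domains included.\<close>

definition self_adjoint :: "'h::complex_hilbert set \<Rightarrow> ('h \<Rightarrow> 'h) \<Rightarrow> bool" where
  "self_adjoint D A \<longleftrightarrow> linear_operator D A \<and> closure D = UNIV \<and>
     (\<forall>y z. (y \<in> D \<and> A y = z) \<longleftrightarrow> (\<forall>x\<in>D. cinner (A x) y = cinner x z))"

definition strictly_positive :: "'h::complex_hilbert set \<Rightarrow> ('h \<Rightarrow> 'h) \<Rightarrow> bool" where
  "strictly_positive D A \<longleftrightarrow> (\<exists>c>0. \<forall>x\<in>D. Re (cinner (A x) x) \<ge> c * (norm x)\<^sup>2)"

definition compact_resolvent :: "'h::complex_hilbert set \<Rightarrow> ('h \<Rightarrow> 'h) \<Rightarrow> bool" where
  "compact_resolvent D A \<longleftrightarrow> (\<exists>z::complex.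
     bij_betw (\<lambda>x. z *\<^sub>C x - A x) D UNIV \<and>
     (\<forall>S. bounded S \<longrightarrow> compact (closure (inv_into D (\<lambda>x. z *\<^sub>C x - A x) ` S))))"

definition orthonormal_basis :: "(nat \<Rightarrow> 'h::complex_hilbert) \<Rightarrow> bool" where
  "orthonormal_basis \<Psi> \<longleftrightarrow>
     (\<forall>j k. cinner (\<Psi> j) (\<Psi> k) = (if j = k then 1 else 0)) \<and>
     (\<forall>f. (\<lambda>k. cinner f (\<Psi> k) *\<^sub>C \<Psi> k) sums f)"

definition eigensystem ::
  "'h::complex_hilbert set \<Rightarrow> ('h \<Rightarrow> 'h) \<Rightarrow> (nat \<Rightarrow> real) \<Rightarrow> (nat \<Rightarrow> 'h) \<Rightarrow> bool" where
  "eigensystem D A \<xi> \<Psi> \<longleftrightarrow>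
     0 < \<xi> 0 \<and> strict_mono \<xi> \<and> filterlim \<xi> at_top sequentially \<and>
     orthonormal_basis \<Psi> \<and> (\<forall>k. \<Psi> k \<in> D \<and> A (\<Psi> k) = \<xi> k *\<^sub>R \<Psi> k)"

section \<open>Fractional powers\<close>

definition frac_dom :: "(nat \<Rightarrow> real) \<Rightarrow> (nat \<Rightarrow> 'h::complex_hilbert) \<Rightarrow> real \<Rightarrow> 'h set" where
  "frac_dom \<xi> \<Psi> r = {f. summable (\<lambda>k. \<xi> k powr (2 * r) * (cmod (cinner f (\<Psi> k)))\<^sup>2)}"

definition frac_pow :: "(nat \<Rightarrow> real) \<Rightarrow> (nat \<Rightarrow> 'h::complex_hilbert) \<Rightarrow> real \<Rightarrow> 'h \<Rightarrow> 'h" where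
  "frac_pow \<xi> \<Psi> r f = (\<Sum>k. (\<xi> k powr r) *\<^sub>R cinner f (\<Psi> k) *\<^sub>C \<Psi> k)"

section \<open>The memory kernel\<close>

text \<open>Weak differentiability on \<open>(0, \<infinity>)\<close>, for the locally absolutely continuous
  representative \<open>f\<close>; the derivative \<open>f'\<close> is determined almost everywhere.\<close>

definition weak_deriv_on_pos ::
  "(real \<Rightarrow> 'b::{banach, second_countable_topology}) \<Rightarrow> (real \<Rightarrow> 'b) \<Rightarrow> bool" where
  "weak_deriv_on_pos f f' \<longleftrightarrow> (\<forall>s t. 0 < s \<and> s \<le> t \<longrightarrow>
     set_integrable lebesgue {s..t} f' \<and> f t - f s = (LINT r:{s..t}|lebesgue. f' r))"

definition kernel_mass :: "(real \<Rightarrow> real) \<Rightarrow> real" where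
  "kernel_mass g = (LINT s:{0<..}|lebesgue. g s)"

definition kernel_A1 :: "(real \<Rightarrow> real) \<Rightarrow> (real \<Rightarrow> real) \<Rightarrow> bool" where
  "kernel_A1 g g' \<longleftrightarrow>
     set_integrable lebesgue {0<..} g \<and>
     set_integrable lebesgue {0<..} (\<lambda>s. (g s)\<^sup>2) \<and>
     weak_deriv_on_pos g g' \<and>
     set_borel_measurable lebesgue {0<..} g' \<and>
     set_integrable lebesgue {0<..} (\<lambda>s. (g' s)\<^sup>2) \<and>
     (\<forall>s>0. g s > 0) \<and> 0 < kernel_mass g"

definition kernel_A2 :: "(real \<Rightarrow> real) \<Rightarrow> (real \<Rightarrow> real) \<Rightarrow> bool" where
  "kernel_A2 g g' \<longleftrightarrow> (\<forall>s>0. g' s < 0) \<and>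
     (\<exists>k0>0. \<exists>k1>0. \<forall>s>0. - k0 * g s \<le> g' s \<and> g' s \<le> - k1 * g s)"

section \<open>The state space\<close>

definition L2_memory ::
  "(nat \<Rightarrow> real) \<Rightarrow> (nat \<Rightarrow> 'h::{complex_hilbert, second_countable_topology}) \<Rightarrow> real \<Rightarrow>
   (real \<Rightarrow> real) \<Rightarrow> (real \<Rightarrow> 'h) set" where
  "L2_memory \<xi> \<Psi> a g = {w. set_borel_measurable lebesgue {0<..} w \<and>
     (\<forall>s>0. w s \<in> frac_dom \<xi> \<Psi> (a/2)) \<and>
     set_integrable lebesgue {0<..} (\<lambda>s. g s * (norm (frac_pow \<xi> \<Psi> (a/2) (w s)))\<^sup>2)}"

text \<open>States are represented by \<open>(v, u, p, q, \<eta>)\<close> with an actual function \<open>\<eta>\<close>, of which only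
  the values on \<open>(0, \<infinity>)\<close> matter. Two states are equal as elements of the Hilbert space iff
  their difference has norm zero, which means that the memory components agree almost
  everywhere; all equations between states below are in this sense.\<close>

type_synonym 'h state = "'h \<times> 'h \<times> 'h \<times> 'h \<times> (real \<Rightarrow> 'h)"

fun state_add :: "'h::complex_hilbert state \<Rightarrow> 'h state \<Rightarrow> 'h state" where
  "state_add (v, u, p, q, \<eta>) (v', u', p', q', \<eta>') =
     (v + v', u + u', p + p', q + q', \<lambda>s. \<eta> s + \<eta>' s)"

fun state_scale :: "complex \<Rightarrow> 'h::complex_hilbert state \<Rightarrow> 'h state" where
  "state_scale c (v, u, p, q, \<eta>) =
     (c *\<^sub>C v, c *\<^sub>C u, c *\<^sub>C p, c *\<^sub>C q, \<lambda>s. c *\<^sub>C \<eta> s)"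

definition state_diff :: "'h::complex_hilbert state \<Rightarrow> 'h state \<Rightarrow> 'h state" where
  "state_diff X Y = state_add X (state_scale (-1) Y)"

definition state_space ::
  "(nat \<Rightarrow> real) \<Rightarrow> (nat \<Rightarrow> 'h::{complex_hilbert, second_countable_topology}) \<Rightarrow> real \<Rightarrow>
   (real \<Rightarrow> real) \<Rightarrow> 'h state set" where
  "state_space \<xi> \<Psi> a g =
     frac_dom \<xi> \<Psi> (1/2) \<times> UNIV \<times> frac_dom \<xi> \<Psi> (1/2) \<times> UNIV \<times> L2_memory \<xi> \<Psi> a g"

text \<open>This form is positive definite iff \<open>(\<alpha> - \<gamma>\<^sup>2 * \<beta>) * \<xi> 0 powr (1 - a) > kernel_mass g\<close>, which
  does not follow from \<open>a < 1\<close> and the kernel assumptions.\<close>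

fun state_inner ::
  "(nat \<Rightarrow> real) \<Rightarrow> (nat \<Rightarrow> 'h::{complex_hilbert, second_countable_topology}) \<Rightarrow> real \<Rightarrow>
   real \<Rightarrow> real \<Rightarrow> real \<Rightarrow> real \<Rightarrow> real \<Rightarrow> (real \<Rightarrow> real) \<Rightarrow> 'h state \<Rightarrow> 'h state \<Rightarrow> complex" where
  "state_inner \<xi> \<Psi> a \<rho> \<mu> \<alpha> \<beta> \<gamma> g (v, u, p, q, \<eta>) (v', u', p', q', \<eta>') =
     (let P = frac_pow \<xi> \<Psi> in
        complex_of_real (\<alpha> - \<gamma>\<^sup>2 * \<beta>) * cinner (P (1/2) v) (P (1/2) v')
      - complex_of_real (kernel_mass g) * cinner (P (a/2) v) (P (a/2) v')
      + complex_of_real \<rho> * cinner u u'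
      + complex_of_real \<beta> *
          cinner (\<gamma> *\<^sub>R P (1/2) v - P (1/2) p) (\<gamma> *\<^sub>R P (1/2) v' - P (1/2) p')
      + complex_of_real \<mu> * cinner q q'
      + (LINT s:{0<..}|lebesgue.
           complex_of_real (g s) * cinner (P (a/2) (\<eta> s)) (P (a/2) (\<eta>' s))))"

definition state_norm ::
  "(nat \<Rightarrow> real) \<Rightarrow> (nat \<Rightarrow> 'h::{complex_hilbert, second_countable_topology}) \<Rightarrow> real \<Rightarrow>
   real \<Rightarrow> real \<Rightarrow> real \<Rightarrow> real \<Rightarrow> real \<Rightarrow> (real \<Rightarrow> real) \<Rightarrow> 'h state \<Rightarrow> real" where
  "state_norm \<xi> \<Psi> a \<rho> \<mu> \<alpha> \<beta> \<gamma> g X = sqrt (Re (state_inner \<xi> \<Psi> a \<rho> \<mu> \<alpha> \<beta> \<gamma> g X X))"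

section \<open>The operator\<close>

definition has_memory_deriv ::
  "(nat \<Rightarrow> real) \<Rightarrow> (nat \<Rightarrow> 'h::{complex_hilbert, second_countable_topology}) \<Rightarrow> real \<Rightarrow>
   (real \<Rightarrow> real) \<Rightarrow> (real \<Rightarrow> 'h) \<Rightarrow> (real \<Rightarrow> 'h) \<Rightarrow> bool" where
  "has_memory_deriv \<xi> \<Psi> a g \<eta> w \<longleftrightarrow> weak_deriv_on_pos \<eta> w \<and> w \<in> L2_memory \<xi> \<Psi> a g"

definition memory_deriv ::
  "(nat \<Rightarrow> real) \<Rightarrow> (nat \<Rightarrow> 'h::{complex_hilbert, second_countable_topology}) \<Rightarrow> real \<Rightarrow>
   (real \<Rightarrow> real) \<Rightarrow> (real \<Rightarrow> 'h) \<Rightarrow> (real \<Rightarrow> 'h)" where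
  "memory_deriv \<xi> \<Psi> a g \<eta> = (SOME w. has_memory_deriv \<xi> \<Psi> a g \<eta> w)"

definition memory_mean ::
  "(real \<Rightarrow> real) \<Rightarrow> (real \<Rightarrow> 'h::{complex_hilbert, second_countable_topology}) \<Rightarrow> 'h" where
  "memory_mean g \<eta> = (LINT s:{0<..}|lebesgue. g s *\<^sub>R \<eta> s)"

text \<open>For \<open>\<eta>\<close> with values in the domain of the power \<open>a/2\<close> the integrand of
  \<open>\<integral> g(s) A\<^sup>a \<eta>(s) ds\<close> lives only in the dual scale (exponent \<open>-a/2\<close>), so the closed operator
  \<open>A\<^sup>a\<close> is taken out of the integral. The integral is an element of \<open>H\<close> iff
  \<open>\<integral> g(s) \<eta>(s) ds\<close> is in the domain of \<open>A\<^sup>a\<close>; this last condition in the domain below is what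
  makes the operator take values in the state space. The value \<open>\<eta>(0)\<close> is the trace at \<open>0\<close>.\<close>

definition op_dom ::
  "'h::{complex_hilbert, second_countable_topology} set \<Rightarrow> (nat \<Rightarrow> real) \<Rightarrow> (nat \<Rightarrow> 'h) \<Rightarrow>
   real \<Rightarrow> (real \<Rightarrow> real) \<Rightarrow> 'h state set" where
  "op_dom D \<xi> \<Psi> a g = {(v, u, p, q, \<eta>).
     v \<in> D \<and> u \<in> frac_dom \<xi> \<Psi> (1/2) \<and> p \<in> D \<and> q \<in> frac_dom \<xi> \<Psi> (1/2) \<and>
     \<eta> \<in> L2_memory \<xi> \<Psi> a g \<and> (\<eta> \<longlongrightarrow> 0) (at_right 0) \<and>
     (\<exists>w. has_memory_deriv \<xi> \<Psi> a g \<eta> w) \<and>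
     memory_mean g \<eta> \<in> frac_dom \<xi> \<Psi> a}"

fun op_A ::
  "('h \<Rightarrow> 'h) \<Rightarrow> (nat \<Rightarrow> real) \<Rightarrow> (nat \<Rightarrow> 'h::{complex_hilbert, second_countable_topology}) \<Rightarrow>
   real \<Rightarrow> real \<Rightarrow> real \<Rightarrow> real \<Rightarrow> real \<Rightarrow> real \<Rightarrow> (real \<Rightarrow> real) \<Rightarrow> 'h state \<Rightarrow> 'h state" where
  "op_A A \<xi> \<Psi> a \<rho> \<mu> \<alpha> \<beta> \<gamma> g (v, u, p, q, \<eta>) =
     (u,
      (1/\<rho>) *\<^sub>R (- \<alpha> *\<^sub>R A v + (\<gamma> * \<beta>) *\<^sub>R A p + kernel_mass g *\<^sub>R frac_pow \<xi> \<Psi> a v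
                 - frac_pow \<xi> \<Psi> a (memory_mean g \<eta>)),
      q,
      (1/\<mu>) *\<^sub>R (- \<beta> *\<^sub>R A p + (\<gamma> * \<beta>) *\<^sub>R A v),
      \<lambda>s. u - memory_deriv \<xi> \<Psi> a g \<eta> s)"

text \<open>Equivalent to the square root of the sum of the squares, with constants 1 and \<open>sqrt 2\<close>.\<close>

definition graph_norm :: "('x \<Rightarrow> real) \<Rightarrow> ('x \<Rightarrow> 'x) \<Rightarrow> 'x \<Rightarrow> real" where
  "graph_norm N B x = N x + N (B x)"

section \<open>Semigroups on the state space\<close>

definition contraction_C0_semigroup ::
  "'h::complex_hilbert state set \<Rightarrow> ('h state \<Rightarrow> real) \<Rightarrow> (real \<Rightarrow> 'h state \<Rightarrow> 'h state) \<Rightarrow> bool"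
  where
  "contraction_C0_semigroup V N T \<longleftrightarrow>
     (\<forall>t\<ge>0. \<forall>X\<in>V. T t X \<in> V \<and> N (T t X) \<le> N X) \<and>
     (\<forall>t\<ge>0. \<forall>X\<in>V. \<forall>Y\<in>V.
        N (state_diff (T t (state_add X Y)) (state_add (T t X) (T t Y))) = 0) \<and>
     (\<forall>t\<ge>0. \<forall>X\<in>V. \<forall>c. N (state_diff (T t (state_scale c X)) (state_scale c (T t X))) = 0) \<and>
     (\<forall>X\<in>V. N (state_diff (T 0 X) X) = 0) \<and>
     (\<forall>s\<ge>0. \<forall>t\<ge>0. \<forall>X\<in>V. N (state_diff (T (s + t) X) (T s (T t X))) = 0) \<and>
     (\<forall>X\<in>V. ((\<lambda>t. N (state_diff (T t X) X)) \<longlongrightarrow> 0) (at_right 0))"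

definition generator_graph ::
  "'h::complex_hilbert state set \<Rightarrow> ('h state \<Rightarrow> real) \<Rightarrow> (real \<Rightarrow> 'h state \<Rightarrow> 'h state) \<Rightarrow>
   ('h state \<times> 'h state) set" where
  "generator_graph V N T = {(X, Y). X \<in> V \<and> Y \<in> V \<and>
     ((\<lambda>t. N (state_diff (state_scale (complex_of_real (1/t)) (state_diff (T t X) X)) Y))
        \<longlongrightarrow> 0) (at_right 0)}"

definition closure_graph ::
  "'h::complex_hilbert state set \<Rightarrow> ('h state \<Rightarrow> real) \<Rightarrow> 'h state set \<Rightarrow> ('h state \<Rightarrow> 'h state) \<Rightarrow>
   ('h state \<times> 'h state) set" where
  "closure_graph V N D B = {(X, Y). X \<in> V \<and> Y \<in> V \<and>
     (\<forall>e>0. \<exists>Z\<in>D. N (state_diff Z X) < e \<and> N (state_diff (B Z) Y) < e)}"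

text \<open>The generator is the closure of the operator. A generator is closed, so this covers the
  case that the operator is itself the generator. For \<open>a > 0\<close> only the closure can be: on
  \<open>op_dom\<close> the components \<open>v\<close>, \<open>p\<close> are in the domain of \<open>A\<close>, whereas solving the resolvent
  equation gives \<open>A v\<close> in \<open>H\<close> only up to a term \<open>\<integral> g(s) A\<^sup>a \<eta>(s) ds\<close> of the dual scale.\<close>

definition generates ::
  "'h::complex_hilbert state set \<Rightarrow> ('h state \<Rightarrow> real) \<Rightarrow> 'h state set \<Rightarrow> ('h state \<Rightarrow> 'h state) \<Rightarrow>
   (real \<Rightarrow> 'h state \<Rightarrow> 'h state) \<Rightarrow> bool" where
  "generates V N D B T \<longleftrightarrow> generator_graph V N T = closure_graph V N D B"

end

(* Expand in the eigenbasis. Mode k is a damped linear system with parameter x = xi k. Its energy E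
   satisfies E' <= - k1 x^a h, where h is the squared norm of its memory component. Adding suitable
   cross terms to a multiple of x^(1-a) E gives a Lyapunov function, so that
   E t <= K exp (- c x^(a-1) (t - s)) E s, uniformly in k. On the graph of the generator,
   E <= C (x^a h + F/x) with F the energy of the time derivative, which does not increase; hence
   E (t/2) <= exp (- c1 t/2) E 0 + C F 0 / x. The exponential decay on [t/2, t] and
   exp (- r) <= C r^(-p) with r = c x^(a-1) t/2 and p = 1/(1-a) turn 1/x into t^(-p). Summing over k
   gives the decay of the squared norm. *)
theory Submission
  imports Defs
begin

text \<open>The generator is only the closure of the operator, and states count only up to null
  distance. So from a general pair \<open>(X, Y)\<close> of its graph the proof uses only what
  survives limits in \<open>N\<close>: linear equations between modes, which are bounded
  functionals, and two inequalities for the memory, whose weak derivative is not followed through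
  the limit. The analysis of one mode is set up with just these data. The kernel enters it through
  the two-sided bound in (A2): one side gives the dissipation, the other controls the derivative of
  the memory mean.

  The power \<open>x powr (1 - a)\<close> is a ratio: the cross terms recover damping of all
  components at the price of a multiple of \<open>x * h\<close>, while the energy dissipates only a
  multiple of \<open>x powr a * h\<close>. The resulting rate tends to \<open>0\<close> along the
  spectrum, so it gives no uniform decay; the gain of \<open>1 / x\<close> from the graph norm
  compensates for this, with the exponent for which the eigenvalue cancels.\<close>

section \<open>Complex Hilbert spaces and spectral powers\<close>

lemma norm_add_sq_le:
  fixes x y :: "'a::real_normed_vector"
  shows "(norm (x + y))\<^sup>2 \<le> 2 * (norm x)\<^sup>2 + 2 * (norm y)\<^sup>2"
proof -
  have "(norm (x + y))\<^sup>2 \<le> (norm x + norm y)\<^sup>2" by (intro power_mono norm_triangle_ineq) auto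
  also have "\<dots> \<le> 2 * (norm x)\<^sup>2 + 2 * (norm y)\<^sup>2"
    using sum_squares_bound[of "norm x" "norm y"] by (simp add: power2_sum)
  finally show ?thesis .
qed

lemma cinner_zero_left [simp]: "cinner 0 (y::'a::complex_hilbert) = 0"
  using cinner_add_left[of 0 0 y] by simp

lemma cinner_zero_right [simp]: "cinner x 0 = 0"
  using cinner_commute[of x 0] by simp

lemma cinner_add_right: "cinner x (y + z) = cinner x y + cinner x z"
  using cinner_add_left[of y z x] cinner_commute[of x] by (metis complex_cnj_add)

lemma cinner_scaleC_right: "cinner x (c *\<^sub>C y) = cnj c * cinner x y"
  using cinner_scaleC_left[of c y x] cinner_commute[of x] by (metis complex_cnj_mult)

lemma cinner_scaleR_left: "cinner (r *\<^sub>R x) y = of_real r * cinner x y"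
  by (simp add: scaleR_eq_scaleC cinner_scaleC_left)

lemma cinner_scaleR_right: "cinner x (r *\<^sub>R y) = of_real r * cinner x y"
  by (simp add: scaleR_eq_scaleC cinner_scaleC_right)

lemma cinner_minus_left: "cinner (- x) y = - cinner x y"
  by (rule minus_unique[symmetric]) (simp flip: cinner_add_left)

lemma cinner_diff_left: "cinner (x - y) z = cinner x z - cinner y z"
  using cinner_add_left[of x "- y" z] by (simp add: cinner_minus_left)

lemma cinner_diff_right: "cinner x (y - z) = cinner x y - cinner x z"
  using cinner_diff_left[of y z x] cinner_commute[of x] by (metis complex_cnj_diff)

lemma cinner_sum_left: "cinner (sum f I) y = (\<Sum>i\<in>I. cinner (f i) y)"
  by (induction I rule: infinite_finite_induct) (auto simp: cinner_add_left)

lemma cinner_sum_right: "cinner y (sum f I) = (\<Sum>i\<in>I. cinner y (f i))"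
  by (induction I rule: infinite_finite_induct) (auto simp: cinner_add_right)

text \<open>The class fixes the norm only through the square root of the real part. Conjugate
  symmetry removes the imaginary part; the real part is nonnegative because the real
  \<open>sqrt\<close> preserves signs and its value here is a norm.\<close>

lemma cinner_self: "cinner x x = of_real ((norm x)\<^sup>2)"
proof -
  have "Im (cinner x x) = 0" using cinner_commute[of x x] by (metis Reals_cnj_iff complex_is_Real_iff)
  moreover have "0 \<le> Re (cinner x x)"
    using norm_eq_sqrt_cinner[of x] norm_ge_zero[of x] by (metis real_sqrt_ge_0_iff)
  ultimately show ?thesis
    by (simp add: complex_eq_iff norm_eq_sqrt_cinner)
qed

lemma norm_scaleC: "norm (c *\<^sub>C x) = cmod c * norm x"
proof -
  have "complex_of_real ((norm (c *\<^sub>C x))\<^sup>2) = of_real ((cmod c * norm x)\<^sup>2)"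
    unfolding cinner_self[symmetric] cinner_scaleC_left cinner_scaleC_right
    by (simp add: cinner_self power_mult_distrib) (metis complex_norm_square mult.commute of_real_power)
  then have "(norm (c *\<^sub>C x))\<^sup>2 = (cmod c * norm x)\<^sup>2" by (simp only: of_real_eq_iff)
  then show ?thesis by (simp add: power2_eq_iff_nonneg)
qed

lemma scaleC_zero_left [simp]: "0 *\<^sub>C x = 0"
  using norm_scaleC[of 0 x] by simp

lemma scaleC_minus_one: "(- 1) *\<^sub>C x = - x"
  using scaleR_eq_scaleC[of "- 1" x] by simp

lemma cmod_cinner_le: "cmod (cinner x y) \<le> norm x * norm y"
proof (cases "y = 0")
  case False
  \<comment> \<open>\<open>c *\<^sub>C y\<close> is the orthogonal projection of \<open>x\<close>
    onto the line of \<open>y\<close>; the squared norm of the remainder is the defect in the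
    inequality.\<close>
  define c where "c = cinner x y / of_real ((norm y)\<^sup>2)"
  have ny: "norm y \<noteq> 0" using False by simp
  have "of_real ((norm (x - c *\<^sub>C y))\<^sup>2) = cinner (x - c *\<^sub>C y) (x - c *\<^sub>C y)"
    by (simp add: cinner_self)
  also have "\<dots> = of_real ((norm x)\<^sup>2) - cnj c * cinner x y - c * cinner y x + c * cnj c * of_real ((norm y)\<^sup>2)"
    by (simp add: cinner_diff_left cinner_diff_right cinner_scaleC_left cinner_scaleC_right cinner_self[of x] cinner_self[of y] algebra_simps)
  also have "c * cnj c * of_real ((norm y)\<^sup>2) = c * cinner y x"
    using ny cinner_commute[of y x] by (simp add: c_def power2_eq_square)
  also have "cnj c * cinner x y = of_real ((cmod (cinner x y))\<^sup>2 / (norm y)\<^sup>2)"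
    by (simp add: c_def mult.commute) (metis complex_norm_square of_real_power)
  finally have "complex_of_real ((norm (x - c *\<^sub>C y))\<^sup>2) =
      of_real ((norm x)\<^sup>2 - (cmod (cinner x y))\<^sup>2 / (norm y)\<^sup>2)" by simp
  then have "(norm (x - c *\<^sub>C y))\<^sup>2 = (norm x)\<^sup>2 - (cmod (cinner x y))\<^sup>2 / (norm y)\<^sup>2"
    by (simp only: of_real_eq_iff)
  then have "(cmod (cinner x y))\<^sup>2 / (norm y)\<^sup>2 \<le> (norm x)\<^sup>2" by (metis diff_ge_0_iff_ge zero_le_power2)
  then have "(cmod (cinner x y))\<^sup>2 \<le> (norm x * norm y)\<^sup>2"
    using ny by (simp add: divide_le_eq power_mult_distrib)
  then show ?thesis by (rule power2_le_imp_le) simp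
qed simp

lemma bounded_linear_cinner_left: "bounded_linear (\<lambda>x::'a::complex_hilbert. cinner x y)"
  by (rule bounded_linear_intro[where K = "norm y"])
    (auto simp: cinner_add_left cinner_scaleR_left cmod_cinner_le scaleR_conv_of_real)

lemma bounded_linear_scaleC_right: "bounded_linear (\<lambda>x::'a::complex_hilbert. c *\<^sub>C x)"
  by (rule bounded_linear_intro[where K = "cmod c"])
    (auto simp: scaleC_add_right norm_scaleC scaleR_eq_scaleC scaleC_scaleC mult.commute)

section \<open>Orthonormal expansions\<close>

locale onb =
  fixes \<Psi> :: "nat \<Rightarrow> 'h::complex_hilbert"
  assumes onb: "orthonormal_basis \<Psi>"
begin

lemma cinner_basis: "cinner (\<Psi> j) (\<Psi> k) = (if j = k then 1 else 0)"
  and basis_sums: "(\<lambda>k. cinner f (\<Psi> k) *\<^sub>C \<Psi> k) sums f"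
  using onb by (auto simp: orthonormal_basis_def)

lemma norm_sum_basis:
  assumes "finite I"
  shows "(norm (\<Sum>k\<in>I. c k *\<^sub>C \<Psi> k))\<^sup>2 = (\<Sum>k\<in>I. (cmod (c k))\<^sup>2)"
proof -
  have "complex_of_real ((norm (\<Sum>k\<in>I. c k *\<^sub>C \<Psi> k))\<^sup>2) = (\<Sum>k\<in>I. \<Sum>j\<in>I. c j * (cnj (c k) * (if j = k then 1 else 0)))"
    unfolding cinner_self[symmetric]
    by (simp add: cinner_sum_left cinner_sum_right cinner_scaleC_left cinner_scaleC_right cinner_basis sum_distrib_left mult_ac)
  also have "\<dots> = (\<Sum>k\<in>I. c k * cnj (c k))"
    using assms by (simp add: if_distrib[of "\<lambda>x. _ * x"] sum.delta cong: if_cong)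
  also have "\<dots> = of_real (\<Sum>k\<in>I. (cmod (c k))\<^sup>2)"
    by (simp add: complex_norm_square del: of_real_power)
  finally show ?thesis by (simp only: of_real_eq_iff)
qed

lemma parseval: "(\<lambda>k. (cmod (cinner f (\<Psi> k)))\<^sup>2) sums (norm f)\<^sup>2"
proof -
  have "(\<lambda>n. (norm (\<Sum>k<n. cinner f (\<Psi> k) *\<^sub>C \<Psi> k))\<^sup>2) \<longlonglongrightarrow> (norm f)\<^sup>2"
    using basis_sums[of f] unfolding sums_def by (intro tendsto_intros)
  then show ?thesis by (simp add: norm_sum_basis sums_def)
qed

text \<open>Pythagoras turns blocks of the vector series into blocks of the squared coefficients,
  and the Cauchy criterion transfers.\<close>

lemma summable_basis:
  assumes "summable (\<lambda>k. (cmod (c k))\<^sup>2)"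
  shows "summable (\<lambda>k. c k *\<^sub>C \<Psi> k)"
proof (subst summable_Cauchy, intro allI impI)
  fix e :: real assume e: "0 < e"
  then obtain N where N: "\<And>m n. N \<le> m \<Longrightarrow> norm (\<Sum>k=m..<n. (cmod (c k))\<^sup>2) < e\<^sup>2"
    using assms[unfolded summable_Cauchy, rule_format, of "e\<^sup>2"] by auto
  have "norm (\<Sum>k=m..<n. c k *\<^sub>C \<Psi> k) < e" if "N \<le> m" for m n
  proof -
    have "(norm (\<Sum>k=m..<n. c k *\<^sub>C \<Psi> k))\<^sup>2 < e\<^sup>2"
      using N[OF that, of n] by (simp add: norm_sum_basis sum_nonneg)
    then show ?thesis using e by (intro power2_less_imp_less[of _ e]) auto
  qed
  then show "\<exists>N. \<forall>m\<ge>N. \<forall>n. norm (\<Sum>k=m..<n. c k *\<^sub>C \<Psi> k) < e" by blast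
qed

lemma cinner_suminf_basis:
  assumes "summable (\<lambda>k. (cmod (c k))\<^sup>2)"
  shows "cinner (\<Sum>k. c k *\<^sub>C \<Psi> k) (\<Psi> j) = c j"
proof -
  have "cinner (\<Sum>k. c k *\<^sub>C \<Psi> k) (\<Psi> j) = (\<Sum>k. cinner (c k *\<^sub>C \<Psi> k) (\<Psi> j))"
    using bounded_linear.suminf[OF bounded_linear_cinner_left summable_basis[OF assms]] by simp
  also have "\<dots> = (\<Sum>k. if k = j then c j else 0)"
    by (intro arg_cong[of _ _ suminf] ext) (auto simp: cinner_scaleC_left cinner_basis)
  also have "\<dots> = c j" using sums_single[of j "\<lambda>_. c j"] by (simp add: sums_iff)
  finally show ?thesis .
qed

end

section \<open>Fractional powers and the operator in the eigenbasis\<close>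

locale spectral = onb \<Psi> for \<Psi> :: "nat \<Rightarrow> 'h::complex_hilbert" +
  fixes D :: "'h set" and A :: "'h \<Rightarrow> 'h" and \<xi> :: "nat \<Rightarrow> real"
  assumes self_adjoint: "self_adjoint D A" and eigensystem: "eigensystem D A \<xi> \<Psi>"
begin

lemma eigenvalue_ge: "\<xi> 0 \<le> \<xi> k"
  using eigensystem strict_mono_less_eq[of \<xi> 0 k] by (simp add: eigensystem_def)

lemma eigenvalue_pos: "0 < \<xi> k"
  using eigensystem eigenvalue_ge[of k] by (simp add: eigensystem_def)

lemma frac_dom_iff: "f \<in> frac_dom \<xi> \<Psi> r \<longleftrightarrow> summable (\<lambda>k. (cmod ((\<xi> k powr r) *\<^sub>R cinner f (\<Psi> k)))\<^sup>2)"
proof -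
  have "\<xi> k powr (2 * r) = (\<xi> k powr r)\<^sup>2" for k by (simp add: power2_eq_square flip: powr_add)
  then show ?thesis by (simp add: frac_dom_def power_mult_distrib)
qed

lemma frac_pow_eq: "frac_pow \<xi> \<Psi> r f = (\<Sum>k. ((\<xi> k powr r) *\<^sub>R cinner f (\<Psi> k)) *\<^sub>C \<Psi> k)"
  by (simp add: frac_pow_def scaleR_eq_scaleC scaleC_scaleC scaleR_conv_of_real)

lemma cinner_frac_pow:
  assumes "f \<in> frac_dom \<xi> \<Psi> r"
  shows "cinner (frac_pow \<xi> \<Psi> r f) (\<Psi> k) = of_real (\<xi> k powr r) * cinner f (\<Psi> k)"
  using assms cinner_suminf_basis[of "\<lambda>k. (\<xi> k powr r) *\<^sub>R cinner f (\<Psi> k)" k]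
  by (simp add: frac_dom_iff frac_pow_eq scaleR_conv_of_real)

lemma norm_frac_pow_sums:
  assumes "f \<in> frac_dom \<xi> \<Psi> r"
  shows "(\<lambda>k. \<xi> k powr (2 * r) * (cmod (cinner f (\<Psi> k)))\<^sup>2) sums (norm (frac_pow \<xi> \<Psi> r f))\<^sup>2"
proof -
  have "\<xi> k powr (2 * r) = (\<xi> k powr r)\<^sup>2" for k by (simp add: power2_eq_square flip: powr_add)
  then show ?thesis
    using parseval[of "frac_pow \<xi> \<Psi> r f"] by (simp add: cinner_frac_pow[OF assms] norm_mult power_mult_distrib)
qed

text \<open>The spectrum is bounded below by \<open>\<xi> 0 > 0\<close>, so a power with the
  exponent \<open>2 * (r - r') \<le> 0\<close> is largest at \<open>\<xi> 0\<close>.\<close>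

lemma frac_dom_mono:
  assumes "r \<le> r'" "f \<in> frac_dom \<xi> \<Psi> r'"
  shows "f \<in> frac_dom \<xi> \<Psi> r"
proof -
  have s: "summable (\<lambda>k. \<xi> 0 powr (2 * (r - r')) * (\<xi> k powr (2 * r') * (cmod (cinner f (\<Psi> k)))\<^sup>2))"
    using assms by (intro summable_mult) (simp add: frac_dom_def)
  have le: "\<xi> k powr (2 * r) * (cmod (cinner f (\<Psi> k)))\<^sup>2 \<le>
    \<xi> 0 powr (2 * (r - r')) * (\<xi> k powr (2 * r') * (cmod (cinner f (\<Psi> k)))\<^sup>2)" for k
  proof -
    have "\<xi> k powr (2 * r) = \<xi> k powr (2 * (r - r')) * \<xi> k powr (2 * r')" by (simp add: right_diff_distrib flip: powr_add)
    also have "\<dots> \<le> \<xi> 0 powr (2 * (r - r')) * \<xi> k powr (2 * r')"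
      using assms eigenvalue_ge[of k] eigenvalue_pos[of 0] by (intro mult_right_mono powr_mono2') auto
    finally show ?thesis by (simp add: mult_right_mono mult.assoc[symmetric])
  qed
  show ?thesis
    unfolding frac_dom_def mem_Collect_eq
    by (rule summable_comparison_test'[OF s, of 0]) (use le in \<open>simp add: abs_mult\<close>)
qed

lemma frac_dom_add:
  assumes "f \<in> frac_dom \<xi> \<Psi> r" "h \<in> frac_dom \<xi> \<Psi> r"
  shows "f + h \<in> frac_dom \<xi> \<Psi> r"
proof -
  have s: "summable (\<lambda>k. 2 * (\<xi> k powr (2 * r) * (cmod (cinner f (\<Psi> k)))\<^sup>2 + \<xi> k powr (2 * r) * (cmod (cinner h (\<Psi> k)))\<^sup>2))"
    using assms by (intro summable_mult summable_add) (auto simp: frac_dom_def)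
  have le: "\<xi> k powr (2 * r) * (cmod (cinner (f + h) (\<Psi> k)))\<^sup>2 \<le>
     2 * (\<xi> k powr (2 * r) * (cmod (cinner f (\<Psi> k)))\<^sup>2 + \<xi> k powr (2 * r) * (cmod (cinner h (\<Psi> k)))\<^sup>2)" for k
  proof -
    have "\<xi> k powr (2 * r) * (cmod (cinner (f + h) (\<Psi> k)))\<^sup>2 \<le>
      \<xi> k powr (2 * r) * (2 * (cmod (cinner f (\<Psi> k)))\<^sup>2 + 2 * (cmod (cinner h (\<Psi> k)))\<^sup>2)"
      unfolding cinner_add_left by (intro mult_left_mono norm_add_sq_le) auto
    then show ?thesis by (simp add: algebra_simps)
  qed
  show ?thesis
    unfolding frac_dom_def mem_Collect_eq
    by (rule summable_comparison_test'[OF s, of 0]) (use le in \<open>simp add: abs_mult\<close>)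
qed

lemma frac_dom_scaleC: "f \<in> frac_dom \<xi> \<Psi> r \<Longrightarrow> c *\<^sub>C f \<in> frac_dom \<xi> \<Psi> r"
  unfolding frac_dom_def
  by (auto simp: cinner_scaleC_left norm_mult power_mult_distrib mult.left_commute intro: summable_mult)

lemma cinner_operator:
  assumes "v \<in> D"
  shows "cinner (A v) (\<Psi> k) = of_real (\<xi> k) * cinner v (\<Psi> k)"
proof -
  have "\<Psi> k \<in> D" "A (\<Psi> k) = \<xi> k *\<^sub>R \<Psi> k" using eigensystem by (auto simp: eigensystem_def)
  then have "cinner (A v) (\<Psi> k) = cinner v (\<xi> k *\<^sub>R \<Psi> k)"
    using self_adjoint assms unfolding self_adjoint_def by blast
  then show ?thesis by (simp add: cinner_scaleR_right)
qed

text \<open>Parseval for \<open>A v\<close> is the membership in the domain of the power 1; smaller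
  exponents follow by monotonicity.\<close>

lemma operator_domain_subset: "r \<le> 1 \<Longrightarrow> v \<in> D \<Longrightarrow> v \<in> frac_dom \<xi> \<Psi> r"
proof (rule frac_dom_mono)
  assume "v \<in> D"
  then have "(cmod (cinner (A v) (\<Psi> k)))\<^sup>2 = \<xi> k powr (2 * 1) * (cmod (cinner v (\<Psi> k)))\<^sup>2" for k
    using eigenvalue_pos[of k] by (simp add: cinner_operator norm_mult power_mult_distrib)
  then show "v \<in> frac_dom \<xi> \<Psi> 1"
    using parseval[of "A v"] by (simp add: frac_dom_def sums_iff)
qed

end

section \<open>Square-integrable functions\<close>

definition square_integrable :: "'a measure \<Rightarrow> ('a \<Rightarrow> complex) \<Rightarrow> bool" where
  "square_integrable M f \<longleftrightarrow> f \<in> borel_measurable M \<and> integrable M (\<lambda>s. (cmod (f s))\<^sup>2)"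

definition sq_norm :: "'a measure \<Rightarrow> ('a \<Rightarrow> complex) \<Rightarrow> real" where
  "sq_norm M f = (\<integral>s. (cmod (f s))\<^sup>2 \<partial>M)"

lemma sq_norm_nonneg [simp]: "0 \<le> sq_norm M f"
  by (simp add: sq_norm_def)

lemma square_integrable_prod:
  assumes "square_integrable M f" "square_integrable M h"
  shows "integrable M (\<lambda>s. cmod (f s) * cmod (h s))"
proof (rule Bochner_Integration.integrable_bound)
  show "integrable M (\<lambda>s. (cmod (f s))\<^sup>2 + (cmod (h s))\<^sup>2)"
    using assms by (simp add: square_integrable_def)
  show "(\<lambda>s. cmod (f s) * cmod (h s)) \<in> borel_measurable M"
    using assms by (auto simp: square_integrable_def)
  have "cmod z * cmod w \<le> (cmod z)\<^sup>2 + (cmod w)\<^sup>2" for z w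
    using sum_squares_bound[of "cmod z" "cmod w"] mult_nonneg_nonneg[OF norm_ge_zero[of z] norm_ge_zero[of w]]
    unfolding mult.assoc by linarith
  then show "AE s in M. norm (cmod (f s) * cmod (h s)) \<le> norm ((cmod (f s))\<^sup>2 + (cmod (h s))\<^sup>2)"
    by auto
qed

lemma square_integrable_mult_cnj:
  assumes "square_integrable M f" "square_integrable M h"
  shows "integrable M (\<lambda>s. f s * cnj (h s))"
proof (rule Bochner_Integration.integrable_bound[OF square_integrable_prod[OF assms]])
  show "(\<lambda>s. f s * cnj (h s)) \<in> borel_measurable M"
    using assms unfolding square_integrable_def
    by (intro borel_measurable_times borel_measurable_continuous_on[of cnj] continuous_intros) auto
qed (simp add: norm_mult)

lemma square_integrable_add:
  assumes "square_integrable M f" "square_integrable M h"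
  shows "square_integrable M (\<lambda>s. f s + h s)"
  unfolding square_integrable_def
proof
  show m: "(\<lambda>s. f s + h s) \<in> borel_measurable M"
    using assms unfolding square_integrable_def by (intro borel_measurable_add) auto
  show "integrable M (\<lambda>s. (cmod (f s + h s))\<^sup>2)"
  proof (rule Bochner_Integration.integrable_bound)
    show "integrable M (\<lambda>s. 2 * ((cmod (f s))\<^sup>2 + (cmod (h s))\<^sup>2))"
      using assms by (simp add: square_integrable_def)
    show "AE s in M. norm ((cmod (f s + h s))\<^sup>2) \<le> norm (2 * ((cmod (f s))\<^sup>2 + (cmod (h s))\<^sup>2))"
      using norm_add_sq_le by (intro AE_I2) (simp add: distrib_left)
  qed (use m in auto)
qed

lemma square_integrable_cmult:
  "square_integrable M f \<Longrightarrow> square_integrable M (\<lambda>s. c * f s)"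
  by (auto simp: square_integrable_def norm_mult power_mult_distrib)

lemma square_integrable_const:
  "finite_measure M \<Longrightarrow> square_integrable M (\<lambda>s. c)"
  by (auto simp: square_integrable_def finite_measure.integrable_const)

lemma square_integrable_integrable:
  assumes "finite_measure M" "square_integrable M f"
  shows "integrable M f"
  using square_integrable_mult_cnj[OF assms(2) square_integrable_const[OF assms(1), of 1]] by simp

lemma square_integrable_cauchy_schwarz:
  assumes f: "square_integrable M f" and h: "square_integrable M h"
  shows "(\<integral>s. cmod (f s) * cmod (h s) \<partial>M)\<^sup>2 \<le> sq_norm M f * sq_norm M h"
proof -
  define I where "I = (\<integral>s. cmod (f s) * cmod (h s) \<partial>M)"
  have I: "0 \<le> I" by (simp add: I_def)
  \<comment> \<open>The integral of \<open>(|f| - t |h|)^2\<close> is a nonnegative quadratic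
    polynomial in \<open>t\<close>.\<close>
  have *: "0 \<le> sq_norm M f - 2 * t * I + t\<^sup>2 * sq_norm M h" for t
  proof -
    have "0 \<le> (\<integral>s. (cmod (f s) - t * cmod (h s))\<^sup>2 \<partial>M)" by simp
    also have "\<dots> = (\<integral>s. ((cmod (f s))\<^sup>2 - 2 * t * (cmod (f s) * cmod (h s))) + t\<^sup>2 * (cmod (h s))\<^sup>2 \<partial>M)"
      by (simp add: power2_eq_square algebra_simps)
    also have "\<dots> = sq_norm M f - 2 * t * I + t\<^sup>2 * sq_norm M h"
      using square_integrable_prod[OF f h] f h by (simp add: square_integrable_def sq_norm_def I_def)
    finally show ?thesis .
  qed
  show ?thesis
  proof (cases "sq_norm M h = 0")
    case True
    have "I = 0"
    proof (rule ccontr)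
      assume "I \<noteq> 0"
      \<comment> \<open>The quadratic term has vanished, and this \<open>t\<close> makes the
        remaining affine expression equal to \<open>-1\<close>.\<close>
      with *[of "(sq_norm M f + 1) / (2 * I)"] True show False by simp
    qed
    then show ?thesis using True by (simp add: I_def)
  next
    case False
    then have "0 < sq_norm M h" using sq_norm_nonneg[of M h] by linarith
    \<comment> \<open>The minimum of the quadratic polynomial.\<close>
    with *[of "I / sq_norm M h"] show ?thesis
      by (simp add: I_def[symmetric] power2_eq_square field_simps)
  qed
qed

lemma cmod_integral_mult_cnj_le:
  assumes "square_integrable M f" "square_integrable M h"
  shows "cmod (\<integral>s. f s * cnj (h s) \<partial>M) \<le> sqrt (sq_norm M f) * sqrt (sq_norm M h)"
proof -
  have "cmod (\<integral>s. f s * cnj (h s) \<partial>M) \<le> (\<integral>s. cmod (f s * cnj (h s)) \<partial>M)"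
    by (rule integral_norm_bound)
  also have "\<dots> = (\<integral>s. cmod (f s) * cmod (h s) \<partial>M)" by (simp add: norm_mult)
  also have "\<dots> \<le> sqrt (sq_norm M f * sq_norm M h)"
    using square_integrable_cauchy_schwarz[OF assms] by (rule real_le_rsqrt)
  finally show ?thesis by (simp add: real_sqrt_mult)
qed

lemma cmod_integral_sq_le:
  assumes "finite_measure M" "square_integrable M f"
  shows "(cmod (\<integral>s. f s \<partial>M))\<^sup>2 \<le> measure M (space M) * sq_norm M f"
proof -
  have "cmod (\<integral>s. f s \<partial>M) \<le> sqrt (sq_norm M f) * sqrt (sq_norm M (\<lambda>_. 1))"
    using cmod_integral_mult_cnj_le[OF assms(2) square_integrable_const[OF assms(1), of 1]] by simp
  then have "(cmod (\<integral>s. f s \<partial>M))\<^sup>2 \<le> (sqrt (sq_norm M f) * sqrt (sq_norm M (\<lambda>_. 1)))\<^sup>2"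
    by (rule power_mono) simp
  then show ?thesis by (simp add: power_mult_distrib sq_norm_def mult.commute)
qed

section \<open>Integration by parts against the kernel\<close>

text \<open>Carrying the half-line in the measure turns the set integrals of the definitions into
  plain integrals, to which Fubini on \<open>pos_line\<close> times itself applies.\<close>

abbreviation pos_line :: "real measure" where
  "pos_line \<equiv> restrict_space lebesgue {0<..}"

lemma space_pos_line: "space pos_line = {0<..}"
  by (simp add: space_restrict_space)

lemma set_lebesgue_integral_pos_line:
  fixes f :: "real \<Rightarrow> 'b::{banach, second_countable_topology}"
  shows "(LINT s:{0<..}|lebesgue. f s) = (\<integral>s. f s \<partial>pos_line)"
  by (simp add: set_lebesgue_integral_def integral_restrict_space)

lemma set_integrable_pos_line:
  fixes f :: "real \<Rightarrow> 'b::{banach, second_countable_topology}"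
  shows "set_integrable lebesgue {0<..} f \<longleftrightarrow> integrable pos_line f"
  by (simp add: set_integrable_def integrable_restrict_space)

lemma set_borel_measurable_pos_line:
  fixes f :: "real \<Rightarrow> 'b::real_normed_vector"
  shows "set_borel_measurable lebesgue {0<..} f \<longleftrightarrow> f \<in> borel_measurable pos_line"
  by (simp add: set_borel_measurable_def borel_measurable_restrict_space_iff)

lemma measurable_ident_pos_line [measurable]: "(\<lambda>s. s) \<in> borel_measurable pos_line"
  by (intro measurable_restrict_space1 measurable_completion) simp

lemma sigma_finite_pos_line: "sigma_finite_measure pos_line"
proof (rule sigma_finite_measure_restrict_space)
  show "sigma_finite_measure (lebesgue :: real measure)"
  proof
    show "\<exists>A::real set set. countable A \<and> A \<subseteq> sets lebesgue \<and> \<Union> A = space lebesgue \<and> (\<forall>a\<in>A. emeasure lebesgue a \<noteq> \<infinity>)"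
    proof (intro exI[of _ "range (\<lambda>n::nat. {- real n..real n})"] conjI)
      show "\<Union> (range (\<lambda>n::nat. {- real n..real n})) = space lebesgue"
      proof (auto)
        fix x :: real
        obtain n :: nat where "\<bar>x\<bar> \<le> real n" using real_arch_simple by blast
        then show "\<exists>n::nat. - real n \<le> x \<and> x \<le> real n" by (auto intro!: exI[of _ n])
      qed
    qed auto
  qed
qed simp

lemma integrable_pos_line_Icc:
  fixes f :: "real \<Rightarrow> 'b::{banach, second_countable_topology}"
  assumes "0 < s"
  shows "set_integrable lebesgue {s..t} f \<longleftrightarrow> integrable pos_line (\<lambda>r. indicator {s..t} r *\<^sub>R f r)"
    and "(LINT r:{s..t}|lebesgue. f r) = (\<integral>r. indicator {s..t} r *\<^sub>R f r \<partial>pos_line)"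
proof -
  have *: "indicator {0<..} r * indicator {s..t} r = (indicator {s..t} r :: real)" for r
    using assms by (auto simp: indicator_def)
  show "set_integrable lebesgue {s..t} f \<longleftrightarrow> integrable pos_line (\<lambda>r. indicator {s..t} r *\<^sub>R f r)"
    by (simp add: set_integrable_def integrable_restrict_space *)
  show "(LINT r:{s..t}|lebesgue. f r) = (\<integral>r. indicator {s..t} r *\<^sub>R f r \<partial>pos_line)"
    by (simp add: set_lebesgue_integral_def integral_restrict_space *)
qed

interpretation pos_line: sigma_finite_measure pos_line
  by (rule sigma_finite_pos_line)

interpretation pos_line_pair: pair_sigma_finite pos_line pos_line ..

lemma measurable_le_pos_line [measurable]:
  "(\<lambda>(s, r). indicator {..r} s :: real) \<in> borel_measurable (pos_line \<Otimes>\<^sub>M pos_line)"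
proof -
  have "(\<lambda>p. fst p) \<in> borel_measurable (pos_line \<Otimes>\<^sub>M pos_line)" "(\<lambda>p. snd p) \<in> borel_measurable (pos_line \<Otimes>\<^sub>M pos_line)"
    using measurable_compose[OF measurable_fst measurable_ident_pos_line]
      measurable_compose[OF measurable_snd measurable_ident_pos_line] by auto
  then have "(\<lambda>p. if fst p \<le> snd p then 1 else 0 :: real) \<in> borel_measurable (pos_line \<Otimes>\<^sub>M pos_line)"
    by (intro measurable_If borel_measurable_const) (rule borel_measurable_le)
  then show ?thesis by (simp add: split_beta' indicator_def of_bool_def)
qed

text \<open>Fubini on the region \<open>s \<le> r\<close>. Since \<open>k\<close> is nonnegative,
  integrating the norm over \<open>r\<close> gives the norm of the integrand in \<open>int\<close>,
  so that hypothesis is the absolute integrability which Fubini asks for.\<close>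

lemma pos_line_swap:
  fixes w :: "real \<Rightarrow> 'b::{banach, second_countable_topology}" and k :: "real \<Rightarrow> real"
  assumes w: "w \<in> borel_measurable pos_line" and k: "k \<in> borel_measurable pos_line"
    and k0: "\<And>r. 0 < r \<Longrightarrow> 0 \<le> k r"
    and ki: "\<And>s. 0 < s \<Longrightarrow> integrable pos_line (\<lambda>r. indicator {..r} s * k r)"
    and int: "integrable pos_line (\<lambda>s. (\<integral>r. indicator {..r} s * k r \<partial>pos_line) *\<^sub>R w s)"
  shows "(\<integral>s. (\<integral>r. indicator {..r} s * k r \<partial>pos_line) *\<^sub>R w s \<partial>pos_line) =
    (\<integral>r. k r *\<^sub>R (\<integral>s. indicator {..r} s *\<^sub>R w s \<partial>pos_line) \<partial>pos_line)"
proof -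
  define f where "f = (\<lambda>(s, r). (indicator {..r} s * k r) *\<^sub>R w s)"
  have fm: "f \<in> borel_measurable (pos_line \<Otimes>\<^sub>M pos_line)"
    using measurable_le_pos_line measurable_compose[OF measurable_snd k] measurable_compose[OF measurable_fst w]
    unfolding f_def split_beta' by (intro borel_measurable_scaleR borel_measurable_times) auto
  have inner: "(\<integral>r. norm (f (s, r)) \<partial>pos_line) = norm ((\<integral>r. indicator {..r} s * k r \<partial>pos_line) *\<^sub>R w s)"
    if s: "0 < s" for s
  proof -
    have "(\<integral>r. norm (f (s, r)) \<partial>pos_line) = (\<integral>r. (indicator {..r} s * k r) * norm (w s) \<partial>pos_line)"
      using k0 by (intro Bochner_Integration.integral_cong) (auto simp: f_def space_pos_line abs_mult)
    also have "\<dots> = (\<integral>r. indicator {..r} s * k r \<partial>pos_line) * norm (w s)" by simp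
    also have "\<dots> = norm ((\<integral>r. indicator {..r} s * k r \<partial>pos_line) *\<^sub>R w s)"
    proof -
      have "0 \<le> (\<integral>r. indicator {..r} s * k r \<partial>pos_line)"
        using k0 by (intro integral_nonneg_AE AE_I2) (auto simp: space_pos_line)
      then show ?thesis by simp
    qed
    finally show ?thesis .
  qed
  have fi: "integrable (pos_line \<Otimes>\<^sub>M pos_line) f"
  proof (rule pos_line_pair.Fubini_integrable[OF fm])
    show "integrable pos_line (\<lambda>s. \<integral>r. norm (f (s, r)) \<partial>pos_line)"
      using integrable_norm[OF int] by (rule Bochner_Integration.integrable_cong[THEN iffD1, rotated 2])
        (auto simp: inner space_pos_line)
    show "AE s in pos_line. integrable pos_line (\<lambda>r. f (s, r))"
      using ki by (intro AE_I2) (auto simp: f_def space_pos_line)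
  qed
  have "(\<integral>s. (\<integral>r. indicator {..r} s * k r \<partial>pos_line) *\<^sub>R w s \<partial>pos_line) = (\<integral>s. (\<integral>r. f (s, r) \<partial>pos_line) \<partial>pos_line)"
    using ki by (intro Bochner_Integration.integral_cong) (auto simp: f_def space_pos_line)
  also have "\<dots> = (\<integral>r. (\<integral>s. f (s, r) \<partial>pos_line) \<partial>pos_line)"
    using pos_line_pair.Fubini_integral[of "\<lambda>s r. f (s, r)"] fi by simp
  also have "\<dots> = (\<integral>r. k r *\<^sub>R (\<integral>s. indicator {..r} s *\<^sub>R w s \<partial>pos_line) \<partial>pos_line)"
  proof (intro Bochner_Integration.integral_cong refl)
    fix r
    have "(\<integral>s. f (s, r) \<partial>pos_line) = (\<integral>s. k r *\<^sub>R indicator {..r} s *\<^sub>R w s \<partial>pos_line)"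
      by (intro Bochner_Integration.integral_cong) (auto simp: f_def mult.commute)
    also have "\<dots> = k r *\<^sub>R (\<integral>s. indicator {..r} s *\<^sub>R w s \<partial>pos_line)"
      by (rule integral_scaleR_right)
    finally show "(\<integral>s. f (s, r) \<partial>pos_line) = k r *\<^sub>R (\<integral>s. indicator {..r} s *\<^sub>R w s \<partial>pos_line)" .
  qed
  finally show ?thesis .
qed

lemma AE_pos_line_neq: "AE s in pos_line. s \<noteq> c"
proof -
  have "{c} \<in> null_sets lebesgue" by simp
  then have "AE s in lebesgue. s \<noteq> c" by (auto intro: AE_I'[of "{c}"])
  then have "AE s in lebesgue. s \<in> {0<..} \<longrightarrow> s \<noteq> c" by eventually_elim simp
  then show ?thesis by (subst AE_restrict_space_iff) auto
qed

text \<open>Split the double integral of \<open>w s * cnj (w r)\<close> along the diagonal.\<close>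

lemma pos_line_square:
  fixes w :: "real \<Rightarrow> complex"
  assumes w: "integrable pos_line w"
  defines "F \<equiv> \<lambda>r. \<integral>s. indicator {..r} s *\<^sub>R w s \<partial>pos_line"
  shows "integrable pos_line (\<lambda>r. w r * cnj (F r))"
    and "(cmod (\<integral>s. w s \<partial>pos_line))\<^sup>2 = (\<integral>r. 2 * Re (w r * cnj (F r)) \<partial>pos_line)"
proof -
  note wm = borel_measurable_integrable[OF w]
  have cm: "(\<lambda>r. cnj (w r)) \<in> borel_measurable pos_line"
    using wm by (intro borel_measurable_continuous_on[of cnj] continuous_intros)
  have ci: "integrable pos_line (\<lambda>r. cnj (w r))" using w by simp
  define P where "P = (\<lambda>(s, r). w s * cnj (w r))"
  define f where "f = (\<lambda>(s, r). (indicator {..r} s :: real) *\<^sub>R (w s * cnj (w r)))"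
  have Pm: "P \<in> borel_measurable (pos_line \<Otimes>\<^sub>M pos_line)"
    using measurable_compose[OF measurable_fst wm] measurable_compose[OF measurable_snd cm]
    unfolding P_def split_beta' by (intro borel_measurable_times) auto
  have fm: "f \<in> borel_measurable (pos_line \<Otimes>\<^sub>M pos_line)"
    using measurable_le_pos_line Pm unfolding f_def P_def split_beta' by (intro borel_measurable_scaleR) auto
  have Pi: "integrable (pos_line \<Otimes>\<^sub>M pos_line) P"
    using w by (intro pos_line_pair.Fubini_integrable[OF Pm]) (auto simp: P_def norm_mult)
  have fi: "integrable (pos_line \<Otimes>\<^sub>M pos_line) f"
    by (rule Bochner_Integration.integrable_bound[OF Pi fm]) (auto simp: f_def P_def norm_mult indicator_def)
  have Fi: "integrable pos_line (\<lambda>s. indicator {..r} s *\<^sub>R w s)" for r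
    using w by (intro Bochner_Integration.integrable_bound[OF w]) (auto simp: indicator_def)
  have snd: "(\<integral>s. f (s, r) \<partial>pos_line) = F r * cnj (w r)" for r
  proof -
    have "(\<integral>s. f (s, r) \<partial>pos_line) = (\<integral>s. (indicator {..r} s *\<^sub>R w s) * cnj (w r) \<partial>pos_line)"
      by (simp add: f_def)
    also have "\<dots> = F r * cnj (w r)" unfolding F_def by (rule Bochner_Integration.integral_mult_left) (rule Fi)
    finally show ?thesis .
  qed
  have "integrable pos_line (\<lambda>r. F r * cnj (w r))"
    using pos_line_pair.integrable_snd[of "\<lambda>s r. f (s, r)"] fi by (simp add: snd)
  from integrable_cnj[OF this]
  show int: "integrable pos_line (\<lambda>r. w r * cnj (F r))" by (simp add: mult.commute)
  define I where "I = (\<integral>s. w s \<partial>pos_line)"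
  have "I * cnj I = (\<integral>r. I * cnj (w r) \<partial>pos_line)" using ci by (simp add: I_def)
  also have "\<dots> = (\<integral>r. (F r * cnj (w r)) + cnj (F r * cnj (w r)) \<partial>pos_line)"
  proof -
    \<comment> \<open>For fixed \<open>s\<close>, the points \<open>r \<ge> s\<close> contribute
      \<open>I - F s\<close>. The point \<open>r = s\<close> is counted in \<open>F s\<close> as
      well, so the integrands agree only almost everywhere.\<close>
    have up: "(\<integral>r. f (s, r) \<partial>pos_line) = w s * cnj (I - F s)" if "0 < s" for s
    proof -
      have "(\<integral>r. f (s, r) \<partial>pos_line) = (\<integral>r. w s * cnj (w r - indicator {..s} r *\<^sub>R w r) \<partial>pos_line)"
      proof (rule integral_cong_AE)
        show "AE r in pos_line. f (s, r) = w s * cnj (w r - indicator {..s} r *\<^sub>R w r)"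
          using AE_pos_line_neq[of s] by eventually_elim (auto simp: f_def indicator_def)
        show "(\<lambda>r. f (s, r)) \<in> borel_measurable pos_line"
          using measurable_compose_Pair1[OF _ fm, of s] that by (simp add: space_pos_line)
        have "integrable pos_line (\<lambda>r. w s * cnj (w r - indicator {..s} r *\<^sub>R w r))"
          using w Fi[of s] by (intro integrable_mult_right integrable_cnj Bochner_Integration.integrable_diff)
        then show "(\<lambda>r. w s * cnj (w r - indicator {..s} r *\<^sub>R w r)) \<in> borel_measurable pos_line" by auto
      qed
      also have "\<dots> = w s * cnj (I - F s)"
        by (simp only: integral_mult_right_zero Bochner_Integration.integral_cnj Bochner_Integration.integral_diff[OF w Fi] I_def F_def)
      finally show ?thesis .
    qed
    have "(\<integral>s. w s * cnj (I - F s) \<partial>pos_line) = (\<integral>s. (\<integral>r. f (s, r) \<partial>pos_line) \<partial>pos_line)"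
      by (intro Bochner_Integration.integral_cong) (auto simp: up space_pos_line)
    also have "\<dots> = (\<integral>r. (\<integral>s. f (s, r) \<partial>pos_line) \<partial>pos_line)"
      using pos_line_pair.Fubini_integral[of "\<lambda>s r. f (s, r)"] fi by simp
    also have "\<dots> = (\<integral>r. F r * cnj (w r) \<partial>pos_line)" by (simp add: snd)
    finally have eq: "(\<integral>s. w s * cnj (I - F s) \<partial>pos_line) = (\<integral>r. F r * cnj (w r) \<partial>pos_line)" .
    have "(\<integral>s. w s * cnj (I - F s) \<partial>pos_line) = (\<integral>s. w s * cnj I \<partial>pos_line) - (\<integral>s. w s * cnj (F s) \<partial>pos_line)"
      using w int by (simp add: right_diff_distrib)
    with eq have "(\<integral>s. w s * cnj I \<partial>pos_line) = (\<integral>r. F r * cnj (w r) \<partial>pos_line) + (\<integral>s. w s * cnj (F s) \<partial>pos_line)"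
      by (simp add: algebra_simps)
    also have "\<dots> = (\<integral>r. (F r * cnj (w r)) + cnj (F r * cnj (w r)) \<partial>pos_line)"
      using int \<open>integrable pos_line (\<lambda>r. F r * cnj (w r))\<close> by (simp add: mult.commute)
    finally show ?thesis using w ci by (simp add: I_def)
  qed
  also have "\<dots> = (\<integral>r. complex_of_real (2 * Re (w r * cnj (F r))) \<partial>pos_line)"
    by (intro Bochner_Integration.integral_cong refl) (auto simp: complex_eq_iff algebra_simps)
  also have "\<dots> = complex_of_real (\<integral>r. 2 * Re (w r * cnj (F r)) \<partial>pos_line)"
    by (rule integral_complex_of_real)
  finally have "complex_of_real ((cmod I)\<^sup>2) = complex_of_real (\<integral>r. 2 * Re (w r * cnj (F r)) \<partial>pos_line)"
    by (simp only: complex_norm_square)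
  then show "(cmod (\<integral>s. w s \<partial>pos_line))\<^sup>2 = (\<integral>r. 2 * Re (w r * cnj (F r)) \<partial>pos_line)"
    by (simp only: of_real_eq_iff I_def)
qed

text \<open>With the kernel as density, the weighted norms of the memory become plain L2 norms over
  a finite measure, and the mean against \<open>g\<close> becomes a plain integral.\<close>

definition memory_measure :: "(real \<Rightarrow> real) \<Rightarrow> real measure" where
  "memory_measure g = density pos_line (\<lambda>s. ennreal (g s))"

lemma measurable_memory_measure [simp]:
  "f \<in> borel_measurable (memory_measure g) \<longleftrightarrow> f \<in> borel_measurable pos_line"
  by (simp add: memory_measure_def)

lemma space_memory_measure: "space (memory_measure g) = {0<..}"
  by (simp add: memory_measure_def space_pos_line)

section \<open>Monotonicity, tail formula and integration by parts for the kernel\<close>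

locale memory_kernel =
  fixes g g' :: "real \<Rightarrow> real" and k0 k1 :: real
  assumes A1: "kernel_A1 g g'" and k: "0 < k0" "0 < k1"
    and lower: "\<And>s. 0 < s \<Longrightarrow> - k0 * g s \<le> g' s"
    and upper: "\<And>s. 0 < s \<Longrightarrow> g' s \<le> - k1 * g s"
begin

abbreviation G :: "real measure" where
  "G \<equiv> memory_measure g"

lemma g_pos: "0 < s \<Longrightarrow> 0 < g s"
  and g_integrable: "integrable pos_line g"
  and g'_measurable: "g' \<in> borel_measurable pos_line"
  and mass_pos: "0 < kernel_mass g"
  using A1 by (auto simp: kernel_A1_def set_integrable_pos_line set_borel_measurable_pos_line)

lemma g_measurable: "g \<in> borel_measurable pos_line"
  using g_integrable by auto

lemma g_deriv:
  assumes "0 < s" "s \<le> t"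
  shows "integrable pos_line (\<lambda>r. indicator {s..t} r *\<^sub>R g' r)"
    and "g t - g s = (\<integral>r. indicator {s..t} r *\<^sub>R g' r \<partial>pos_line)"
  unfolding integrable_pos_line_Icc[OF assms(1), symmetric]
  using A1 assms unfolding kernel_A1_def weak_deriv_on_pos_def by auto

lemma g'_bound: "0 < s \<Longrightarrow> \<bar>g' s\<bar> \<le> k0 * g s" "0 < s \<Longrightarrow> k1 * g s \<le> - g' s" "0 < s \<Longrightarrow> g' s \<le> 0"
proof -
  assume s: "0 < s"
  have "0 \<le> k1 * g s" using k g_pos[OF s] by simp
  then show "\<bar>g' s\<bar> \<le> k0 * g s" "k1 * g s \<le> - g' s" "g' s \<le> 0"
    using lower[OF s] upper[OF s] by auto
qed

lemma g'_integrable: "integrable pos_line g'"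
proof (rule Bochner_Integration.integrable_bound)
  show "integrable pos_line (\<lambda>s. k0 * g s)" using g_integrable by simp
  show "AE s in pos_line. norm (g' s) \<le> norm (k0 * g s)"
    using g'_bound(1) by (intro AE_I2) (force simp: space_pos_line)
qed (rule g'_measurable)

lemma g_antimono:
  assumes "0 < s" "s \<le> t"
  shows "g t \<le> g s"
proof -
  have "(\<integral>r. indicator {s..t} r *\<^sub>R g' r \<partial>pos_line) \<le> (\<integral>r. 0 \<partial>pos_line)"
    using g_deriv(1)[OF assms] g'_bound(3)
    by (intro integral_mono_AE AE_I2) (auto simp: space_pos_line indicator_def)
  then show ?thesis using g_deriv(2)[OF assms] by simp
qed

lemma kernel_mass_eq: "kernel_mass g = (\<integral>s. g s \<partial>pos_line)"
  by (simp add: kernel_mass_def set_lebesgue_integral_pos_line)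

text \<open>\<open>g\<close> decreases, so a rectangle of width \<open>real n\<close> and height
  \<open>g (s + real n)\<close> fits under its graph; its area is at most the mass of the
  kernel.\<close>

lemma g_tendsto_zero:
  assumes "0 < s"
  shows "(\<lambda>n. g (s + real n)) \<longlonglongrightarrow> 0"
proof (rule tendsto_sandwich)
  show "\<forall>\<^sub>F n in sequentially. 0 \<le> g (s + real n)"
    using g_pos assms by (intro always_eventually allI less_imp_le) simp
  show "\<forall>\<^sub>F n in sequentially. g (s + real n) \<le> kernel_mass g / real n"
  proof (intro eventually_sequentiallyI[of 1])
    fix n :: nat assume n: "1 \<le> n"
    have c: "integrable pos_line (\<lambda>r. indicator {s..s + real n} r *\<^sub>R g (s + real n))"
      "(\<integral>r. indicator {s..s + real n} r *\<^sub>R g (s + real n) \<partial>pos_line) = real n * g (s + real n)"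
      unfolding integrable_pos_line_Icc[OF assms, symmetric]
      by (simp_all add: set_integrable_def set_lebesgue_integral_def)
    have "(\<integral>r. indicator {s..s + real n} r *\<^sub>R g (s + real n) \<partial>pos_line) \<le> (\<integral>r. g r \<partial>pos_line)"
    proof (intro integral_mono_AE AE_I2 c g_integrable)
      fix r assume "r \<in> space pos_line"
      then show "indicator {s..s + real n} r *\<^sub>R g (s + real n) \<le> g r"
        using g_antimono[of r "s + real n"] g_pos[of r] by (auto simp: space_pos_line indicator_def)
    qed
    then show "g (s + real n) \<le> kernel_mass g / real n"
      unfolding c kernel_mass_eq using n by (simp add: field_simps)
  qed
  show "(\<lambda>n. kernel_mass g / real n) \<longlonglongrightarrow> 0" by (rule lim_const_over_n)
qed auto

text \<open>Let the right end in \<open>g_deriv\<close> tend to infinity, where \<open>g\<close>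
  vanishes. The condition \<open>r \<ge> s\<close> is written as \<open>indicator {..r} s\<close>,
  the form in which \<open>pos_line_swap\<close> exchanges the integrals.\<close>

lemma g_tail:
  assumes "0 < s"
  shows "integrable pos_line (\<lambda>r. indicator {..r} s * (- g' r))"
    and "(\<integral>r. indicator {..r} s * (- g' r) \<partial>pos_line) = g s"
proof -
  have i: "(\<lambda>r. indicator {..r} s * (- g' r)) = (\<lambda>r. indicator {s..} r *\<^sub>R (- g' r))"
    by (auto simp: indicator_def)
  have m: "{s..} \<inter> space pos_line \<in> sets pos_line" "{s..t} \<inter> space pos_line \<in> sets pos_line" for t
    by (auto simp: sets_restrict_space space_pos_line)
  have meas: "(\<lambda>r. indicator {s..} r *\<^sub>R (- g' r)) \<in> borel_measurable pos_line"
    "(\<lambda>r. indicator {s..t} r *\<^sub>R (- g' r)) \<in> borel_measurable pos_line" for t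
    using g'_measurable m by (auto intro!: borel_measurable_scaleR borel_measurable_indicator')
  show int: "integrable pos_line (\<lambda>r. indicator {..r} s * (- g' r))"
    unfolding i by (rule Bochner_Integration.integrable_bound[OF g'_integrable meas(1)]) (auto simp: indicator_def)
  have "(\<lambda>n. \<integral>r. indicator {s..s + real n} r *\<^sub>R (- g' r) \<partial>pos_line) \<longlonglongrightarrow> (\<integral>r. indicator {s..} r *\<^sub>R (- g' r) \<partial>pos_line)"
  proof (rule integral_dominated_convergence[where w = "\<lambda>r. \<bar>g' r\<bar>"])
    show "integrable pos_line (\<lambda>r. \<bar>g' r\<bar>)" using g'_integrable by simp
    have "(\<lambda>n. indicator {s..s + real n} r *\<^sub>R (- g' r)) \<longlonglongrightarrow> indicator {s..} r *\<^sub>R (- g' r)" for r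
    proof (rule tendsto_eventually)
      obtain N :: nat where N: "r - s \<le> real N" using real_arch_simple by blast
      show "\<forall>\<^sub>F n in sequentially. indicator {s..s + real n} r *\<^sub>R (- g' r) = indicator {s..} r *\<^sub>R (- g' r)"
        using N by (intro eventually_sequentiallyI[of N]) (auto simp: indicator_def)
    qed
    then show "AE r in pos_line. (\<lambda>n. indicator {s..s + real n} r *\<^sub>R (- g' r)) \<longlonglongrightarrow> indicator {s..} r *\<^sub>R (- g' r)"
      by simp
    show "AE r in pos_line. norm (indicator {s..s + real n} r *\<^sub>R (- g' r)) \<le> \<bar>g' r\<bar>" for n
      by (auto simp: indicator_def)
  qed (use meas in auto)
  moreover have "(\<integral>r. indicator {s..s + real n} r *\<^sub>R (- g' r) \<partial>pos_line) = g s - g (s + real n)" for n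
    using g_deriv[of s "s + real n"] assms by simp
  moreover have "(\<lambda>n. g s - g (s + real n)) \<longlonglongrightarrow> g s - 0"
    by (intro tendsto_intros g_tendsto_zero assms)
  ultimately show "(\<integral>r. indicator {..r} s * (- g' r) \<partial>pos_line) = g s"
    unfolding i by (auto intro: LIMSEQ_unique)
qed

lemma integral_memory_measure:
  fixes f :: "real \<Rightarrow> 'b::{banach, second_countable_topology}"
  assumes "f \<in> borel_measurable pos_line"
  shows "integrable G f \<longleftrightarrow> integrable pos_line (\<lambda>s. g s *\<^sub>R f s)"
    and "(\<integral>s. f s \<partial>G) = (\<integral>s. g s *\<^sub>R f s \<partial>pos_line)"
proof -
  have "AE s in pos_line. 0 \<le> g s" using g_pos by (intro AE_I2) (auto simp: space_pos_line less_imp_le)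
  then show "integrable G f \<longleftrightarrow> integrable pos_line (\<lambda>s. g s *\<^sub>R f s)"
    and "(\<integral>s. f s \<partial>G) = (\<integral>s. g s *\<^sub>R f s \<partial>pos_line)"
    unfolding memory_measure_def using assms g_measurable by (simp_all add: integrable_density integral_density)
qed

lemma finite_G: "finite_measure G" and measure_G: "measure G (space G) = kernel_mass g"
proof -
  have "emeasure G (space G) = (\<integral>\<^sup>+ s. ennreal (g s) * indicator (space pos_line) s \<partial>pos_line)"
    unfolding memory_measure_def using g_measurable by (simp add: emeasure_density)
  also have "\<dots> = (\<integral>\<^sup>+ s. ennreal (g s) \<partial>pos_line)"
    by (intro nn_integral_cong) auto
  also have "\<dots> = ennreal (kernel_mass g)"
    unfolding kernel_mass_eq using g_pos
    by (intro nn_integral_eq_integral g_integrable AE_I2) (auto simp: space_pos_line less_imp_le)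
  finally have e: "emeasure G (space G) = ennreal (kernel_mass g)" .
  then show "finite_measure G" by (intro finite_measureI) simp
  show "measure G (space G) = kernel_mass g" using mass_pos by (simp add: measure_def e)
qed

text \<open>Write \<open>g s\<close> as the tail integral of \<open>- g'\<close> and exchange the
  integrals. Going through Fubini avoids the boundary term at infinity, where nothing is known about
  the primitive of \<open>w\<close>.\<close>

lemma kernel_by_parts:
  fixes w :: "real \<Rightarrow> 'b::{banach, second_countable_topology}"
  assumes "integrable G w"
  shows "(\<integral>s. w s \<partial>G) = (\<integral>r. (- g' r) *\<^sub>R (\<integral>s. indicator {..r} s *\<^sub>R w s \<partial>pos_line) \<partial>pos_line)"
proof -
  have w: "w \<in> borel_measurable pos_line" using borel_measurable_integrable[OF assms] by simp
  have i: "integrable pos_line (\<lambda>s. g s *\<^sub>R w s)" using assms integral_memory_measure(1)[OF w] by simp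
  have "(\<integral>s. w s \<partial>G) = (\<integral>s. (\<integral>r. indicator {..r} s * (- g' r) \<partial>pos_line) *\<^sub>R w s \<partial>pos_line)"
    unfolding integral_memory_measure(2)[OF w]
    by (intro Bochner_Integration.integral_cong refl) (simp only: g_tail(2) space_pos_line greaterThan_iff)
  also have "\<dots> = (\<integral>r. (- g' r) *\<^sub>R (\<integral>s. indicator {..r} s *\<^sub>R w s \<partial>pos_line) \<partial>pos_line)"
  proof (rule pos_line_swap[OF w])
    show "(\<lambda>r. - g' r) \<in> borel_measurable pos_line" using g'_measurable by simp
    show "0 \<le> - g' r" if "0 < r" for r using g'_bound(3)[OF that] by simp
    show "integrable pos_line (\<lambda>r. indicator {..r} s * - g' r)" if "0 < s" for s
      using g_tail(1)[OF that] .
    show "integrable pos_line (\<lambda>s. (\<integral>r. indicator {..r} s * (- g' r) \<partial>pos_line) *\<^sub>R w s)"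
      using i by (rule Bochner_Integration.integrable_cong[THEN iffD1, rotated 2])
        (simp_all only: g_tail(2) space_pos_line greaterThan_iff)
  qed
  finally show ?thesis .
qed

text \<open>Up to \<open>r\<close> the kernel is at least \<open>g r > 0\<close>, so integrability
  with the weight gives integrability without it.\<close>

lemma integrable_initial:
  assumes w: "square_integrable G w" and r: "0 < r"
  shows "integrable pos_line (\<lambda>s. indicator {..r} s *\<^sub>R w s)"
proof (rule Bochner_Integration.integrable_bound)
  have wm: "w \<in> borel_measurable pos_line" using w by (simp add: square_integrable_def)
  have "integrable G (\<lambda>s. cmod (w s))"
    using integrable_norm[OF square_integrable_integrable[OF finite_G w]] .
  then have "integrable pos_line (\<lambda>s. g s *\<^sub>R cmod (w s))"
    using integral_memory_measure(1)[of "\<lambda>s. cmod (w s)"] wm by simp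
  then show "integrable pos_line (\<lambda>s. 1 / g r * (g s * cmod (w s)))" by simp
  have "{..r} \<inter> space pos_line \<in> sets pos_line" by (auto simp: sets_restrict_space space_pos_line)
  then show "(\<lambda>s. indicator {..r} s *\<^sub>R w s) \<in> borel_measurable pos_line"
    using wm by (auto intro!: borel_measurable_scaleR borel_measurable_indicator')
  show "AE s in pos_line. norm (indicator {..r} s *\<^sub>R w s) \<le> norm (1 / g r * (g s * cmod (w s)))"
  proof (intro AE_I2)
    fix s assume "s \<in> space pos_line"
    then have s: "0 < s" by (simp add: space_pos_line)
    show "norm (indicator {..r} s *\<^sub>R w s) \<le> norm (1 / g r * (g s * cmod (w s)))"
    proof (cases "s \<le> r")
      case True
      then have "1 \<le> g s / g r" using g_antimono[OF s True] g_pos[OF r] by simp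
      then have "1 * cmod (w s) \<le> g s / g r * cmod (w s)" by (rule mult_right_mono) simp
      then show ?thesis using True g_pos[OF s] g_pos[OF r] by (simp add: abs_mult)
    qed (simp add: indicator_def)
  qed
qed

text \<open>\<open>weak_deriv_on_pos\<close> speaks only about intervals away from \<open>0\<close>.
  Letting the left end tend to \<open>0\<close> brings in the trace condition \<open>lim\<close>,
  with \<open>integrable_initial\<close> supplying the dominating function.\<close>

lemma primitive_eq:
  assumes w: "square_integrable G w" and d: "weak_deriv_on_pos \<eta> w"
    and lim: "(\<eta> \<longlongrightarrow> 0) (at_right 0)" and r: "0 < r"
  shows "\<eta> r = (\<integral>s. indicator {..r} s *\<^sub>R w s \<partial>pos_line)"
proof -
  define t where "t n = r / real (n + 2)" for n
  have t: "0 < t n" "t n \<le> r" for n using r by (auto simp: t_def field_simps)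
  have t0: "t \<longlonglongrightarrow> 0"
    unfolding t_def using lim_const_over_n[of r] by (rule LIMSEQ_ignore_initial_segment)
  have f: "filterlim t (at_right 0) sequentially"
    using t0 t by (auto simp: filterlim_at intro!: always_eventually) (metis less_irrefl)
  note I = integrable_initial[OF w r]
  have "(\<lambda>n. \<integral>s. indicator {t n..r} s *\<^sub>R w s \<partial>pos_line) \<longlonglongrightarrow> (\<integral>s. indicator {..r} s *\<^sub>R w s \<partial>pos_line)"
  proof (rule integral_dominated_convergence[where w = "\<lambda>s. cmod (indicator {..r} s *\<^sub>R w s)"])
    show "integrable pos_line (\<lambda>s. cmod (indicator {..r} s *\<^sub>R w s))" using I by (rule integrable_norm)
    show "(\<lambda>s. indicator {..r} s *\<^sub>R w s) \<in> borel_measurable pos_line" using I by auto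
    show "(\<lambda>s. indicator {t n..r} s *\<^sub>R w s) \<in> borel_measurable pos_line" for n
    proof -
      have "set_integrable lebesgue {t n..r} w" using d t[of n] unfolding weak_deriv_on_pos_def by blast
      then show ?thesis unfolding integrable_pos_line_Icc(1)[OF t(1)] by (rule borel_measurable_integrable)
    qed
    show "AE s in pos_line. (\<lambda>n. indicator {t n..r} s *\<^sub>R w s) \<longlonglongrightarrow> indicator {..r} s *\<^sub>R w s"
    proof (intro AE_I2 tendsto_eventually)
      fix s assume "s \<in> space pos_line"
      then have "\<forall>\<^sub>F n in sequentially. t n < s" using order_tendstoD(2)[OF t0] by (simp add: space_pos_line)
      then show "\<forall>\<^sub>F n in sequentially. indicator {t n..r} s *\<^sub>R w s = indicator {..r} s *\<^sub>R w s"
        by eventually_elim (auto simp: indicator_def)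
    qed
    show "AE s in pos_line. cmod (indicator {t n..r} s *\<^sub>R w s) \<le> cmod (indicator {..r} s *\<^sub>R w s)" for n
      by (auto simp: indicator_def)
  qed
  moreover have "(\<integral>s. indicator {t n..r} s *\<^sub>R w s \<partial>pos_line) = \<eta> r - \<eta> (t n)" for n
    using d t[of n] integrable_pos_line_Icc(2)[OF t(1)] unfolding weak_deriv_on_pos_def by metis
  moreover have "(\<lambda>n. \<eta> r - \<eta> (t n)) \<longlonglongrightarrow> \<eta> r - 0"
    by (intro tendsto_intros filterlim_compose[OF lim f])
  ultimately show ?thesis by (auto intro: LIMSEQ_unique)
qed

text \<open>Both are instances of \<open>kernel_by_parts\<close>, once the primitive is known: it is
  \<open>\<eta>\<close> for \<open>w\<close>, and the squared modulus of \<open>\<eta>\<close> for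
  \<open>2 * Re (w s * cnj (\<eta> s))\<close>. The second is a chain rule for a function with only
  a weak derivative, obtained from \<open>pos_line_square\<close> for \<open>w\<close> cut off at
  \<open>r\<close>.\<close>

lemma memory_by_parts:
  assumes \<eta>: "square_integrable G \<eta>" and w: "square_integrable G w"
    and d: "weak_deriv_on_pos \<eta> w" and lim: "(\<eta> \<longlongrightarrow> 0) (at_right 0)"
  shows "(\<integral>s. w s \<partial>G) = (\<integral>r. (- g' r) *\<^sub>R \<eta> r \<partial>pos_line)"
    and "(\<integral>s. 2 * Re (w s * cnj (\<eta> s)) \<partial>G) = (\<integral>r. (- g' r) * (cmod (\<eta> r))\<^sup>2 \<partial>pos_line)"
proof -
  note prim = primitive_eq[OF w d lim]
  show "(\<integral>s. w s \<partial>G) = (\<integral>r. (- g' r) *\<^sub>R \<eta> r \<partial>pos_line)"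
    unfolding kernel_by_parts[OF square_integrable_integrable[OF finite_G w]]
    by (intro Bochner_Integration.integral_cong refl) (simp add: prim space_pos_line)
  have "integrable G (\<lambda>s. 2 * Re (w s * cnj (\<eta> s)))"
    using square_integrable_mult_cnj[OF w \<eta>] by (intro integrable_mult_right integrable_Re)
  from kernel_by_parts[OF this]
  have "(\<integral>s. 2 * Re (w s * cnj (\<eta> s)) \<partial>G) =
    (\<integral>r. (- g' r) *\<^sub>R (\<integral>s. indicator {..r} s *\<^sub>R (2 * Re (w s * cnj (\<eta> s))) \<partial>pos_line) \<partial>pos_line)" .
  also have "\<dots> = (\<integral>r. (- g' r) * (cmod (\<eta> r))\<^sup>2 \<partial>pos_line)"
  proof (intro Bochner_Integration.integral_cong refl)
    fix r assume "r \<in> space pos_line"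
    then have r: "0 < r" by (simp add: space_pos_line)
    have "(cmod (\<eta> r))\<^sup>2 = (\<integral>s. 2 * Re ((indicator {..r} s *\<^sub>R w s) *
        cnj (\<integral>t. indicator {..s} t *\<^sub>R indicator {..r} t *\<^sub>R w t \<partial>pos_line)) \<partial>pos_line)"
      using pos_line_square(2)[OF integrable_initial[OF w r]] by (simp only: prim[OF r])
    also have "\<dots> = (\<integral>s. indicator {..r} s *\<^sub>R (2 * Re (w s * cnj (\<eta> s))) \<partial>pos_line)"
    proof (intro Bochner_Integration.integral_cong refl)
      fix s assume "s \<in> space pos_line"
      then have s: "0 < s" by (simp add: space_pos_line)
      show "2 * Re ((indicator {..r} s *\<^sub>R w s) *
        cnj (\<integral>t. indicator {..s} t *\<^sub>R indicator {..r} t *\<^sub>R w t \<partial>pos_line)) =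
        indicator {..r} s *\<^sub>R (2 * Re (w s * cnj (\<eta> s)))"
      proof (cases "s \<le> r")
        case True
        then have "(\<lambda>t. indicator {..s} t *\<^sub>R indicator {..r} t *\<^sub>R w t) = (\<lambda>t. indicator {..s} t *\<^sub>R w t)"
          by (auto simp: indicator_def)
        then show ?thesis using True by (simp add: prim[OF s])
      qed simp
    qed
    finally show "(- g' r) *\<^sub>R (\<integral>s. indicator {..r} s *\<^sub>R (2 * Re (w s * cnj (\<eta> s))) \<partial>pos_line) =
        (- g' r) * (cmod (\<eta> r))\<^sup>2" by simp
  qed
  finally show "(\<integral>s. 2 * Re (w s * cnj (\<eta> s)) \<partial>G) = (\<integral>r. (- g' r) * (cmod (\<eta> r))\<^sup>2 \<partial>pos_line)" .
qed

text \<open>\<open>u - w\<close> is the memory component of the operator. Integration by parts moves the derivative of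
  \<open>\<eta>\<close> to the kernel, where (A2) bounds it from both sides.\<close>

lemma memory_generator:
  assumes \<eta>: "square_integrable G \<eta>" and w: "square_integrable G w"
    and d: "weak_deriv_on_pos \<eta> w" and lim: "(\<eta> \<longlongrightarrow> 0) (at_right 0)"
  shows "(cmod ((\<integral>s. u - w s \<partial>G) - of_real (kernel_mass g) * u))\<^sup>2 \<le> k0\<^sup>2 * kernel_mass g * sq_norm G \<eta>"
    and "2 * Re (\<integral>s. \<eta> s * cnj (u - w s) \<partial>G) \<le> 2 * Re ((\<integral>s. \<eta> s \<partial>G) * cnj u) - k1 * sq_norm G \<eta>"
proof -
  note parts = memory_by_parts[OF assms]
  have \<eta>m: "\<eta> \<in> borel_measurable pos_line" using \<eta> by (simp add: square_integrable_def)
  have \<eta>i: "integrable G \<eta>" and wi: "integrable G w"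
    using square_integrable_integrable[OF finite_G] \<eta> w by auto
  have sq: "sq_norm G \<eta> = (\<integral>s. g s * (cmod (\<eta> s))\<^sup>2 \<partial>pos_line)"
    "integrable pos_line (\<lambda>s. g s * (cmod (\<eta> s))\<^sup>2)"
    using integral_memory_measure[of "\<lambda>s. (cmod (\<eta> s))\<^sup>2"] \<eta>m \<eta> by (auto simp: sq_norm_def square_integrable_def)
  have "(\<integral>s. u - w s \<partial>G) - of_real (kernel_mass g) * u = - (\<integral>s. w s \<partial>G)"
    using wi finite_measure.integrable_const[OF finite_G, of u] by (simp add: measure_G scaleR_conv_of_real)
  then have "cmod ((\<integral>s. u - w s \<partial>G) - of_real (kernel_mass g) * u) = cmod (\<integral>r. (- g' r) *\<^sub>R \<eta> r \<partial>pos_line)"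
    by (simp add: parts(1))
  also have "\<dots> \<le> (\<integral>r. norm ((- g' r) *\<^sub>R \<eta> r) \<partial>pos_line)" by (rule integral_norm_bound)
  also have "\<dots> \<le> (\<integral>r. k0 * (g r *\<^sub>R cmod (\<eta> r)) \<partial>pos_line)"
  proof (rule integral_mono_AE')
    show "integrable pos_line (\<lambda>r. k0 * (g r *\<^sub>R cmod (\<eta> r)))"
      using integral_memory_measure(1)[of "\<lambda>s. cmod (\<eta> s)"] \<eta>m integrable_norm[OF \<eta>i] by simp
    show "AE r in pos_line. norm ((- g' r) *\<^sub>R \<eta> r) \<le> k0 * (g r *\<^sub>R cmod (\<eta> r))"
      using g'_bound(1) by (intro AE_I2) (auto simp: space_pos_line mult.assoc[symmetric] intro!: mult_right_mono)
    show "AE r in pos_line. 0 \<le> k0 * (g r *\<^sub>R cmod (\<eta> r))"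
      using k g_pos by (intro AE_I2) (auto simp: space_pos_line less_imp_le)
  qed
  also have "\<dots> = k0 * (\<integral>s. cmod (\<eta> s) \<partial>G)"
    using integral_memory_measure(2)[of "\<lambda>s. cmod (\<eta> s)"] \<eta>m by simp
  finally have "cmod ((\<integral>s. u - w s \<partial>G) - of_real (kernel_mass g) * u) \<le> k0 * (\<integral>s. cmod (\<eta> s) \<partial>G)" .
  then have "(cmod ((\<integral>s. u - w s \<partial>G) - of_real (kernel_mass g) * u))\<^sup>2 \<le> (k0 * (\<integral>s. cmod (\<eta> s) \<partial>G))\<^sup>2"
    by (rule power_mono) simp
  \<comment> \<open>The factor \<open>cmod 1\<close> prepares Cauchy-Schwarz against the constant
    function, whose squared norm is the mass of the kernel.\<close>
  also have "\<dots> = k0\<^sup>2 * (\<integral>s. cmod (\<eta> s) * cmod 1 \<partial>G)\<^sup>2" by (simp add: power_mult_distrib)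
  also have "\<dots> \<le> k0\<^sup>2 * (sq_norm G \<eta> * sq_norm G (\<lambda>_. 1))"
    by (intro mult_left_mono square_integrable_cauchy_schwarz \<eta> square_integrable_const finite_G) simp
  also have "\<dots> = k0\<^sup>2 * kernel_mass g * sq_norm G \<eta>" by (simp add: sq_norm_def measure_G)
  finally show "(cmod ((\<integral>s. u - w s \<partial>G) - of_real (kernel_mass g) * u))\<^sup>2 \<le> k0\<^sup>2 * kernel_mass g * sq_norm G \<eta>" .
  have wc: "integrable G (\<lambda>s. w s * cnj (\<eta> s))" "integrable G (\<lambda>s. \<eta> s * cnj (w s))"
    using square_integrable_mult_cnj \<eta> w by auto
  have "(\<integral>s. \<eta> s * cnj (u - w s) \<partial>G) = (\<integral>s. \<eta> s * cnj u \<partial>G) - (\<integral>s. \<eta> s * cnj (w s) \<partial>G)"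
    using \<eta>i wc by (simp add: right_diff_distrib)
  also have "(\<integral>s. \<eta> s * cnj u \<partial>G) = (\<integral>s. \<eta> s \<partial>G) * cnj u" using \<eta>i by simp
  finally have "2 * Re (\<integral>s. \<eta> s * cnj (u - w s) \<partial>G) = 2 * Re ((\<integral>s. \<eta> s \<partial>G) * cnj u) - 2 * Re (\<integral>s. \<eta> s * cnj (w s) \<partial>G)"
    by simp
  also have "2 * Re (\<integral>s. \<eta> s * cnj (w s) \<partial>G) = (\<integral>s. 2 * Re (\<eta> s * cnj (w s)) \<partial>G)"
    by (simp only: integral_Re[OF wc(2)] integral_mult_right_zero)
  also have "\<dots> = (\<integral>s. 2 * Re (w s * cnj (\<eta> s)) \<partial>G)"
    by (intro Bochner_Integration.integral_cong refl) simp
  also have "\<dots> = (\<integral>r. (- g' r) * (cmod (\<eta> r))\<^sup>2 \<partial>pos_line)" by (rule parts(2))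
  finally have e: "2 * Re (\<integral>s. \<eta> s * cnj (u - w s) \<partial>G) = 2 * Re ((\<integral>s. \<eta> s \<partial>G) * cnj u) - (\<integral>r. (- g' r) * (cmod (\<eta> r))\<^sup>2 \<partial>pos_line)" .
  have "k1 * sq_norm G \<eta> = (\<integral>r. k1 * (g r * (cmod (\<eta> r))\<^sup>2) \<partial>pos_line)" by (simp add: sq)
  also have "\<dots> \<le> (\<integral>r. (- g' r) * (cmod (\<eta> r))\<^sup>2 \<partial>pos_line)"
  proof (intro integral_mono_AE AE_I2)
    show "integrable pos_line (\<lambda>r. k1 * (g r * (cmod (\<eta> r))\<^sup>2))" using sq by simp
    show "integrable pos_line (\<lambda>r. (- g' r) * (cmod (\<eta> r))\<^sup>2)"
    proof (rule Bochner_Integration.integrable_bound)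
      show "integrable pos_line (\<lambda>r. k0 * (g r * (cmod (\<eta> r))\<^sup>2))" using sq by simp
      show "(\<lambda>r. (- g' r) * (cmod (\<eta> r))\<^sup>2) \<in> borel_measurable pos_line"
        using g'_measurable \<eta>m by simp
      show "AE r in pos_line. norm ((- g' r) * (cmod (\<eta> r))\<^sup>2) \<le> norm (k0 * (g r * (cmod (\<eta> r))\<^sup>2))"
      proof (intro AE_I2)
        fix r assume "r \<in> space pos_line"
        then have "\<bar>g' r\<bar> * (cmod (\<eta> r))\<^sup>2 \<le> (k0 * g r) * (cmod (\<eta> r))\<^sup>2"
          using g'_bound(1) by (intro mult_right_mono) (auto simp: space_pos_line)
        also have "\<dots> \<le> \<bar>k0 * g r * (cmod (\<eta> r))\<^sup>2\<bar>" by (rule abs_ge_self)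
        finally show "norm ((- g' r) * (cmod (\<eta> r))\<^sup>2) \<le> norm (k0 * (g r * (cmod (\<eta> r))\<^sup>2))"
          by (simp add: abs_mult mult.assoc)
      qed
    qed
    fix r assume "r \<in> space pos_line"
    then have "(k1 * g r) * (cmod (\<eta> r))\<^sup>2 \<le> (- g' r) * (cmod (\<eta> r))\<^sup>2"
      using g'_bound(2) by (intro mult_right_mono) (auto simp: space_pos_line)
    then show "k1 * (g r * (cmod (\<eta> r))\<^sup>2) \<le> (- g' r) * (cmod (\<eta> r))\<^sup>2" by simp
  qed
  finally show "2 * Re (\<integral>s. \<eta> s * cnj (u - w s) \<partial>G) \<le> 2 * Re ((\<integral>s. \<eta> s \<partial>G) * cnj u) - k1 * sq_norm G \<eta>"
    using e by linarith
qed

end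

section \<open>Decay of a single mode\<close>

lemma young_ineq:
  fixes a b C e :: real
  assumes "0 < e"
  shows "C * (a * b) \<le> e * a\<^sup>2 + C\<^sup>2 / (4 * e) * b\<^sup>2"
proof -
  have "0 \<le> (2 * e * a - C * b)\<^sup>2 / (4 * e)"
    using assms by simp
  also have "\<dots> = e * a\<^sup>2 + C\<^sup>2 / (4 * e) * b\<^sup>2 - C * (a * b)"
    using assms by (simp add: power2_eq_square field_simps)
  finally show ?thesis by simp
qed

text \<open>The four brackets are the bounds for the derivatives of the cross terms. Each has one
  negative square and errors that a later choice absorbs: \<open>K4\<close> outweighs
  \<open>b * W\<^sup>2\<close>, then \<open>K5\<close> the product \<open>V * W\<close>, then
  \<open>K1\<close> all terms with \<open>U\<close>, and finally \<open>M\<close> every product with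
  \<open>H\<close>. Half of \<open>m * Q\<^sup>2\<close> is spent on \<open>Q * U\<close>.\<close>

lemma quadratic_absorption:
  fixes r k d b m C :: real
  assumes "0 < r" "0 < k" "0 < d" "0 \<le> b" "0 < m" "0 \<le> C"
  obtains K1 K4 K5 M c where "0 \<le> K1" "0 \<le> K4" "0 \<le> K5" "0 \<le> M" "0 < c"
    "\<And>V W U Q H. K1 * (- r * U\<^sup>2 + C * (H * V + H * W + H * U + H\<^sup>2))
       + K5 * (- k * V\<^sup>2 + C * (H * V + U\<^sup>2 + Q * U))
       + K4 * (- d * W\<^sup>2 + C * (V * W + H * W + U\<^sup>2 + Q * U))
       + (b * W\<^sup>2 - m * Q\<^sup>2 + C * (Q * U))
      \<le> M * H\<^sup>2 - c * (V\<^sup>2 + W\<^sup>2 + U\<^sup>2 + Q\<^sup>2 + H\<^sup>2)"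
proof -
  \<comment> \<open>The summand \<open>4\<close> here and in \<open>K5\<close>, \<open>K1\<close>
    leaves room for the unit squares that Young's inequality produces and for the negative squares
    that must remain. The factors \<open>4 * 1\<close> keep the shape of \<open>young_ineq\<close>
    with \<open>e = 1\<close>.\<close>
  define K4 where "K4 = (b + 4) / d"
  define K5 where "K5 = ((K4 * C)\<^sup>2 / (4 * 1) + 4) / k"
  define S where "S = K4 * C + K5 * C + C"
  define K1 where "K1 = (S\<^sup>2 / (4 * (m / 2)) + (K4 + K5) * C + 4) / r"
  define M where "M = ((K1 + K5) * C)\<^sup>2 / (4 * 1) + ((K1 + K4) * C)\<^sup>2 / (4 * 1)
    + (K1 * C)\<^sup>2 / (4 * 1) + K1 * C + 1"
  define c where "c = min 1 (m / 2)"
  have K4: "K4 * d = b + 4" "0 \<le> K4" using assms by (auto simp: K4_def)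
  have K5: "K5 * k = (K4 * C)\<^sup>2 / (4 * 1) + 4" "0 \<le> K5" using assms by (auto simp: K5_def)
  have K1: "K1 * r = S\<^sup>2 / (4 * (m / 2)) + (K4 + K5) * C + 4" "0 \<le> K1"
    using assms K4 K5 by (auto simp: K1_def)
  have M: "0 \<le> M" using assms K1 by (auto simp: M_def intro!: add_nonneg_nonneg)
  have c: "0 < c" "c \<le> 1" "c \<le> m / 2" using assms by (auto simp: c_def)
  show ?thesis
  proof (rule that[OF K1(2) K4(2) K5(2) M c(1)])
    fix V W U Q H :: real
    have y: "(K4 * C) * (W * V) \<le> 1 * W\<^sup>2 + (K4 * C)\<^sup>2 / (4 * 1) * V\<^sup>2"
      "S * (Q * U) \<le> (m / 2) * Q\<^sup>2 + S\<^sup>2 / (4 * (m / 2)) * U\<^sup>2"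
      "((K1 + K5) * C) * (V * H) \<le> 1 * V\<^sup>2 + ((K1 + K5) * C)\<^sup>2 / (4 * 1) * H\<^sup>2"
      "((K1 + K4) * C) * (W * H) \<le> 1 * W\<^sup>2 + ((K1 + K4) * C)\<^sup>2 / (4 * 1) * H\<^sup>2"
      "(K1 * C) * (U * H) \<le> 1 * U\<^sup>2 + (K1 * C)\<^sup>2 / (4 * 1) * H\<^sup>2"
      by (rule young_ineq; use assms in simp)+
    have cc: "c * V\<^sup>2 \<le> V\<^sup>2" "c * W\<^sup>2 \<le> W\<^sup>2" "c * U\<^sup>2 \<le> U\<^sup>2" "c * H\<^sup>2 \<le> H\<^sup>2"
      using c by (auto intro!: mult_left_le_one_le)
    have cq: "c * Q\<^sup>2 \<le> (m / 2) * Q\<^sup>2"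
      using c by (intro mult_right_mono) auto
    have "K1 * (- r * U\<^sup>2 + C * (H * V + H * W + H * U + H\<^sup>2))
       + K5 * (- k * V\<^sup>2 + C * (H * V + U\<^sup>2 + Q * U))
       + K4 * (- d * W\<^sup>2 + C * (V * W + H * W + U\<^sup>2 + Q * U))
       + (b * W\<^sup>2 - m * Q\<^sup>2 + C * (Q * U)) =
       - (K1 * r) * U\<^sup>2 - (K5 * k) * V\<^sup>2 - (K4 * d) * W\<^sup>2 + b * W\<^sup>2 - m * Q\<^sup>2
       + (K4 * C) * (W * V) + S * (Q * U) + ((K1 + K5) * C) * (V * H)
       + ((K1 + K4) * C) * (W * H) + (K1 * C) * (U * H) + (K1 * C) * H\<^sup>2
       + ((K4 + K5) * C) * U\<^sup>2"
      by (simp add: S_def algebra_simps)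
    also have "\<dots> \<le> M * H\<^sup>2 - V\<^sup>2 - W\<^sup>2 - U\<^sup>2 - (m / 2) * Q\<^sup>2 - H\<^sup>2"
      using y unfolding K1(1) K4(1) K5(1) M_def distrib_right
      by (simp add: algebra_simps) (insert zero_le_power2[of U] zero_le_power2[of V] zero_le_power2[of W], linarith)
    also have "\<dots> \<le> M * H\<^sup>2 - c * (V\<^sup>2 + W\<^sup>2 + U\<^sup>2 + Q\<^sup>2 + H\<^sup>2)"
      using cc cq by (simp add: distrib_left)
    finally show "K1 * (- r * U\<^sup>2 + C * (H * V + H * W + H * U + H\<^sup>2))
       + K5 * (- k * V\<^sup>2 + C * (H * V + U\<^sup>2 + Q * U))
       + K4 * (- d * W\<^sup>2 + C * (V * W + H * W + U\<^sup>2 + Q * U))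
       + (b * W\<^sup>2 - m * Q\<^sup>2 + C * (Q * U))
      \<le> M * H\<^sup>2 - c * (V\<^sup>2 + W\<^sup>2 + U\<^sup>2 + Q\<^sup>2 + H\<^sup>2)" .
  qed
qed

text \<open>The derivative on the time half-line: two-sided for positive \<open>t\<close>, one-sided
  at \<open>0\<close>.\<close>

abbreviation half_deriv :: "(real \<Rightarrow> 'b::real_normed_vector) \<Rightarrow> 'b \<Rightarrow> real \<Rightarrow> bool" where
  "half_deriv f d t \<equiv> (f has_vector_derivative d) (at t within {0..})"

text \<open>\<open>\<zeta>\<close> will be the mass of the kernel and \<open>x0\<close> the smallest
  eigenvalue. All constants below depend on these parameters only, never on \<open>x\<close>, so
  they serve all modes at once. In what follows \<open>B\<close> takes the place of
  \<open>\<alpha>1 * x - \<zeta> * x powr a\<close>; only its bounds by multiples of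
  \<open>x\<close> enter.\<close>

locale mode_params =
  fixes a \<rho> \<mu> \<beta> \<gamma> \<alpha>1 \<zeta> \<kappa> k0 k1 x0 :: real
  assumes a: "0 \<le> a" "a < 1"
    and pos: "0 < \<rho>" "0 < \<mu>" "0 < \<beta>" "0 < \<gamma>" "0 < \<alpha>1" "0 < \<zeta>" "0 < \<kappa>" "0 < k0" "0 < k1" "0 < x0"
begin

text \<open>The variable \<open>w\<close> stands for \<open>\<gamma> v - p\<close>, the variable \<open>m\<close> for the weighted mean of the memory
  component and \<open>h\<close> for its squared weighted norm.\<close>

definition mode_energy :: "real \<Rightarrow> real \<Rightarrow> 'a::real_inner \<Rightarrow> 'a \<Rightarrow> 'a \<Rightarrow> 'a \<Rightarrow> real \<Rightarrow> real" where
  "mode_energy x B v w u q h =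
     B * (norm v)\<^sup>2 + \<beta> * x * (norm w)\<^sup>2 + \<rho> * (norm u)\<^sup>2 + \<mu> * (norm q)\<^sup>2 + x powr a * h"

text \<open>\<open>du\<close>, \<open>dq\<close>, \<open>dm\<close> stand for time derivatives. Of \<open>m\<close> and \<open>h\<close> only bounds are prescribed.\<close>

definition mode_balance :: "real \<Rightarrow> real \<Rightarrow> 'a::real_inner \<Rightarrow> 'a \<Rightarrow> 'a \<Rightarrow> real \<Rightarrow> 'a \<Rightarrow> 'a \<Rightarrow> bool" where
  "mode_balance x B v w m h du dq \<longleftrightarrow> x0 \<le> x \<and> \<kappa> * x \<le> B \<and> B \<le> \<alpha>1 * x \<and> 0 \<le> h \<and> (norm m)\<^sup>2 \<le> \<zeta> * h \<and>
     \<rho> *\<^sub>R du = - B *\<^sub>R v - (\<gamma> * \<beta> * x) *\<^sub>R w - (x powr a) *\<^sub>R m \<and> \<mu> *\<^sub>R dq = (\<beta> * x) *\<^sub>R w"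

text \<open>Along solutions the four terms of \<open>cross\<close> yield multiples of \<open>- \<bar>u\<bar>\<^sup>2\<close>, \<open>- x \<bar>v\<bar>\<^sup>2\<close>,
  \<open>- x \<bar>w\<bar>\<^sup>2\<close> and \<open>- \<bar>q\<bar>\<^sup>2\<close>, in this order, up to errors that the other terms and the memory
  dissipation absorb; \<open>dcross\<close> is the time derivative.\<close>

definition cross :: "real \<Rightarrow> real \<Rightarrow> real \<Rightarrow> 'a::real_inner \<Rightarrow> 'a \<Rightarrow> 'a \<Rightarrow> 'a \<Rightarrow> 'a \<Rightarrow> real" where
  "cross K1 K4 K5 v w u q m = - K1 * \<rho> * inner u m + K5 * inner (\<rho> *\<^sub>R u + (\<gamma> * \<mu>) *\<^sub>R q) v
     + K4 * \<rho> * inner u w + \<mu> * inner q w"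

definition dcross :: "real \<Rightarrow> real \<Rightarrow> real \<Rightarrow> 'a::real_inner \<Rightarrow> 'a \<Rightarrow> 'a \<Rightarrow> 'a \<Rightarrow> 'a \<Rightarrow> 'a \<Rightarrow> 'a \<Rightarrow> 'a \<Rightarrow> real" where
  "dcross K1 K4 K5 v w u q m du dq dm = - K1 * \<rho> * (inner u dm + inner du m)
     + K5 * (inner (\<rho> *\<^sub>R u + (\<gamma> * \<mu>) *\<^sub>R q) u + inner (\<rho> *\<^sub>R du + (\<gamma> * \<mu>) *\<^sub>R dq) v)
     + K4 * \<rho> * (inner u (\<gamma> *\<^sub>R u - q) + inner du w) + \<mu> * (inner q (\<gamma> *\<^sub>R u - q) + inner dq w)"

text \<open>As \<open>a < 1\<close> and \<open>x\<close> stays away from \<open>0\<close>, memory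
  terms are of lower order than the elastic ones.\<close>

lemma powr_a_le: "x0 \<le> x \<Longrightarrow> x powr a \<le> x0 powr (a - 1) * x"
proof -
  assume x: "x0 \<le> x"
  have "x powr a = x powr (a - 1) * x"
    using x pos by (simp add: powr_diff)
  also have "x powr (a - 1) \<le> x0 powr (a - 1)"
    using x pos a by (intro powr_mono2') auto
  finally show ?thesis using x pos by (simp add: mult_right_mono)
qed

text \<open>A pointwise inequality between vectors, to be used at every time of an orbit. After
  scaling by \<open>sqrt x\<close>, all terms become products of \<open>V\<close>, \<open>W\<close>,
  \<open>U\<close>, \<open>Q\<close>, \<open>H\<close> with coefficients free of \<open>x\<close>,
  and \<open>quadratic_absorption\<close> applies. The price \<open>M * k1 * (x * h)\<close> is what
  the dissipation \<open>k1 * x powr a * h\<close> yields when the energy is weighted with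
  \<open>M * x powr (1 - a)\<close>. The second bound keeps the cross terms below half of that
  weighted energy.\<close>

lemma lyapunov_exists:
  obtains M K1 K4 K5 c where "0 < M" "0 < c"
    "\<And>x B h (v :: 'a::real_inner) w u q m du dq dm.
      \<lbrakk>mode_balance x B v w m h du dq; (norm (dm - \<zeta> *\<^sub>R u))\<^sup>2 \<le> k0\<^sup>2 * \<zeta> * h\<rbrakk> \<Longrightarrow>
       dcross K1 K4 K5 v w u q m du dq dm \<le> M * k1 * (x * h) - c * mode_energy x B v w u q h \<and>
       \<bar>cross K1 K4 K5 v w u q m\<bar> \<le> M / 2 * (x powr (1 - a) * mode_energy x B v w u q h)"
proof -
  define Z where "Z = x0 powr (a - 1)"
  have Z: "0 < Z" using pos by (simp add: Z_def)
  define s where "s = sqrt \<zeta>"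
  have s: "0 < s" "s\<^sup>2 = \<zeta>" using pos by (auto simp: s_def)
  \<comment> \<open>A common bound for the coefficients of all error terms in \<open>t1\<close>,
    \<open>t5\<close>, \<open>t4\<close> and \<open>t6\<close>.\<close>
  define C where "C = s * \<alpha>1 + s * \<gamma> * \<beta> + \<rho> * k0 * s / sqrt x0 + Z * \<zeta> + Z * s + \<rho>
     + \<gamma> * \<mu> + \<alpha>1 + \<rho> * \<gamma> + \<rho>"
  have C: "0 \<le> C" "s * \<alpha>1 \<le> C" "s * \<gamma> * \<beta> \<le> C" "\<rho> * k0 * s / sqrt x0 \<le> C" "Z * \<zeta> \<le> C"
    "Z * s \<le> C" "\<rho> \<le> C" "\<gamma> * \<mu> \<le> C" "\<alpha>1 \<le> C" "\<rho> * \<gamma> \<le> C"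
    unfolding C_def using pos Z s by (auto intro!: add_nonneg_nonneg add_increasing add_increasing2)
  obtain K1 K4 K5 M0 c0 where K: "0 \<le> K1" "0 \<le> K4" "0 \<le> K5" "0 \<le> M0" "0 < c0"
    and quad: "\<And>V W U Q H. K1 * (- (\<rho> * \<zeta>) * U\<^sup>2 + C * (H * V + H * W + H * U + H\<^sup>2))
       + K5 * (- \<kappa> * V\<^sup>2 + C * (H * V + U\<^sup>2 + Q * U))
       + K4 * (- (\<gamma> * \<beta>) * W\<^sup>2 + C * (V * W + H * W + U\<^sup>2 + Q * U))
       + (\<beta> * W\<^sup>2 - \<mu> * Q\<^sup>2 + C * (Q * U))
      \<le> M0 * H\<^sup>2 - c0 * (V\<^sup>2 + W\<^sup>2 + U\<^sup>2 + Q\<^sup>2 + H\<^sup>2)"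
    by (rule quadratic_absorption[of "\<rho> * \<zeta>" \<kappa> "\<gamma> * \<beta>" \<beta> \<mu> C]) (use pos C in auto)
  define C5 where "C5 = \<alpha>1 + \<beta> + \<rho> + \<mu> + Z"
  have C5: "0 < C5" "\<alpha>1 \<le> C5" "\<beta> \<le> C5" "\<rho> \<le> C5" "\<mu> \<le> C5" "Z \<le> C5"
    using pos Z by (auto simp: C5_def)
  \<comment> \<open>Since \<open>x powr (1 - a) \<ge> 1 / Z\<close> and \<open>x \<ge> x0\<close>,
    each entry bounds from below the coefficient of one component in \<open>x powr (1 - a)\<close>
    times the energy. For \<open>h\<close> that coefficient is \<open>x\<close> itself.\<close>
  define c3 where "c3 = Min {\<kappa> * x0 / Z, \<rho> / Z, \<beta> * x0 / Z, \<mu> / Z, x0}"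
  have c3: "0 < c3" "c3 \<le> \<kappa> * x0 / Z" "c3 \<le> \<rho> / Z" "c3 \<le> \<beta> * x0 / Z" "c3 \<le> \<mu> / Z" "c3 \<le> x0"
    using pos Z by (auto simp: c3_def)
  define C4 where "C4 = K1 * \<rho> * (1 + \<zeta>) + K5 * (\<rho> + \<gamma> * \<mu>) + K4 * \<rho> + \<mu>"
  have C4: "0 \<le> C4" using K pos by (auto simp: C4_def intro!: add_nonneg_nonneg mult_nonneg_nonneg)
  define D where "D = C4 / c3"
  \<comment> \<open>\<open>M0 / k1\<close> lets \<open>M * k1\<close> cover the memory term of the
    quadratic form, and \<open>2 * D\<close> lets \<open>M / 2\<close> cover the cross
    terms.\<close>
  define M where "M = M0 / k1 + 2 * D + 1"
  have M: "0 < M" "M0 \<le> M * k1" "D \<le> M / 2"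
  proof -
    have n: "0 \<le> M0 / k1" "0 \<le> D" using K C4 c3 pos by (auto simp: D_def)
    then show "0 < M" "D \<le> M / 2" by (auto simp: M_def)
    have "M0 / k1 \<le> M" using n by (simp add: M_def)
    then show "M0 \<le> M * k1" using pos by (simp add: field_simps)
  qed
  define c where "c = c0 / C5"
  have c: "0 < c" using K C5 by (simp add: c_def)
  show ?thesis
  proof (rule that[OF M(1) c, of K1 K4 K5], goal_cases)
    case (1 x B h v w u q m du dq dm)
    have x: "x0 \<le> x" and B: "\<kappa> * x \<le> B" "B \<le> \<alpha>1 * x" and h: "0 \<le> h" and m: "(norm m)\<^sup>2 \<le> \<zeta> * h"
      and du: "\<rho> *\<^sub>R du = - B *\<^sub>R v - (\<gamma> * \<beta> * x) *\<^sub>R w - (x powr a) *\<^sub>R m" and dq: "\<mu> *\<^sub>R dq = (\<beta> * x) *\<^sub>R w"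
      using 1(1) by (auto simp: mode_balance_def)
    note dm = 1(2)
    have xp: "0 < x" using x pos by simp
    define z where "z = x powr a"
    define V where "V = sqrt x * norm v"
    define W where "W = sqrt x * norm w"
    define U where "U = norm u"
    define Q where "Q = norm q"
    define H where "H = sqrt (x * h)"
    have nn: "0 \<le> V" "0 \<le> W" "0 \<le> U" "0 \<le> Q" "0 \<le> H" using xp h by (auto simp: V_def W_def U_def Q_def H_def)
    have sq: "V\<^sup>2 = x * (norm v)\<^sup>2" "W\<^sup>2 = x * (norm w)\<^sup>2" "H\<^sup>2 = x * h"
      using xp h by (auto simp: V_def W_def H_def power_mult_distrib)
    have z: "0 < z" "z \<le> Z * x" using powr_a_le[OF x] xp by (auto simp: z_def Z_def)
    have Bp: "0 \<le> B" using B(1) pos xp by (meson less_imp_le mult_pos_pos order_trans)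
    have mle: "norm m \<le> s * sqrt h"
      using m by (auto simp: s_def simp flip: real_sqrt_mult intro!: real_le_rsqrt)
    have dmle: "norm (dm - \<zeta> *\<^sub>R u) \<le> k0 * s * sqrt h"
    proof -
      have "norm (dm - \<zeta> *\<^sub>R u) \<le> sqrt (k0\<^sup>2 * \<zeta> * h)" using dm by (rule real_le_rsqrt)
      also have "\<dots> = k0 * s * sqrt h" using pos by (simp add: real_sqrt_mult s_def)
      finally show ?thesis .
    qed
    have hH: "x * sqrt h = sqrt x * H" using xp by (simp add: H_def real_sqrt_mult)
    have ip: "inner r1 r2 \<le> norm r1 * norm r2" "- inner r1 r2 \<le> norm r1 * norm r2" for r1 r2 :: 'a
      using Cauchy_Schwarz_ineq2[of r1 r2] by auto
    have xm: "x * (norm m * norm r) \<le> s * (H * (sqrt x * norm r))" for r :: 'a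
    proof -
      have "x * (norm m * norm r) \<le> x * ((s * sqrt h) * norm r)"
        using mle xp by (intro mult_left_mono mult_right_mono) auto
      also have "\<dots> = s * (x * sqrt h) * norm r" by simp
      also have "\<dots> = s * (H * (sqrt x * norm r))" unfolding hH by simp
      finally show ?thesis .
    qed
    have zm: "z * (norm m * norm r) \<le> Z * s * (H * (sqrt x * norm r))" for r :: 'a
    proof -
      have "z * (norm m * norm r) \<le> Z * x * (norm m * norm r)" using z by (intro mult_right_mono) auto
      also have "\<dots> \<le> Z * (s * (H * (sqrt x * norm r)))"
        using xm[of r] Z by (simp add: mult.assoc mult_left_mono)
      finally show ?thesis by simp
    qed
    \<comment> \<open>\<open>dm\<close> equals \<open>\<zeta> *\<^sub>R u\<close> up to an error
      controlled by the memory, so pairing it with \<open>u\<close> creates damping of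
      \<open>u\<close>, which has none of its own.\<close>
    have t1: "- \<rho> * (inner u dm + inner du m) \<le> - (\<rho> * \<zeta>) * U\<^sup>2 + C * (H * V + H * W + H * U + H\<^sup>2)"
    proof -
      have "- \<rho> * inner u dm = - (\<rho> * \<zeta>) * U\<^sup>2 + \<rho> * (- inner u (dm - \<zeta> *\<^sub>R u))"
        by (simp add: inner_diff_right U_def power2_norm_eq_inner algebra_simps)
      also have "- inner u (dm - \<zeta> *\<^sub>R u) \<le> U * (k0 * s * sqrt h)"
        using ip(2)[of u "dm - \<zeta> *\<^sub>R u"] mult_left_mono[OF dmle, of U] nn unfolding U_def by linarith
      also have "sqrt h = H / sqrt x" using xp by (simp add: H_def real_sqrt_mult)
      also have "U * (k0 * s * (H / sqrt x)) \<le> U * (k0 * s * (H / sqrt x0))"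
        using nn pos s x xp by (intro mult_left_mono divide_left_mono) auto
      finally have A: "- \<rho> * inner u dm \<le> - (\<rho> * \<zeta>) * U\<^sup>2 + \<rho> * k0 * s / sqrt x0 * (H * U)"
        using pos by (simp add: mult_left_mono algebra_simps)
      have "- \<rho> * inner du m = - inner (\<rho> *\<^sub>R du) m" by simp
      also have "\<dots> = B * inner v m + \<gamma> * \<beta> * (x * inner w m) + z * inner m m"
        unfolding du z_def by (simp add: inner_diff_left inner_add_left algebra_simps)
      also have "\<dots> \<le> B * (norm v * norm m) + \<gamma> * \<beta> * (x * (norm w * norm m)) + z * (norm m)\<^sup>2"
        using ip Bp pos xp z by (intro add_mono mult_left_mono) (auto simp: power2_norm_eq_inner)
      also have "B * (norm v * norm m) \<le> \<alpha>1 * (x * (norm m * norm v))"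
        using B mult_right_mono[of B "\<alpha>1 * x" "norm m * norm v"] by (simp add: mult_ac)
      also have "\<alpha>1 * (x * (norm m * norm v)) \<le> s * \<alpha>1 * (H * V)"
        using xm[of v] pos by (simp add: V_def mult_left_mono mult_ac)
      also have "\<gamma> * \<beta> * (x * (norm w * norm m)) \<le> s * \<gamma> * \<beta> * (H * W)"
        using xm[of w] pos by (simp add: W_def mult_left_mono mult_ac)
      also have "z * (norm m)\<^sup>2 \<le> (Z * x) * (\<zeta> * h)"
        using z m xp Z by (intro mult_mono) auto
      also have "\<dots> = Z * \<zeta> * H\<^sup>2" by (simp add: sq)
      finally have "- \<rho> * inner du m \<le> s * \<alpha>1 * (H * V) + s * \<gamma> * \<beta> * (H * W) + Z * \<zeta> * H\<^sup>2" by simp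
      with A have "- \<rho> * (inner u dm + inner du m) \<le> - (\<rho> * \<zeta>) * U\<^sup>2 +
        (s * \<alpha>1 * (H * V) + s * \<gamma> * \<beta> * (H * W) + \<rho> * k0 * s / sqrt x0 * (H * U) + Z * \<zeta> * H\<^sup>2)"
        by (simp add: distrib_left)
      also have "s * \<alpha>1 * (H * V) + s * \<gamma> * \<beta> * (H * W) + \<rho> * k0 * s / sqrt x0 * (H * U) + Z * \<zeta> * H\<^sup>2
        \<le> C * (H * V) + C * (H * W) + C * (H * U) + C * H\<^sup>2"
        using C nn by (intro add_mono mult_right_mono) auto
      finally show ?thesis by (simp add: distrib_left)
    qed
    have t5: "inner (\<rho> *\<^sub>R u + (\<gamma> * \<mu>) *\<^sub>R q) u + inner (\<rho> *\<^sub>R du + (\<gamma> * \<mu>) *\<^sub>R dq) v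
      \<le> - \<kappa> * V\<^sup>2 + C * (H * V + U\<^sup>2 + Q * U)"
    proof -
      \<comment> \<open>The weight \<open>\<gamma> * \<mu>\<close> of \<open>q\<close> in this cross
        term is chosen so that the terms with \<open>w\<close> cancel; only \<open>v\<close> and the
        memory remain.\<close>
      have "\<rho> *\<^sub>R du + (\<gamma> * \<mu>) *\<^sub>R dq = \<rho> *\<^sub>R du + \<gamma> *\<^sub>R (\<mu> *\<^sub>R dq)" by simp
      also have "\<dots> = - B *\<^sub>R v - z *\<^sub>R m" unfolding du dq by (simp add: z_def algebra_simps)
      finally have "inner (\<rho> *\<^sub>R u + (\<gamma> * \<mu>) *\<^sub>R q) u + inner (\<rho> *\<^sub>R du + (\<gamma> * \<mu>) *\<^sub>R dq) v =
        \<rho> * U\<^sup>2 + \<gamma> * \<mu> * inner q u + (- B * (norm v)\<^sup>2 + z * (- inner m v))"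
        by (simp add: inner_add_left inner_diff_left U_def power2_norm_eq_inner)
      also have "\<dots> \<le> \<rho> * U\<^sup>2 + \<gamma> * \<mu> * (Q * U) + (- \<kappa> * V\<^sup>2 + z * (norm m * norm v))"
        using ip pos z B mult_right_mono[OF B(1), of "(norm v)\<^sup>2"]
        by (intro add_mono mult_left_mono) (auto simp: Q_def U_def sq)
      also have "\<dots> \<le> \<rho> * U\<^sup>2 + \<gamma> * \<mu> * (Q * U) + (- \<kappa> * V\<^sup>2 + Z * s * (H * V))"
        using zm[of v] by (simp add: V_def)
      also have "\<dots> \<le> C * U\<^sup>2 + C * (Q * U) + (- \<kappa> * V\<^sup>2 + C * (H * V))"
        using C nn by (intro add_mono mult_right_mono) auto
      finally show ?thesis by (simp add: distrib_left)
    qed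
    \<comment> \<open>The coupling term in the equation for \<open>u\<close> is paired with
      \<open>w\<close> and gives the negative square. The term \<open>- B *\<^sub>R v\<close> gives
      the product \<open>V * W\<close>, which is why \<open>K5\<close> is chosen after
      \<open>K4\<close>.\<close>
    have t4: "\<rho> * (inner u (\<gamma> *\<^sub>R u - q) + inner du w) \<le> - (\<gamma> * \<beta>) * W\<^sup>2 + C * (V * W + H * W + U\<^sup>2 + Q * U)"
    proof -
      have "\<rho> * (inner u (\<gamma> *\<^sub>R u - q) + inner du w) =
         \<rho> * \<gamma> * U\<^sup>2 + \<rho> * (- inner q u) + inner (\<rho> *\<^sub>R du) w"
        by (simp add: inner_diff_right U_def power2_norm_eq_inner inner_commute algebra_simps)
      also have "inner (\<rho> *\<^sub>R du) w = B * (- inner v w) + (- (\<gamma> * \<beta> * W\<^sup>2) + z * (- inner m w))"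
        unfolding du by (simp add: inner_diff_left inner_add_left sq z_def power2_norm_eq_inner algebra_simps)
      also have "\<rho> * \<gamma> * U\<^sup>2 + \<rho> * (- inner q u) + (B * (- inner v w) + (- (\<gamma> * \<beta> * W\<^sup>2) + z * (- inner m w)))
        \<le> \<rho> * \<gamma> * U\<^sup>2 + \<rho> * (Q * U) + (B * (norm v * norm w) + (- (\<gamma> * \<beta> * W\<^sup>2) + z * (norm m * norm w)))"
        using ip pos z Bp by (intro add_mono mult_left_mono) (auto simp: Q_def U_def)
      also have "B * (norm v * norm w) \<le> (\<alpha>1 * x) * (norm v * norm w)" using B by (intro mult_right_mono) auto
      also have "\<dots> = \<alpha>1 * (V * W)" using xp by (simp add: V_def W_def)
      also have "z * (norm m * norm w) \<le> Z * s * (H * W)" using zm[of w] by (simp add: W_def)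
      also have "\<rho> * \<gamma> * U\<^sup>2 + \<rho> * (Q * U) + (\<alpha>1 * (V * W) + (- (\<gamma> * \<beta> * W\<^sup>2) + Z * s * (H * W)))
        \<le> C * U\<^sup>2 + C * (Q * U) + (C * (V * W) + (- (\<gamma> * \<beta> * W\<^sup>2) + C * (H * W)))"
        using C nn by (intro add_mono mult_right_mono) auto
      finally show ?thesis by (simp add: distrib_left)
    qed
    \<comment> \<open>The damping of \<open>q\<close> comes from the time derivative
      \<open>\<gamma> *\<^sub>R u - q\<close> of \<open>w\<close>. Its price
      \<open>\<beta> * W\<^sup>2\<close> is the term that \<open>K4\<close> outweighs.\<close>
    have t6: "\<mu> * (inner q (\<gamma> *\<^sub>R u - q) + inner dq w) \<le> \<beta> * W\<^sup>2 - \<mu> * Q\<^sup>2 + C * (Q * U)"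
    proof -
      have "\<mu> * (inner q (\<gamma> *\<^sub>R u - q) + inner dq w) =
        \<gamma> * \<mu> * inner q u - \<mu> * Q\<^sup>2 + inner (\<mu> *\<^sub>R dq) w"
        by (simp add: inner_diff_right Q_def power2_norm_eq_inner algebra_simps)
      also have "inner (\<mu> *\<^sub>R dq) w = \<beta> * W\<^sup>2" unfolding dq by (simp add: sq power2_norm_eq_inner)
      also have "\<gamma> * \<mu> * inner q u - \<mu> * Q\<^sup>2 + \<beta> * W\<^sup>2 \<le> \<gamma> * \<mu> * (Q * U) - \<mu> * Q\<^sup>2 + \<beta> * W\<^sup>2"
        using ip(1)[of q u] pos by (auto simp: Q_def U_def intro!: mult_left_mono)
      also have "\<dots> \<le> C * (Q * U) - \<mu> * Q\<^sup>2 + \<beta> * W\<^sup>2"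
        using C nn by (intro add_mono diff_mono mult_right_mono) auto
      finally show ?thesis by simp
    qed
    have E: "mode_energy x B v w u q h \<le> C5 * (V\<^sup>2 + W\<^sup>2 + U\<^sup>2 + Q\<^sup>2 + H\<^sup>2)"
    proof -
      have "mode_energy x B v w u q h \<le> (\<alpha>1 * x) * (norm v)\<^sup>2 + \<beta> * x * (norm w)\<^sup>2
         + \<rho> * (norm u)\<^sup>2 + \<mu> * (norm q)\<^sup>2 + (Z * x) * h"
        unfolding mode_energy_def z_def[symmetric] using B z h xp by (intro add_mono mult_right_mono) auto
      also have "\<dots> = \<alpha>1 * V\<^sup>2 + \<beta> * W\<^sup>2 + \<rho> * U\<^sup>2 + \<mu> * Q\<^sup>2 + Z * H\<^sup>2"
        by (simp add: sq U_def Q_def)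
      also have "\<dots> \<le> C5 * V\<^sup>2 + C5 * W\<^sup>2 + C5 * U\<^sup>2 + C5 * Q\<^sup>2 + C5 * H\<^sup>2"
        using C5 by (intro add_mono mult_right_mono) auto
      finally show ?thesis by (simp add: distrib_left)
    qed
    have yz: "x powr (1 - a) * z = x" using xp by (simp add: z_def flip: powr_add)
    have y: "1 / Z \<le> x powr (1 - a)"
    proof -
      have "x = x powr (1 - a) * z" using yz by simp
      also have "\<dots> \<le> x powr (1 - a) * (Z * x)" using z by (intro mult_left_mono) auto
      finally show ?thesis using xp Z by (simp add: field_simps)
    qed
    have EL: "c3 * ((norm v)\<^sup>2 + (norm w)\<^sup>2 + U\<^sup>2 + Q\<^sup>2 + h) \<le> x powr (1 - a) * mode_energy x B v w u q h"
    proof -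
      have "c3 * (norm v)\<^sup>2 + c3 * (norm w)\<^sup>2 + c3 * U\<^sup>2 + c3 * Q\<^sup>2 + c3 * h
        \<le> \<kappa> * x0 / Z * (norm v)\<^sup>2 + \<beta> * x0 / Z * (norm w)\<^sup>2 + \<rho> / Z * U\<^sup>2 + \<mu> / Z * Q\<^sup>2 + x0 * h"
        using c3 h by (intro add_mono mult_right_mono) auto
      also have "\<dots> = 1 / Z * ((\<kappa> * x0) * (norm v)\<^sup>2 + (\<beta> * x0) * (norm w)\<^sup>2 + \<rho> * U\<^sup>2 + \<mu> * Q\<^sup>2) + x0 * h"
        by (simp add: add_divide_distrib)
      also have "\<dots> \<le> 1 / Z * (B * (norm v)\<^sup>2 + (\<beta> * x) * (norm w)\<^sup>2 + \<rho> * U\<^sup>2 + \<mu> * Q\<^sup>2) + x * h"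
      proof -
        have "\<kappa> * x0 \<le> \<kappa> * x" using x pos by simp
        then have "\<kappa> * x0 \<le> B" using B by linarith
        then show ?thesis using x pos h Z by (intro add_mono mult_left_mono mult_right_mono) auto
      qed
      also have "\<dots> \<le> x powr (1 - a) * (B * (norm v)\<^sup>2 + (\<beta> * x) * (norm w)\<^sup>2 + \<rho> * U\<^sup>2 + \<mu> * Q\<^sup>2) + x * h"
        using y Bp pos xp h by (intro add_mono mult_right_mono add_nonneg_nonneg) auto
      also have "\<dots> = x powr (1 - a) * mode_energy x B v w u q h"
        unfolding mode_energy_def z_def[symmetric] distrib_left mult.assoc[symmetric] yz
        by (simp add: U_def Q_def)
      finally show ?thesis by (simp add: distrib_left)
    qed
    have ipa: "\<bar>inner r1 r2\<bar> \<le> (norm r1)\<^sup>2 + (norm r2)\<^sup>2" for r1 r2 :: 'a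
      using Cauchy_Schwarz_ineq2[of r1 r2] sum_squares_bound[of "norm r1" "norm r2"]
        mult_nonneg_nonneg[OF norm_ge_zero[of r1] norm_ge_zero[of r2]]
      unfolding mult.assoc by linarith
    show ?case
    proof
      have "K1 * (- \<rho> * (inner u dm + inner du m))
       + K5 * (inner (\<rho> *\<^sub>R u + (\<gamma> * \<mu>) *\<^sub>R q) u + inner (\<rho> *\<^sub>R du + (\<gamma> * \<mu>) *\<^sub>R dq) v)
       + K4 * (\<rho> * (inner u (\<gamma> *\<^sub>R u - q) + inner du w))
       + \<mu> * (inner q (\<gamma> *\<^sub>R u - q) + inner dq w)
       \<le> M0 * H\<^sup>2 - c0 * (V\<^sup>2 + W\<^sup>2 + U\<^sup>2 + Q\<^sup>2 + H\<^sup>2)"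
        using quad[of U H V W Q] mult_left_mono[OF t1 K(1)] mult_left_mono[OF t5 K(3)]
          mult_left_mono[OF t4 K(2)] t6 by linarith
      also have "\<dots> \<le> M * k1 * H\<^sup>2 - c * mode_energy x B v w u q h"
      proof -
        have "c * mode_energy x B v w u q h \<le> c * (C5 * (V\<^sup>2 + W\<^sup>2 + U\<^sup>2 + Q\<^sup>2 + H\<^sup>2))"
          using E c by (simp add: mult_left_mono)
        also have "\<dots> = c0 * (V\<^sup>2 + W\<^sup>2 + U\<^sup>2 + Q\<^sup>2 + H\<^sup>2)" using C5 by (simp add: c_def)
        finally show ?thesis using mult_right_mono[OF M(2), of "H\<^sup>2"] by simp
      qed
      finally show "dcross K1 K4 K5 v w u q m du dq dm \<le> M * k1 * (x * h) - c * mode_energy x B v w u q h"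
        by (simp add: dcross_def sq mult.assoc)
    next
      define S where "S = (norm v)\<^sup>2 + (norm w)\<^sup>2 + U\<^sup>2 + Q\<^sup>2 + h"
      have "\<bar>inner u m\<bar> \<le> U\<^sup>2 + \<zeta> * h" using ipa[of u m] m by (simp add: U_def)
      also have "\<dots> \<le> (1 + \<zeta>) * S" using h pos by (auto simp: S_def algebra_simps intro!: add_nonneg_nonneg)
      finally have i1: "\<bar>inner u m\<bar> \<le> (1 + \<zeta>) * S" .
      have n: "0 \<le> K1 * \<rho>" "0 \<le> K5 * \<rho>" "0 \<le> K5 * (\<gamma> * \<mu>)" "0 \<le> K4 * \<rho>" "0 \<le> \<mu>"
        using K pos by auto
      have i2: "\<bar>inner u v\<bar> \<le> S" "\<bar>inner q v\<bar> \<le> S" "\<bar>inner u w\<bar> \<le> S" "\<bar>inner q w\<bar> \<le> S"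
        using ipa[of u v] ipa[of q v] ipa[of u w] ipa[of q w] h by (auto simp: S_def U_def Q_def intro: order_trans)
      have "\<bar>cross K1 K4 K5 v w u q m\<bar>
         = \<bar>(- (K1 * \<rho> * inner u m)) + K5 * \<rho> * inner u v + K5 * (\<gamma> * \<mu>) * inner q v + K4 * \<rho> * inner u w + \<mu> * inner q w\<bar>"
        by (simp add: cross_def inner_add_left algebra_simps)
      also have "\<dots> \<le> K1 * \<rho> * \<bar>inner u m\<bar> + K5 * \<rho> * \<bar>inner u v\<bar> + K5 * (\<gamma> * \<mu>) * \<bar>inner q v\<bar>
          + K4 * \<rho> * \<bar>inner u w\<bar> + \<mu> * \<bar>inner q w\<bar>"
      proof -
        have ab: "\<bar>- b1 + b2 + b3 + b4 + b5\<bar> \<le> \<bar>b1\<bar> + \<bar>b2\<bar> + \<bar>b3\<bar> + \<bar>b4\<bar> + \<bar>b5\<bar>" for b1 b2 b3 b4 b5 :: real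
          using abs_triangle_ineq[of "- b1 + b2 + b3 + b4" b5] abs_triangle_ineq[of "- b1 + b2 + b3" b4]
            abs_triangle_ineq[of "- b1 + b2" b3] abs_triangle_ineq[of "- b1" b2]
          unfolding abs_minus_cancel by (rule order_trans[OF _ add_right_mono[OF order_trans[OF _ add_right_mono[OF order_trans[OF _ add_right_mono]]]]])
        have am: "\<bar>r * i\<bar> = r * \<bar>i\<bar>" if "0 \<le> r" for r i :: real
          using that by (simp add: abs_mult)
        show ?thesis
          using ab[of "K1 * \<rho> * inner u m" "K5 * \<rho> * inner u v" "K5 * (\<gamma> * \<mu>) * inner q v"
            "K4 * \<rho> * inner u w" "\<mu> * inner q w"] unfolding n[THEN am] .
      qed
      also have "\<dots> \<le> K1 * \<rho> * ((1 + \<zeta>) * S) + K5 * \<rho> * S + K5 * (\<gamma> * \<mu>) * S + K4 * \<rho> * S + \<mu> * S"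
        by (intro add_mono mult_left_mono i1 i2 n)
      also have "\<dots> = C4 * S" by (simp add: C4_def algebra_simps)
      also have "\<dots> = D * (c3 * S)" using c3 by (simp add: D_def)
      also have "\<dots> \<le> M / 2 * (c3 * S)" using M c3 h by (intro mult_right_mono) (auto simp: S_def)
      also have "\<dots> \<le> M / 2 * (x powr (1 - a) * mode_energy x B v w u q h)"
        using EL M by (intro mult_left_mono) (auto simp: S_def)
      finally show "\<bar>cross K1 K4 K5 v w u q m\<bar> \<le> M / 2 * (x powr (1 - a) * mode_energy x B v w u q h)" .
    qed
  qed
qed

text \<open>The memory equation itself is absent: its trace is the bound on \<open>m\<close> in
  \<open>mode_balance\<close> together with the inequalities for \<open>dm\<close> and
  \<open>dh\<close>. In this form it can be verified on the closure of the operator.\<close>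

definition mode_solution ::
  "real \<Rightarrow> real \<Rightarrow> (real \<Rightarrow> 'a::real_inner) \<Rightarrow> (real \<Rightarrow> 'a) \<Rightarrow> (real \<Rightarrow> 'a) \<Rightarrow> (real \<Rightarrow> 'a) \<Rightarrow> (real \<Rightarrow> 'a) \<Rightarrow>
   (real \<Rightarrow> real) \<Rightarrow> bool" where
  "mode_solution x B v w u q m h \<longleftrightarrow> (\<forall>t\<ge>0. half_deriv v (u t) t \<and> half_deriv w (\<gamma> *\<^sub>R u t - q t) t \<and>
    (\<exists>du dq dm dh. half_deriv u du t \<and> half_deriv q dq t \<and> half_deriv m dm t \<and> half_deriv h dh t \<and>
      mode_balance x B (v t) (w t) (m t) (h t) du dq \<and> (norm (dm - \<zeta> *\<^sub>R u t))\<^sup>2 \<le> k0\<^sup>2 * \<zeta> * h t \<and>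
      dh \<le> 2 * inner (m t) (u t) - k1 * h t))"

lemma mode_solutionE:
  assumes "mode_solution x B v w u q m h" "0 \<le> t"
  obtains du dq dm dh where "half_deriv v (u t) t" "half_deriv w (\<gamma> *\<^sub>R u t - q t) t"
    "half_deriv u du t" "half_deriv q dq t" "half_deriv m dm t" "half_deriv h dh t"
    "mode_balance x B (v t) (w t) (m t) (h t) du dq" "(norm (dm - \<zeta> *\<^sub>R u t))\<^sup>2 \<le> k0\<^sup>2 * \<zeta> * h t"
    "dh \<le> 2 * inner (m t) (u t) - k1 * h t"
  using assms unfolding mode_solution_def by blast

lemma mode_solution_bounds:
  assumes "mode_solution x B v w u q m h"
  shows "x0 \<le> x" "0 < x" "\<kappa> * x \<le> B" "B \<le> \<alpha>1 * x" "0 \<le> t \<Longrightarrow> 0 \<le> h t"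
proof -
  have "x0 \<le> x \<and> \<kappa> * x \<le> B \<and> B \<le> \<alpha>1 * x \<and> 0 \<le> h t" if "0 \<le> t" for t
    using assms that unfolding mode_solution_def mode_balance_def by blast
  from this[of 0] this[of t] show "x0 \<le> x" "0 < x" "\<kappa> * x \<le> B" "B \<le> \<alpha>1 * x" "0 \<le> t \<Longrightarrow> 0 \<le> h t"
    using pos by auto
qed

lemma mode_energy_nonneg:
  assumes "x0 \<le> x" "\<kappa> * x \<le> B" "0 \<le> h"
  shows "0 \<le> mode_energy x B v w u q h"
proof -
  have "0 < x" using assms pos by simp
  moreover from this have "0 < \<kappa> * x" using pos by simp
  moreover have "0 \<le> B" using assms calculation by linarith
  ultimately show ?thesis
    using assms pos by (auto simp: mode_energy_def intro!: add_nonneg_nonneg)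
qed

text \<open>The exchange between \<open>v\<close>, \<open>w\<close>, \<open>u\<close>,
  \<open>q\<close> is conservative and cancels. The work
  \<open>- 2 * x powr a * inner (m t) (u t)\<close> left by the equation for \<open>u\<close>
  cancels against the source in the memory inequality, so only the kernel decay remains.\<close>

lemma mode_energy_derivative:
  assumes S: "mode_solution x B v w u q m h" and t: "0 \<le> t"
  obtains dE where "half_deriv (\<lambda>t. mode_energy x B (v t) (w t) (u t) (q t) (h t)) dE t"
    "dE \<le> - k1 * (x powr a) * h t"
proof -
  obtain du dq dm dh where d: "half_deriv v (u t) t" "half_deriv w (\<gamma> *\<^sub>R u t - q t) t"
    "half_deriv u du t" "half_deriv q dq t" "half_deriv h dh t"
    and bal: "mode_balance x B (v t) (w t) (m t) (h t) du dq" and dh: "dh \<le> 2 * inner (m t) (u t) - k1 * h t"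
    using S t by (rule mode_solutionE)
  have du: "\<rho> *\<^sub>R du = - B *\<^sub>R v t - (\<gamma> * \<beta> * x) *\<^sub>R w t - (x powr a) *\<^sub>R m t" and dq: "\<mu> *\<^sub>R dq = (\<beta> * x) *\<^sub>R w t"
    using bal by (auto simp: mode_balance_def)
  note ip = bounded_bilinear.has_vector_derivative[OF bounded_bilinear_inner]
  define dE where "dE = B * (inner (v t) (u t) + inner (u t) (v t))
    + \<beta> * x * (inner (w t) (\<gamma> *\<^sub>R u t - q t) + inner (\<gamma> *\<^sub>R u t - q t) (w t))
    + \<rho> * (inner (u t) du + inner du (u t)) + \<mu> * (inner (q t) dq + inner dq (q t)) + x powr a * dh"
  have der: "((\<lambda>t. mode_energy x B (v t) (w t) (u t) (q t) (h t)) has_vector_derivative dE) (at t within {0..})"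
    unfolding mode_energy_def power2_norm_eq_inner dE_def
    by (intro has_vector_derivative_add has_vector_derivative_mult_right ip d)
  have "dE = 2 * B * inner (u t) (v t) + 2 * \<beta> * x * inner (\<gamma> *\<^sub>R u t - q t) (w t)
    + 2 * inner (\<rho> *\<^sub>R du) (u t) + 2 * inner (\<mu> *\<^sub>R dq) (q t) + x powr a * dh"
    by (simp add: dE_def inner_commute algebra_simps)
  also have "\<dots> = - 2 * x powr a * inner (m t) (u t) + x powr a * dh"
    unfolding du dq by (simp add: inner_diff_left inner_diff_right inner_commute algebra_simps)
  also have "\<dots> \<le> - 2 * x powr a * inner (m t) (u t) + x powr a * (2 * inner (m t) (u t) - k1 * h t)"
    using dh by (intro add_left_mono mult_left_mono) auto
  finally have "dE \<le> - k1 * (x powr a) * h t" by (simp add: algebra_simps)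
  with der show ?thesis by (rule that)
qed

end

text \<open>\<open>exp (c * t) * f t\<close> does not increase. Stated for \<open>f\<close> of
  either sign, as it is applied to an energy minus a constant, and also used with
  \<open>c = 0\<close> to obtain monotonicity.\<close>

lemma gronwall_decay:
  fixes f :: "real \<Rightarrow> real"
  assumes der: "\<And>t. 0 \<le> t \<Longrightarrow> \<exists>d. half_deriv f d t \<and> d \<le> - c * f t"
    and st: "0 \<le> s" "s \<le> t"
  shows "f t \<le> exp (- c * (t - s)) * f s"
proof (cases "s = t")
  case False
  have E: "((\<lambda>t. exp (c * t) * f t) has_vector_derivative
      exp (c * r) * d + (c * exp (c * r)) * f r) (at r within {0..})"
    if "(f has_vector_derivative d) (at r within {0..})" for r d
    unfolding has_real_derivative_iff_has_vector_derivative[symmetric]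
    using that[unfolded has_real_derivative_iff_has_vector_derivative[symmetric]]
    by (auto intro!: derivative_eq_intros)
  have "exp (c * t) * f t \<le> exp (c * s) * f s"
  proof (rule DERIV_nonpos_imp_decreasing_open[of s t "\<lambda>t. exp (c * t) * f t"])
    show "s \<le> t" by fact
    fix r assume r: "s < r" "r < t"
    then obtain d where d: "(f has_vector_derivative d) (at r within {0..})" "d \<le> - c * f r"
      using der[of r] st by auto
    have "at r within {0..} = at r"
      using r st by (intro at_within_interior) (auto simp: interior_Ici)
    with E[OF d(1)] have "((\<lambda>t. exp (c * t) * f t) has_real_derivative
      exp (c * r) * d + (c * exp (c * r)) * f r) (at r)"
      by (simp add: has_real_derivative_iff_has_vector_derivative)
    moreover have "exp (c * r) * d + (c * exp (c * r)) * f r \<le> 0"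
    proof -
      have "exp (c * r) * (d + c * f r) \<le> 0" using d by (intro mult_nonneg_nonpos) auto
      then show ?thesis by (simp add: algebra_simps)
    qed
    ultimately show "\<exists>y. ((\<lambda>t. exp (c * t) * f t) has_real_derivative y) (at r) \<and> y \<le> 0" by blast
  next
    have "continuous (at r within {0..}) (\<lambda>t. exp (c * t) * f t)" if "0 \<le> r" for r
      using der[OF that] E has_vector_derivative_continuous by blast
    then have "continuous_on {0..} (\<lambda>t. exp (c * t) * f t)"
      by (auto simp: continuous_on_eq_continuous_within)
    then show "continuous_on {s..t} (\<lambda>t. exp (c * t) * f t)"
      by (rule continuous_on_subset) (use st in auto)
  qed
  then have "exp (- (c * t)) * (exp (c * t) * f t) \<le> exp (- (c * t)) * (exp (c * s) * f s)"
    by (intro mult_left_mono) auto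
  also have "exp (- (c * t)) * (exp (c * t) * f t) = f t"
    by (simp add: exp_minus)
  also have "exp (- (c * t)) * (exp (c * s) * f s) = exp (- c * (t - s)) * f s"
  proof -
    have "- (c * t) + c * s = - c * (t - s)" by (simp add: algebra_simps)
    then show ?thesis by (simp flip: exp_add mult.assoc)
  qed
  finally show ?thesis .
qed simp

section \<open>Exponential and polynomial decay of one mode\<close>

context mode_params
begin

lemma mode_exp_decay:
  obtains K c where "0 < K" "0 < c"
    "\<And>x B (v :: real \<Rightarrow> 'a::real_inner) w u q m h s t.
      \<lbrakk>mode_solution x B v w u q m h; 0 \<le> s; s \<le> t\<rbrakk> \<Longrightarrow>
      mode_energy x B (v t) (w t) (u t) (q t) (h t)
        \<le> K * exp (- c * x powr (a - 1) * (t - s)) * mode_energy x B (v s) (w s) (u s) (q s) (h s)"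
proof -
  obtain M K1 K4 K5 c where M: "0 < M" and c: "0 < c" and lyap:
    "\<And>x B h (v :: 'a) w u q m du dq dm.
      \<lbrakk>mode_balance x B v w m h du dq; (norm (dm - \<zeta> *\<^sub>R u))\<^sup>2 \<le> k0\<^sup>2 * \<zeta> * h\<rbrakk> \<Longrightarrow>
       dcross K1 K4 K5 v w u q m du dq dm \<le> M * k1 * (x * h) - c * mode_energy x B v w u q h \<and>
       \<bar>cross K1 K4 K5 v w u q m\<bar> \<le> M / 2 * (x powr (1 - a) * mode_energy x B v w u q h)"
    by (rule lyapunov_exists) blast
  show ?thesis
  \<comment> \<open>\<open>L\<close> lies between \<open>M / 2\<close> and \<open>3 * M / 2\<close>
    times \<open>y * E\<close>. The ratio of these bounds is the factor \<open>3\<close>, and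
    dividing the decay \<open>c * E\<close> by the upper bound gives the rate.\<close>
  proof (rule that[of 3 "c * 2 / (3 * M)"], goal_cases)
    case (3 x B v w u q m h s t)
    note S = this(1) and st = this(2,3)
    note x = mode_solution_bounds[OF S]
    define y where "y = x powr (1 - a)"
    have y: "0 < y" using x by (simp add: y_def)
    have yx: "y * x powr a = x" using x by (simp add: y_def flip: powr_add)
    have yi: "1 / y = x powr (a - 1)" using x by (simp add: y_def powr_diff)
    define E where "E t = mode_energy x B (v t) (w t) (u t) (q t) (h t)" for t
    define F where "F t = cross K1 K4 K5 (v t) (w t) (u t) (q t) (m t)" for t
    define L where "L t = M * y * E t + F t" for t
    have E0: "0 \<le> E t" if "0 \<le> t" for t
      using x that unfolding E_def by (intro mode_energy_nonneg)
    have main: "\<bar>F t\<bar> \<le> M / 2 * (y * E t) \<and>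
        (\<exists>d. half_deriv L d t \<and> d \<le> - c * E t)" if t: "0 \<le> t" for t
    proof -
      obtain du dq dm dh where d: "half_deriv v (u t) t" "half_deriv w (\<gamma> *\<^sub>R u t - q t) t"
        "half_deriv u du t" "half_deriv q dq t" "half_deriv m dm t"
        and hyp: "mode_balance x B (v t) (w t) (m t) (h t) du dq" "(norm (dm - \<zeta> *\<^sub>R u t))\<^sup>2 \<le> k0\<^sup>2 * \<zeta> * h t"
        using S t by (rule mode_solutionE)
      obtain dE where dE: "half_deriv E dE t" "dE \<le> - k1 * (x powr a) * h t"
        using mode_energy_derivative[OF S t] unfolding E_def by blast
      note ip = bounded_bilinear.has_vector_derivative[OF bounded_bilinear_inner]
      define dF where "dF = dcross K1 K4 K5 (v t) (w t) (u t) (q t) (m t) du dq dm"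
      have sc: "((\<lambda>t. \<rho> *\<^sub>R u t + (\<gamma> * \<mu>) *\<^sub>R q t) has_vector_derivative \<rho> *\<^sub>R du + (\<gamma> * \<mu>) *\<^sub>R dq) (at t within {0..})"
        by (intro has_vector_derivative_add bounded_linear.has_vector_derivative[OF bounded_linear_scaleR_right] d)
      have "half_deriv F dF t"
        unfolding F_def[abs_def] dF_def cross_def dcross_def
        by (intro has_vector_derivative_add has_vector_derivative_mult_right ip d sc)
      then have L: "(L has_vector_derivative M * y * dE + dF) (at t within {0..})"
        unfolding L_def[abs_def] by (intro has_vector_derivative_add has_vector_derivative_mult_right dE)
      have ly: "dF \<le> M * k1 * (x * h t) - c * E t" "\<bar>F t\<bar> \<le> M / 2 * (y * E t)"
        using lyap[OF hyp] unfolding dF_def F_def E_def y_def by auto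
      have "M * y * dE \<le> M * y * (- k1 * (x powr a) * h t)" using dE M y by (intro mult_left_mono) auto
      also have "\<dots> = - M * k1 * ((y * x powr a) * h t)" by simp
      finally have "M * y * dE + dF \<le> - c * E t" using ly unfolding yx by simp
      with L ly show ?thesis by blast
    qed
    have Lb: "M / 2 * (y * E t) \<le> L t" "L t \<le> 3 * M / 2 * (y * E t)" if "0 \<le> t" for t
      using main[OF that] unfolding L_def by (auto simp: algebra_simps abs_le_iff)
    define c' where "c' = c * 2 / (3 * M) * x powr (a - 1)"
    have "\<exists>d. half_deriv L d t \<and> d \<le> - c' * L t" if t: "0 \<le> t" for t
    proof -
      have "c' * L t \<le> c' * (3 * M / 2 * (y * E t))"
        using Lb(2)[OF t] c M by (intro mult_left_mono) (auto simp: c'_def)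
      also have "\<dots> = c * E t" using y M unfolding c'_def yi[symmetric] by simp
      finally show ?thesis using main[OF t] by (auto intro: order_trans)
    qed
    from gronwall_decay[of L, OF this st] have "L t \<le> exp (- c' * (t - s)) * L s" .
    also have "\<dots> \<le> exp (- c' * (t - s)) * (3 * M / 2 * (y * E s))"
      using Lb(2)[OF st(1)] by (intro mult_left_mono) auto
    finally have "M / 2 * (y * E t) \<le> exp (- c' * (t - s)) * (3 * M / 2 * (y * E s))"
      using Lb(1)[of t] st by linarith
    then have "(M / 2 * y) * E t \<le> (M / 2 * y) * (3 * exp (- c' * (t - s)) * E s)"
      by (simp add: algebra_simps)
    then have "E t \<le> 3 * exp (- c' * (t - s)) * E s" by (rule mult_left_le_imp_le) (use M y in simp)
    then show ?case by (simp add: E_def c'_def)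
  qed (use c M in auto)
qed

text \<open>The second energy is that of the time derivatives of \<open>v\<close>, \<open>w\<close>, \<open>u\<close>, \<open>q\<close>. It controls all
  components except the memory, with a gain of one power of \<open>x\<close>.\<close>

lemma mode_energy_le_derivative:
  obtains C where "0 < C"
    "\<And>x B h h' (v :: 'a::real_inner) w u q m dw du dq.
      \<lbrakk>mode_balance x B v w m h du dq; 0 \<le> h'; dw = \<gamma> *\<^sub>R u - q\<rbrakk> \<Longrightarrow>
       mode_energy x B v w u q h \<le> C * (x powr a * h + mode_energy x B u dw du dq h' / x)"
proof -
  define Z where "Z = x0 powr (a - 1)"
  have Z: "0 < Z" using pos by (simp add: Z_def)
  define Cv where "Cv = 3 / \<kappa> * (\<rho> + \<gamma>\<^sup>2 * \<mu> + Z * \<zeta>)"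
  define Cw where "Cw = \<mu> / \<beta>"
  define Cu where "Cu = \<rho> / \<kappa>"
  define Cq where "Cq = 2 * \<mu> * (\<gamma>\<^sup>2 / \<kappa> + 1 / \<beta>)"
  have Cs: "0 < Cv" "0 < Cw" "0 < Cu" "0 < Cq"
    using pos Z by (auto simp: Cv_def Cw_def Cu_def Cq_def intro!: mult_pos_pos add_pos_pos divide_pos_pos)
  show ?thesis
  proof (rule that[of "Cv + Cw + Cu + Cq + 1"], goal_cases)
    case 1 then show ?case using Cs by simp
  next
    case (2 x B h h' v w u q m dw du dq)
    have x0: "x0 \<le> x" and B: "\<kappa> * x \<le> B" "B \<le> \<alpha>1 * x" and h: "0 \<le> h" "0 \<le> h'" and m: "(norm m)\<^sup>2 \<le> \<zeta> * h"
      and du: "\<rho> *\<^sub>R du = - B *\<^sub>R v - (\<gamma> * \<beta> * x) *\<^sub>R w - (x powr a) *\<^sub>R m" and dq: "\<mu> *\<^sub>R dq = (\<beta> * x) *\<^sub>R w"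
      and dw: "dw = \<gamma> *\<^sub>R u - q"
      using 2 by (auto simp: mode_balance_def)
    have x: "0 < x" using x0 pos by simp
    have kx: "0 < \<kappa> * x" using pos x by simp
    have Bp: "0 < B" using kx B by linarith
    define F where "F = mode_energy x B u dw du dq h'"
    define z where "z = x powr a"
    have z: "0 < z" "z \<le> Z * x" using powr_a_le[OF x0] x by (auto simp: z_def Z_def)
    have nn: "0 \<le> B * (norm u)\<^sup>2" "0 \<le> \<beta> * x * (norm dw)\<^sup>2" "0 \<le> \<rho> * (norm du)\<^sup>2" "0 \<le> \<mu> * (norm dq)\<^sup>2" "0 \<le> z * h'"
      using Bp pos x z h by auto
    have Fle: "\<kappa> * x * (norm u)\<^sup>2 \<le> F" "\<beta> * x * (norm dw)\<^sup>2 \<le> F" "\<rho> * (norm du)\<^sup>2 \<le> F" "\<mu> * (norm dq)\<^sup>2 \<le> F" "0 \<le> F"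
      using nn mult_right_mono[OF B(1), of "(norm u)\<^sup>2"] unfolding F_def mode_energy_def z_def by auto
    have u: "(norm u)\<^sup>2 \<le> F / (\<kappa> * x)" using Fle(1) kx by (simp add: pos_le_divide_eq mult.commute)
    have dwl: "(norm dw)\<^sup>2 \<le> F / (\<beta> * x)" using Fle(2) x pos by (simp add: pos_le_divide_eq mult.commute)
    have sq3: "(norm (r1 + r2 + r3))\<^sup>2 \<le> 3 * ((norm r1)\<^sup>2 + (norm r2)\<^sup>2 + (norm r3)\<^sup>2)" for r1 r2 r3 :: 'a
    proof -
      have "norm (r1 + r2 + r3) \<le> norm r1 + norm r2 + norm r3"
        by (intro norm_triangle_le add_right_mono norm_triangle_ineq)
      then have "(norm (r1 + r2 + r3))\<^sup>2 \<le> (norm r1 + norm r2 + norm r3)\<^sup>2" by (intro power_mono) auto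
      also have "\<dots> \<le> 3 * ((norm r1)\<^sup>2 + (norm r2)\<^sup>2 + (norm r3)\<^sup>2)"
        using sum_squares_bound[of "norm r1" "norm r2"] sum_squares_bound[of "norm r1" "norm r3"]
          sum_squares_bound[of "norm r2" "norm r3"]
        by (simp add: power2_eq_square algebra_simps)
      finally show ?thesis .
    qed
    have "\<rho> * (norm u)\<^sup>2 \<le> \<rho> * (F / (\<kappa> * x))" using u pos by (intro mult_left_mono) auto
    then have bu: "\<rho> * (norm u)\<^sup>2 \<le> Cu * (F / x)" by (simp add: Cu_def)
    have "\<mu> * (norm q)\<^sup>2 \<le> Cq * (F / x)"
    proof -
      have "q = \<gamma> *\<^sub>R u + - dw" using dw by simp
      then have "(norm q)\<^sup>2 \<le> 2 * (\<gamma>\<^sup>2 * (norm u)\<^sup>2 + (norm dw)\<^sup>2)"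
        using norm_add_sq_le[of "\<gamma> *\<^sub>R u" "- dw"] by (simp add: power_mult_distrib)
      also have "\<dots> \<le> 2 * (\<gamma>\<^sup>2 * (F / (\<kappa> * x)) + F / (\<beta> * x))"
        using u dwl by (intro mult_left_mono add_mono) auto
      finally have "\<mu> * (norm q)\<^sup>2 \<le> \<mu> * (2 * (\<gamma>\<^sup>2 * (F / (\<kappa> * x)) + F / (\<beta> * x)))"
        using pos by (intro mult_left_mono) auto
      also have "\<dots> = Cq * (F / x)" using pos x by (simp add: Cq_def field_simps)
      finally show ?thesis .
    qed
    note bq = this
    have bw: "\<beta> * x * (norm w)\<^sup>2 \<le> Cw * (F / x)"
    proof -
      have "(\<beta> * x)\<^sup>2 * (norm w)\<^sup>2 = \<mu> * (\<mu> * (norm dq)\<^sup>2)"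
        using arg_cong[OF dq, of "\<lambda>r. (norm r)\<^sup>2"] by (simp add: power_mult_distrib power2_eq_square mult_ac)
      also have "\<dots> \<le> \<mu> * F" using Fle pos by (intro mult_left_mono) auto
      finally show ?thesis using pos x by (simp add: Cw_def field_simps power2_eq_square)
    qed
    have bv: "B * (norm v)\<^sup>2 \<le> Cv * (F / x) + Cv * (z * h)"
    proof -
      \<comment> \<open>Eliminating \<open>w\<close> between the equations for \<open>du\<close> and
        \<open>dq\<close> expresses \<open>v\<close> by the time derivatives and the memory
        mean.\<close>
      have "- B *\<^sub>R v = \<rho> *\<^sub>R du + \<gamma> *\<^sub>R (\<mu> *\<^sub>R dq) + z *\<^sub>R m"
        unfolding du dq by (simp add: z_def algebra_simps)
      then have "B\<^sup>2 * (norm v)\<^sup>2 \<le> 3 * ((norm (\<rho> *\<^sub>R du))\<^sup>2 + (norm (\<gamma> *\<^sub>R (\<mu> *\<^sub>R dq)))\<^sup>2 + (norm (z *\<^sub>R m))\<^sup>2)"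
        using sq3[of "\<rho> *\<^sub>R du" "\<gamma> *\<^sub>R (\<mu> *\<^sub>R dq)" "z *\<^sub>R m"]
        by (metis norm_scaleR power_mult_distrib power2_abs power2_minus)
      also have "\<dots> = 3 * (\<rho> * (\<rho> * (norm du)\<^sup>2) + \<gamma>\<^sup>2 * \<mu> * (\<mu> * (norm dq)\<^sup>2) + z * (z * (norm m)\<^sup>2))"
        by (simp add: power_mult_distrib power2_eq_square mult_ac)
      also have "\<dots> \<le> 3 * (\<rho> * F + \<gamma>\<^sup>2 * \<mu> * F + (Z * x) * (z * (\<zeta> * h)))"
        using Fle pos z m Z x by (intro mult_left_mono add_mono mult_mono) auto
      also have "\<dots> \<le> \<kappa> * Cv * (F + x * (z * h))"
      proof -
        have "0 \<le> \<rho> * (x * (z * h))" "0 \<le> \<gamma>\<^sup>2 * \<mu> * (x * (z * h))" "0 \<le> Z * \<zeta> * F"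
          using pos x z h Z Fle by auto
        moreover have "\<kappa> * Cv = 3 * (\<rho> + \<gamma>\<^sup>2 * \<mu> + Z * \<zeta>)" using pos by (simp add: Cv_def)
        ultimately show ?thesis by (simp add: algebra_simps)
      qed
      finally have *: "B\<^sup>2 * (norm v)\<^sup>2 \<le> \<kappa> * Cv * (F + x * (z * h))" .
      have "(\<kappa> * x) * (B * (norm v)\<^sup>2) \<le> B * (B * (norm v)\<^sup>2)"
        using B Bp by (intro mult_right_mono) auto
      also have "\<dots> \<le> \<kappa> * Cv * (F + x * (z * h))" using * by (simp add: power2_eq_square mult_ac)
      also have "\<dots> = (\<kappa> * x) * (Cv * (F / x) + Cv * (z * h))" using x by (simp add: field_simps)
      finally show ?thesis using kx by (simp only: mult_le_cancel_left_pos)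
    qed
    have "mode_energy x B v w u q h \<le> (Cv * (F / x) + Cv * (z * h)) + Cw * (F / x) + Cu * (F / x) + Cq * (F / x) + z * h"
      using bv bw bu bq unfolding mode_energy_def z_def[symmetric] by linarith
    also have "\<dots> = (Cv + Cw + Cu + Cq) * (F / x) + (Cv + 1) * (z * h)" by (simp add: algebra_simps add_divide_distrib)
    also have "\<dots> \<le> (Cv + Cw + Cu + Cq + 1) * (F / x) + (Cv + Cw + Cu + Cq + 1) * (z * h)"
      using Cs Fle(5) x z h by (intro add_mono[of _ _ "_ * (z * h)"] mult_right_mono) auto
    finally show ?case by (simp add: F_def z_def algebra_simps)
  qed
qed

text \<open>Raise \<open>s / p \<le> exp (s / p)\<close> to the power \<open>p\<close>.\<close>

lemma exp_powr_bound:
  fixes p :: real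
  assumes "0 < p"
  obtains C where "0 < C" "\<And>s. 0 < s \<Longrightarrow> s powr p * exp (- s) \<le> C"
proof (rule that[of "p powr p + 1"])
  fix s :: real assume s: "0 < s"
  have "s / p \<le> exp (s / p)" using exp_ge_add_one_self[of "s / p"] by linarith
  then have "(s / p) powr p \<le> exp (s / p) powr p" using s assms by (intro powr_mono2) auto
  also have "\<dots> = exp s" using assms by (simp add: powr_def)
  finally have "s powr p \<le> p powr p * exp s"
    using s assms by (simp add: powr_divide divide_le_eq mult.commute)
  then have "s powr p * exp (- s) \<le> p powr p * exp s * exp (- s)" by (intro mult_right_mono) auto
  then show "s powr p * exp (- s) \<le> p powr p + 1" by (simp add: mult.assoc exp_minus_inverse flip: exp_add)
qed (use assms in \<open>auto intro: add_pos_pos\<close>)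

lemma mode_poly_decay:
  obtains C where "0 < C"
    "\<And>x B (v :: real \<Rightarrow> 'a::real_inner) w u q m h dw du dq h' F0 t.
      \<lbrakk>mode_solution x B v w u q m h; 0 < t;
       \<And>t. 0 \<le> t \<Longrightarrow> mode_balance x B (v t) (w t) (m t) (h t) (du t) (dq t) \<and> 0 \<le> h' t \<and> dw t = \<gamma> *\<^sub>R u t - q t;
       \<And>t. 0 \<le> t \<Longrightarrow> mode_energy x B (u t) (dw t) (du t) (dq t) (h' t) \<le> F0\<rbrakk> \<Longrightarrow>
      mode_energy x B (v t) (w t) (u t) (q t) (h t)
        \<le> C * t powr (- (1 / (1 - a))) * (mode_energy x B (v 0) (w 0) (u 0) (q 0) (h 0) + F0)"
proof -
  obtain K c where K: "0 < K" "0 < c" and decay: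
    "\<And>x B (v :: real \<Rightarrow> 'a) w u q m h s t.
      \<lbrakk>mode_solution x B v w u q m h; 0 \<le> s; s \<le> t\<rbrakk> \<Longrightarrow>
      mode_energy x B (v t) (w t) (u t) (q t) (h t)
        \<le> K * exp (- c * x powr (a - 1) * (t - s)) * mode_energy x B (v s) (w s) (u s) (q s) (h s)"
    by (rule mode_exp_decay) blast
  obtain C1 where C1: "0 < C1" and stat:
    "\<And>x B h h' (v :: 'a) w u q m dw du dq.
      \<lbrakk>mode_balance x B v w m h du dq; 0 \<le> h'; dw = \<gamma> *\<^sub>R u - q\<rbrakk> \<Longrightarrow>
       mode_energy x B v w u q h \<le> C1 * (x powr a * h + mode_energy x B u dw du dq h' / x)"
    by (rule mode_energy_le_derivative) blast
  define p where "p = 1 / (1 - a)"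
  have p: "0 < p" "(1 - a) * p = 1" using a by (auto simp: p_def)
  obtain C2 where C2: "0 < C2" "\<And>s. 0 < s \<Longrightarrow> s powr p * exp (- s) \<le> C2"
    using exp_powr_bound[OF p(1)] by blast
  \<comment> \<open>Inserting the bound of \<open>E\<close> by \<open>x powr a * h\<close> and
    \<open>F0 / x\<close> into the dissipation gives
    \<open>dE \<le> - c1 * (E - C1 * F0 / x)\<close>, a Gronwall inequality whose rate does not
    depend on \<open>x\<close>.\<close>
  define c1 where "c1 = k1 / C1"
  have c1: "0 < c1" using pos C1 by (simp add: c1_def)
  define C where "C = max 1 K * (C2 / (c1 / 2) powr p + C1 * C2 / (c / 2) powr p)"
  have Cp: "0 < C"
    unfolding C_def using K C1 C2 c1 by (intro mult_pos_pos add_pos_pos divide_pos_pos) auto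
  have time: "exp (- (d * t)) \<le> C2 / d powr p * t powr (- p)" if "0 < d" "0 < t" for d t
  proof -
    have "(d * t) powr p * exp (- (d * t)) \<le> C2" using C2(2)[of "d * t"] that by simp
    then show ?thesis using that by (simp add: powr_mult powr_minus field_simps)
  qed
  show ?thesis
  proof (rule that[OF Cp], goal_cases)
    case (1 x B v w u q m h dw du dq h' F0 t)
    note S = 1(1) and t = 1(2) and eqs = 1(3) and F0 = 1(4)
    note x = mode_solution_bounds[OF S]
    define E where "E t = mode_energy x B (v t) (w t) (u t) (q t) (h t)" for t
    have E0: "0 \<le> E t" if "0 \<le> t" for t
      using x that unfolding E_def by (intro mode_energy_nonneg)
    have F0p: "0 \<le> F0"
      using F0[of 0] eqs[of 0] x mode_energy_nonneg[of x B "h' 0" "u 0" "dw 0" "du 0" "dq 0"] by simp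
    have d: "\<exists>d. ((\<lambda>t. E t - C1 * F0 / x) has_vector_derivative d) (at t within {0..}) \<and> d \<le> - c1 * (E t - C1 * F0 / x)"
      if t: "0 \<le> t" for t
    proof -
      obtain dE where dE: "half_deriv E dE t" "dE \<le> - k1 * (x powr a) * h t"
        using mode_energy_derivative[OF S t] unfolding E_def by blast
      have "E t \<le> C1 * (x powr a * h t + mode_energy x B (u t) (dw t) (du t) (dq t) (h' t) / x)"
        unfolding E_def using eqs[OF t] by (intro stat) auto
      also have "\<dots> \<le> C1 * (x powr a * h t + F0 / x)"
        using F0[OF t] x C1 by (intro mult_left_mono add_left_mono divide_right_mono) auto
      finally have "c1 * (E t - C1 * F0 / x) \<le> c1 * (C1 * (x powr a * h t))"
        using c1 by (intro mult_left_mono) (auto simp: algebra_simps)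
      also have "\<dots> = k1 * (x powr a) * h t" using C1 by (simp add: c1_def)
      finally have "dE \<le> - c1 * (E t - C1 * F0 / x)" using dE by simp
      moreover have "((\<lambda>t. E t - C1 * F0 / x) has_vector_derivative dE) (at t within {0..})"
        using has_vector_derivative_diff[OF dE(1) has_vector_derivative_const] by simp
      ultimately show ?thesis by blast
    qed
    have "E (t / 2) - C1 * F0 / x \<le> exp (- c1 * (t / 2 - 0)) * (E 0 - C1 * F0 / x)"
      using t by (intro gronwall_decay d) auto
    also have "\<dots> \<le> exp (- (c1 / 2 * t)) * E 0"
    proof -
      have "exp (- c1 * (t / 2 - 0)) = exp (- (c1 / 2 * t))" by simp
      then show ?thesis using F0p C1 x by (simp only:) (intro mult_left_mono, auto)
    qed
    also have "\<dots> \<le> C2 / (c1 / 2) powr p * t powr (- p) * E 0"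
      using time[of "c1 / 2" t] c1 t E0[of 0] by (intro mult_right_mono) auto
    finally have half: "E (t / 2) \<le> C2 / (c1 / 2) powr p * t powr (- p) * E 0 + C1 * F0 / x" by simp
    define e where "e = exp (- c * x powr (a - 1) * (t / 2))"
    have e: "0 < e" "e \<le> 1" using K t by (auto simp: e_def)
    \<comment> \<open>The exponent \<open>p\<close> is the one for which \<open>1 / x\<close> is the
      \<open>p\<close>-th power of the factor \<open>x powr (a - 1)\<close> in the rate. The powers
      of \<open>x\<close> then cancel, and the bound is uniform over the modes.\<close>
    have "1 / x = (x powr (a - 1)) powr p"
    proof -
      have "(a - 1) * p = - 1" using p(2) by (simp add: algebra_simps)
      then show ?thesis using x by (simp add: powr_powr powr_minus_divide)
    qed
    also have "\<dots> * e \<le> C2 / (c / 2) powr p * t powr (- p)"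
    proof -
      define d where "d = c / 2 * x powr (a - 1)"
      have d: "0 < d" using K x by (simp add: d_def)
      have "e = exp (- (d * t))" by (simp add: e_def d_def)
      also have "\<dots> \<le> C2 / d powr p * t powr (- p)" using time d t by blast
      also have "d powr p = (c / 2) powr p * (x powr (a - 1)) powr p"
        unfolding d_def by (rule powr_mult)
      finally have "(x powr (a - 1)) powr p * e \<le> (x powr (a - 1)) powr p *
         (C2 / ((c / 2) powr p * (x powr (a - 1)) powr p) * t powr (- p))"
        by (intro mult_left_mono) auto
      also have "\<dots> = C2 / (c / 2) powr p * t powr (- p)" using x by simp
      finally show ?thesis .
    qed
    finally have ex: "1 / x * e \<le> C2 / (c / 2) powr p * t powr (- p)" .
    have "E t \<le> K * e * E (t / 2)"
      using decay[OF S, of "t / 2" t] t unfolding E_def e_def by simp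
    also have "\<dots> \<le> max 1 K * e * E (t / 2)"
      using e E0[of "t / 2"] t by (intro mult_right_mono) auto
    also have "\<dots> \<le> max 1 K * e * (C2 / (c1 / 2) powr p * t powr (- p) * E 0 + C1 * F0 / x)"
      using half e by (intro mult_left_mono) auto
    also have "\<dots> = max 1 K * (e * (C2 / (c1 / 2) powr p * t powr (- p) * E 0) + C1 * F0 * (1 / x * e))"
      by (simp add: algebra_simps)
    also have "\<dots> \<le> max 1 K * (1 * (C2 / (c1 / 2) powr p * t powr (- p) * E 0)
        + C1 * F0 * (C2 / (c / 2) powr p * t powr (- p)))"
      using e ex C1 C2 F0p E0[of 0] by (intro mult_left_mono add_mono mult_right_mono) auto
    also have "\<dots> = max 1 K * (C2 / (c1 / 2) powr p * E 0 + C1 * C2 / (c / 2) powr p * F0) * t powr (- p)"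
      by (simp add: algebra_simps)
    also have "\<dots> \<le> max 1 K * ((C2 / (c1 / 2) powr p + C1 * C2 / (c / 2) powr p) * (E 0 + F0)) * t powr (- p)"
    proof -
      have ef: "r1 * e + r2 * f \<le> (r1 + r2) * (e + f)" if "0 \<le> r1" "0 \<le> r2" "0 \<le> e" "0 \<le> f" for r1 r2 e f :: real
        using that by (simp add: distrib_left distrib_right)
      show ?thesis
        using C1 C2 F0p E0[of 0] by (intro mult_right_mono mult_left_mono ef) auto
    qed
    also have "\<dots> = C * t powr (- p) * (E 0 + F0)" by (simp add: C_def)
    finally show ?case by (simp add: E_def p_def)
  qed
qed

end

section \<open>Modes of a state\<close>

text \<open>\<open>gap\<close> is the coercivity inequality of the setting, tested on the
  eigenvectors. It yields the lower bound for \<open>B k\<close> and thereby nonnegative mode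
  energies.\<close>

locale memory_system = spectral \<Psi> D A \<xi> + memory_kernel g g' k0 k1
  for \<Psi> :: "nat \<Rightarrow> 'h::{complex_hilbert, second_countable_topology}"
    and D :: "'h set" and A :: "'h \<Rightarrow> 'h" and \<xi> :: "nat \<Rightarrow> real" and g g' :: "real \<Rightarrow> real" and k0 k1 :: real +
  fixes a \<rho> \<mu> \<alpha> \<beta> \<gamma> \<kappa> :: real
  assumes a: "0 \<le> a" "a < 1"
    and pos: "0 < \<rho>" "0 < \<mu>" "0 < \<alpha>" "0 < \<beta>" "0 < \<gamma>" "0 < \<alpha> - \<gamma>\<^sup>2 * \<beta>" "0 < \<kappa>"
    and gap: "\<And>k. \<kappa> * \<xi> k \<le> (\<alpha> - \<gamma>\<^sup>2 * \<beta>) * \<xi> k - kernel_mass g * \<xi> k powr a"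
begin

abbreviation V :: "'h state set" where
  "V \<equiv> state_space \<xi> \<Psi> a g"

abbreviation N :: "'h state \<Rightarrow> real" where
  "N \<equiv> state_norm \<xi> \<Psi> a \<rho> \<mu> \<alpha> \<beta> \<gamma> g"

abbreviation B :: "nat \<Rightarrow> real" where
  "B k \<equiv> (\<alpha> - \<gamma>\<^sup>2 * \<beta>) * \<xi> k - kernel_mass g * \<xi> k powr a"

sublocale mode: mode_params a \<rho> \<mu> \<beta> \<gamma> "\<alpha> - \<gamma>\<^sup>2 * \<beta>" "kernel_mass g" \<kappa> k0 k1 "\<xi> 0"
  using a pos k mass_pos eigenvalue_pos by unfold_locales auto

definition mode_v :: "nat \<Rightarrow> 'h state \<Rightarrow> complex" where
  "mode_v k = (\<lambda>(v, u, p, q, \<eta>). cinner v (\<Psi> k))"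
definition mode_u :: "nat \<Rightarrow> 'h state \<Rightarrow> complex" where
  "mode_u k = (\<lambda>(v, u, p, q, \<eta>). cinner u (\<Psi> k))"
definition mode_w :: "nat \<Rightarrow> 'h state \<Rightarrow> complex" where
  "mode_w k = (\<lambda>(v, u, p, q, \<eta>). \<gamma> *\<^sub>R cinner v (\<Psi> k) - cinner p (\<Psi> k))"
definition mode_q :: "nat \<Rightarrow> 'h state \<Rightarrow> complex" where
  "mode_q k = (\<lambda>(v, u, p, q, \<eta>). cinner q (\<Psi> k))"
definition mode_memory :: "nat \<Rightarrow> 'h state \<Rightarrow> real \<Rightarrow> complex" where
  "mode_memory k = (\<lambda>(v, u, p, q, \<eta>) s. cinner (\<eta> s) (\<Psi> k))"
definition mode_m :: "nat \<Rightarrow> 'h state \<Rightarrow> complex" where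
  "mode_m k X = (\<integral>s. mode_memory k X s \<partial>G)"
definition mode_h :: "nat \<Rightarrow> 'h state \<Rightarrow> real" where
  "mode_h k X = sq_norm G (mode_memory k X)"
definition mode_E :: "nat \<Rightarrow> 'h state \<Rightarrow> real" where
  "mode_E k X = mode.mode_energy (\<xi> k) (B k) (mode_v k X) (mode_w k X) (mode_u k X) (mode_q k X) (mode_h k X)"

lemmas mode_defs = mode_v_def mode_u_def mode_w_def mode_q_def mode_memory_def

lemma mode_h_nonneg [simp]: "0 \<le> mode_h k X"
  by (simp add: mode_h_def)

lemma mode_E_nonneg: "0 \<le> mode_E k X"
  unfolding mode_E_def by (rule mode.mode_energy_nonneg) (auto simp: eigenvalue_ge gap)

subsection \<open>Memory components\<close>

lemma measurable_cinner:
  assumes "\<eta> \<in> borel_measurable M"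
  shows "(\<lambda>s. cinner (\<eta> s :: 'h) y) \<in> borel_measurable M"
  using assms by (rule borel_measurable_continuous_on[rotated])
    (rule bounded_linear.continuous_on[OF bounded_linear_cinner_left continuous_on_id])

text \<open>On \<open>frac_dom \<xi> \<Psi> (a/2)\<close> this is the squared norm of the fractional
  power. As a series of measurable functions it is measurable along any measurable memory.\<close>

definition memory_weight :: "'h \<Rightarrow> real" where
  "memory_weight f = (\<Sum>k. \<xi> k powr a * (cmod (cinner f (\<Psi> k)))\<^sup>2)"

lemma memory_weight_sums:
  assumes "f \<in> frac_dom \<xi> \<Psi> (a/2)"
  shows "(\<lambda>k. \<xi> k powr a * (cmod (cinner f (\<Psi> k)))\<^sup>2) sums memory_weight f"
    and "memory_weight f = (norm (frac_pow \<xi> \<Psi> (a/2) f))\<^sup>2"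
  using norm_frac_pow_sums[OF assms] by (auto simp: memory_weight_def sums_iff)

lemma memory_weight_measurable:
  assumes "\<eta> \<in> borel_measurable pos_line"
  shows "(\<lambda>s. memory_weight (\<eta> s)) \<in> borel_measurable pos_line"
  unfolding memory_weight_def
  using measurable_cinner[OF assms] by (intro borel_measurable_suminf) auto

lemma L2_memory_iff:
  "\<eta> \<in> L2_memory \<xi> \<Psi> a g \<longleftrightarrow> \<eta> \<in> borel_measurable pos_line \<and>
     (\<forall>s>0. \<eta> s \<in> frac_dom \<xi> \<Psi> (a/2)) \<and> integrable G (\<lambda>s. memory_weight (\<eta> s))"
proof -
  have "integrable pos_line (\<lambda>s. g s * (norm (frac_pow \<xi> \<Psi> (a/2) (\<eta> s)))\<^sup>2) \<longleftrightarrow> integrable G (\<lambda>s. memory_weight (\<eta> s))"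
    if "\<eta> \<in> borel_measurable pos_line" "\<forall>s>0. \<eta> s \<in> frac_dom \<xi> \<Psi> (a/2)"
  proof -
    have "integrable pos_line (\<lambda>s. g s * (norm (frac_pow \<xi> \<Psi> (a/2) (\<eta> s)))\<^sup>2) \<longleftrightarrow>
      integrable pos_line (\<lambda>s. g s *\<^sub>R memory_weight (\<eta> s))"
      using that by (intro Bochner_Integration.integrable_cong) (auto simp: space_pos_line memory_weight_sums)
    then show ?thesis using integral_memory_measure(1)[OF memory_weight_measurable[OF that(1)]] by simp
  qed
  then show ?thesis
    unfolding L2_memory_def set_integrable_pos_line set_borel_measurable_pos_line by auto
qed

lemma cmod_le_memory_weight:
  assumes "f \<in> frac_dom \<xi> \<Psi> (a/2)"
  shows "\<xi> k powr a * (cmod (cinner f (\<Psi> k)))\<^sup>2 \<le> memory_weight f"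
proof -
  have "(\<Sum>k\<in>{k}. \<xi> k powr a * (cmod (cinner f (\<Psi> k)))\<^sup>2) \<le> memory_weight f"
    unfolding memory_weight_def
    by (rule sum_le_suminf[OF sums_summable[OF memory_weight_sums(1)[OF assms]]]) auto
  then show ?thesis by simp
qed

lemma norm_le_memory_weight:
  assumes "f \<in> frac_dom \<xi> \<Psi> (a/2)"
  shows "(norm f)\<^sup>2 \<le> \<xi> 0 powr (- a) * memory_weight f"
proof (rule sums_le[OF _ parseval[of "f"] sums_mult[OF memory_weight_sums(1)[OF assms]]])
  fix k
  have "1 = \<xi> 0 powr (- a) * \<xi> 0 powr a" using eigenvalue_pos[of 0] by (simp flip: powr_add)
  also have "\<dots> \<le> \<xi> 0 powr (- a) * \<xi> k powr a"
    using a eigenvalue_ge[of k] eigenvalue_pos[of 0] by (intro mult_left_mono powr_mono2) auto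
  finally have "1 * (cmod (cinner f (\<Psi> k)))\<^sup>2 \<le> \<xi> 0 powr (- a) * \<xi> k powr a * (cmod (cinner f (\<Psi> k)))\<^sup>2"
    by (rule mult_right_mono) simp
  then show "(cmod (cinner f (\<Psi> k)))\<^sup>2 \<le> \<xi> 0 powr (- a) * (\<xi> k powr a * (cmod (cinner f (\<Psi> k)))\<^sup>2)"
    by simp
qed

lemma memory_weight_nonneg: "f \<in> frac_dom \<xi> \<Psi> (a/2) \<Longrightarrow> 0 \<le> memory_weight f"
  by (simp add: memory_weight_sums)

lemma L2_memory_square_integrable:
  assumes "\<eta> \<in> L2_memory \<xi> \<Psi> a g"
  shows "square_integrable G (\<lambda>s. cinner (\<eta> s) (\<Psi> k))"
  unfolding square_integrable_def
proof
  have m: "\<eta> \<in> borel_measurable pos_line" and i: "integrable G (\<lambda>s. memory_weight (\<eta> s))"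
    and d: "\<And>s. 0 < s \<Longrightarrow> \<eta> s \<in> frac_dom \<xi> \<Psi> (a/2)"
    using assms by (auto simp: L2_memory_iff)
  show cm: "(\<lambda>s. cinner (\<eta> s) (\<Psi> k)) \<in> borel_measurable G" using measurable_cinner[OF m] by simp
  show "integrable G (\<lambda>s. (cmod (cinner (\<eta> s) (\<Psi> k)))\<^sup>2)"
  proof (rule Bochner_Integration.integrable_bound)
    show "integrable G (\<lambda>s. 1 / \<xi> k powr a * memory_weight (\<eta> s))" using i by simp
    show "AE s in G. norm ((cmod (cinner (\<eta> s) (\<Psi> k)))\<^sup>2) \<le> norm (1 / \<xi> k powr a * memory_weight (\<eta> s))"
      using cmod_le_memory_weight[OF d] eigenvalue_pos[of k] memory_weight_nonneg[OF d]
      by (intro AE_I2) (auto simp: space_memory_measure field_simps abs_mult)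
  qed (use cm in auto)
qed

text \<open>All terms are nonnegative, so sum and integral may be exchanged: the integrals of the
  partial sums stay below that of the weight, which gives the summability that
  \<open>sums_integral\<close> requires.\<close>

lemma L2_memory_sums:
  assumes "\<eta> \<in> L2_memory \<xi> \<Psi> a g"
  shows "(\<lambda>k. \<xi> k powr a * sq_norm G (\<lambda>s. cinner (\<eta> s) (\<Psi> k))) sums (\<integral>s. memory_weight (\<eta> s) \<partial>G)"
proof -
  have m: "\<eta> \<in> borel_measurable pos_line" and i: "integrable G (\<lambda>s. memory_weight (\<eta> s))"
    and d: "\<And>s. 0 < s \<Longrightarrow> \<eta> s \<in> frac_dom \<xi> \<Psi> (a/2)"
    using assms by (auto simp: L2_memory_iff)
  define f where "f k s = \<xi> k powr a * (cmod (cinner (\<eta> s) (\<Psi> k)))\<^sup>2" for k s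
  have fi: "integrable G (f k)" for k
    using L2_memory_square_integrable[OF assms, of k] by (simp add: f_def[abs_def] square_integrable_def)
  have fs: "(\<lambda>k. f k s) sums memory_weight (\<eta> s)" if "0 < s" for s
    using memory_weight_sums(1)[OF d[OF that]] by (simp add: f_def)
  have f0: "0 \<le> f k s" for k s by (simp add: f_def)
  have "(\<lambda>k. integral\<^sup>L G (f k)) sums (\<integral>s. (\<Sum>k. f k s) \<partial>G)"
  proof (rule sums_integral[OF fi])
    show "AE s in G. summable (\<lambda>k. norm (f k s))"
      using fs f0 by (intro AE_I2) (auto simp: space_memory_measure sums_iff)
    show "summable (\<lambda>k. \<integral>s. norm (f k s) \<partial>G)"
    proof (rule summableI_nonneg_bounded)
      show "0 \<le> (\<integral>s. norm (f k s) \<partial>G)" for k by simp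
      show "(\<Sum>k<n. \<integral>s. norm (f k s) \<partial>G) \<le> (\<integral>s. memory_weight (\<eta> s) \<partial>G)" for n
      proof -
        have "(\<Sum>k<n. \<integral>s. norm (f k s) \<partial>G) = (\<integral>s. (\<Sum>k<n. f k s) \<partial>G)"
          using fi f0 by simp
        also have "\<dots> \<le> (\<integral>s. memory_weight (\<eta> s) \<partial>G)"
        proof (intro integral_mono_AE AE_I2 i Bochner_Integration.integrable_sum fi)
          fix s assume "s \<in> space G"
          then have "0 < s" by (simp add: space_memory_measure)
          from fs[OF this] show "(\<Sum>k<n. f k s) \<le> memory_weight (\<eta> s)"
            using sum_le_suminf[OF sums_summable[OF fs[OF \<open>0 < s\<close>]], of "{..<n}"] f0 by (simp add: sums_iff)
        qed
        finally show ?thesis .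
      qed
    qed
  qed
  moreover have "(\<Sum>k. f k s) = memory_weight (\<eta> s)" for s
    by (simp add: f_def memory_weight_def)
  moreover have "integral\<^sup>L G (f k) = \<xi> k powr a * sq_norm G (\<lambda>s. cinner (\<eta> s) (\<Psi> k))" for k
    by (simp add: f_def[abs_def] sq_norm_def)
  ultimately show ?thesis by simp
qed

lemma L2_memory_add:
  assumes "\<eta> \<in> L2_memory \<xi> \<Psi> a g" "\<theta> \<in> L2_memory \<xi> \<Psi> a g"
  shows "(\<lambda>s. \<eta> s + \<theta> s) \<in> L2_memory \<xi> \<Psi> a g"
  unfolding L2_memory_iff
proof (intro conjI allI impI)
  have m: "\<eta> \<in> borel_measurable pos_line" "\<theta> \<in> borel_measurable pos_line"
    and i: "integrable G (\<lambda>s. memory_weight (\<eta> s))" "integrable G (\<lambda>s. memory_weight (\<theta> s))"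
    and d: "\<And>s. 0 < s \<Longrightarrow> \<eta> s \<in> frac_dom \<xi> \<Psi> (a/2)" "\<And>s. 0 < s \<Longrightarrow> \<theta> s \<in> frac_dom \<xi> \<Psi> (a/2)"
    using assms by (auto simp: L2_memory_iff)
  show ms: "(\<lambda>s. \<eta> s + \<theta> s) \<in> borel_measurable pos_line" using m by (intro borel_measurable_add)
  show ds: "\<eta> s + \<theta> s \<in> frac_dom \<xi> \<Psi> (a/2)" if "0 < s" for s using d[OF that] by (rule frac_dom_add)
  show "integrable G (\<lambda>s. memory_weight (\<eta> s + \<theta> s))"
  proof (rule Bochner_Integration.integrable_bound)
    show "integrable G (\<lambda>s. 2 * memory_weight (\<eta> s) + 2 * memory_weight (\<theta> s))" using i by simp
    show "(\<lambda>s. memory_weight (\<eta> s + \<theta> s)) \<in> borel_measurable G" using memory_weight_measurable[OF ms] by simp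
    show "AE s in G. norm (memory_weight (\<eta> s + \<theta> s)) \<le> norm (2 * memory_weight (\<eta> s) + 2 * memory_weight (\<theta> s))"
    proof (intro AE_I2)
      fix s assume "s \<in> space G"
      then have s: "0 < s" by (simp add: space_memory_measure)
      have "memory_weight (\<eta> s + \<theta> s) \<le> 2 * memory_weight (\<eta> s) + 2 * memory_weight (\<theta> s)"
      proof (rule sums_le[OF _ memory_weight_sums(1)[OF ds[OF s]]
            sums_add[OF sums_mult[OF memory_weight_sums(1)[OF d(1)[OF s]]] sums_mult[OF memory_weight_sums(1)[OF d(2)[OF s]]]]])
        fix k
        have "\<xi> k powr a * (cmod (cinner (\<eta> s + \<theta> s) (\<Psi> k)))\<^sup>2 \<le>
          \<xi> k powr a * (2 * (cmod (cinner (\<eta> s) (\<Psi> k)))\<^sup>2 + 2 * (cmod (cinner (\<theta> s) (\<Psi> k)))\<^sup>2)"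
          unfolding cinner_add_left by (intro mult_left_mono norm_add_sq_le) auto
        then show "\<xi> k powr a * (cmod (cinner (\<eta> s + \<theta> s) (\<Psi> k)))\<^sup>2 \<le>
           2 * (\<xi> k powr a * (cmod (cinner (\<eta> s) (\<Psi> k)))\<^sup>2) + 2 * (\<xi> k powr a * (cmod (cinner (\<theta> s) (\<Psi> k)))\<^sup>2)"
          by (simp add: algebra_simps)
      qed
      then show "norm (memory_weight (\<eta> s + \<theta> s)) \<le> norm (2 * memory_weight (\<eta> s) + 2 * memory_weight (\<theta> s))"
        using memory_weight_nonneg[OF ds[OF s]] by simp
    qed
  qed
qed

lemma L2_memory_scale:
  assumes "\<eta> \<in> L2_memory \<xi> \<Psi> a g"
  shows "(\<lambda>s. c *\<^sub>C \<eta> s) \<in> L2_memory \<xi> \<Psi> a g"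
proof -
  have "memory_weight (c *\<^sub>C \<eta> s) = (cmod c)\<^sup>2 * memory_weight (\<eta> s)" if "0 < s" for s
  proof -
    have "\<eta> s \<in> frac_dom \<xi> \<Psi> (a/2)" using assms that by (simp add: L2_memory_iff)
    from sums_mult[OF memory_weight_sums(1)[OF this], of "(cmod c)\<^sup>2"]
    have "(\<Sum>k. (cmod c)\<^sup>2 * (\<xi> k powr a * (cmod (cinner (\<eta> s) (\<Psi> k)))\<^sup>2)) = (cmod c)\<^sup>2 * memory_weight (\<eta> s)"
      by (rule sums_unique[symmetric])
    then show ?thesis
      by (simp add: memory_weight_def cinner_scaleC_left norm_mult power_mult_distrib mult.left_commute)
  qed
  then have "integrable G (\<lambda>s. memory_weight (c *\<^sub>C \<eta> s)) \<longleftrightarrow> integrable G (\<lambda>s. (cmod c)\<^sup>2 * memory_weight (\<eta> s))"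
    by (intro Bochner_Integration.integrable_cong) (auto simp: space_memory_measure)
  moreover have "(\<lambda>s. c *\<^sub>C \<eta> s) \<in> borel_measurable pos_line" if "\<eta> \<in> borel_measurable pos_line"
    using that by (rule borel_measurable_continuous_on[rotated])
      (rule bounded_linear.continuous_on[OF bounded_linear_scaleC_right continuous_on_id])
  ultimately show ?thesis using assms by (auto simp: L2_memory_iff frac_dom_scaleC)
qed

lemma L2_memory_const:
  assumes "u \<in> frac_dom \<xi> \<Psi> (a/2)"
  shows "(\<lambda>s. u) \<in> L2_memory \<xi> \<Psi> a g"
  using assms finite_measure.integrable_const[OF finite_G]
  by (auto simp: L2_memory_iff memory_weight_def)

lemma L2_memory_integrable:
  assumes "\<eta> \<in> L2_memory \<xi> \<Psi> a g"
  shows "integrable G \<eta>"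
proof (rule Bochner_Integration.integrable_bound)
  have i: "integrable G (\<lambda>s. memory_weight (\<eta> s))" and d: "\<And>s. 0 < s \<Longrightarrow> \<eta> s \<in> frac_dom \<xi> \<Psi> (a/2)"
    using assms by (auto simp: L2_memory_iff)
  show "\<eta> \<in> borel_measurable G" using assms by (simp add: L2_memory_iff)
  \<comment> \<open>On the finite measure \<open>G\<close> the constant is integrable, and
    \<open>1 + (norm (\<eta> s))\<^sup>2\<close> dominates \<open>norm (\<eta> s)\<close>.\<close>
  show "integrable G (\<lambda>s. 1 + \<xi> 0 powr (- a) * memory_weight (\<eta> s))"
    using i by (intro Bochner_Integration.integrable_add finite_measure.integrable_const[OF finite_G]) simp
  show "AE s in G. norm (\<eta> s) \<le> norm (1 + \<xi> 0 powr (- a) * memory_weight (\<eta> s))"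
  proof (intro AE_I2)
    fix s assume "s \<in> space G"
    then have s: "0 < s" by (simp add: space_memory_measure)
    have "norm (\<eta> s) \<le> 1 + (norm (\<eta> s))\<^sup>2" using sum_squares_bound[of "norm (\<eta> s)" 1] norm_ge_zero[of "\<eta> s"]
      unfolding power_one mult_1_right by linarith
    also have "\<dots> \<le> 1 + \<xi> 0 powr (- a) * memory_weight (\<eta> s)" using norm_le_memory_weight[OF d[OF s]] by simp
    finally show "norm (\<eta> s) \<le> norm (1 + \<xi> 0 powr (- a) * memory_weight (\<eta> s))" by simp
  qed
qed

subsection \<open>The state norm in terms of the modes\<close>

lemma frac_dom_half: "f \<in> frac_dom \<xi> \<Psi> (1/2) \<Longrightarrow> f \<in> frac_dom \<xi> \<Psi> (a/2)"
  using a by (rule_tac frac_dom_mono[of "a/2" "1/2"]) auto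

text \<open>Every term of the inner product is diagonal in the eigenbasis.
  \<open>0 \<le> N X\<close> is not automatic, because \<open>state_inner\<close> contains a
  negative term and the real \<open>sqrt\<close> of a negative number is negative; it follows from
  \<open>gap\<close> mode by mode.\<close>

lemma norm_sums:
  assumes X: "X \<in> V"
  shows "(\<lambda>k. mode_E k X) sums (N X)\<^sup>2" and "0 \<le> N X"
proof -
  obtain v u p q \<eta> where X_def: "X = (v, u, p, q, \<eta>)" by (cases X)
  have d: "v \<in> frac_dom \<xi> \<Psi> (1/2)" "p \<in> frac_dom \<xi> \<Psi> (1/2)" "\<eta> \<in> L2_memory \<xi> \<Psi> a g"
    using X by (auto simp: X_def state_space_def)
  define P where "P = frac_pow \<xi> \<Psi>"
  have x: "\<xi> k powr 1 = \<xi> k" "\<bar>\<xi> k\<bar> = \<xi> k" for k using eigenvalue_pos[of k] by auto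
  have cn: "cmod (\<gamma> *\<^sub>R (of_real r * z) - of_real r * z') = r * cmod (\<gamma> *\<^sub>R z - z')" if "0 \<le> r" for r z z'
  proof -
    have "\<gamma> *\<^sub>R (of_real r * z) - of_real r * z' = of_real r * (\<gamma> *\<^sub>R z - z')"
      by (simp add: scaleR_conv_of_real algebra_simps)
    then show ?thesis using that by (simp add: norm_mult)
  qed
  have s1: "(\<lambda>k. \<xi> k * (cmod (cinner v (\<Psi> k)))\<^sup>2) sums (norm (P (1/2) v))\<^sup>2"
    using norm_frac_pow_sums[OF d(1)] by (simp add: P_def x)
  have s2: "(\<lambda>k. \<xi> k powr a * (cmod (cinner v (\<Psi> k)))\<^sup>2) sums (norm (P (a/2) v))\<^sup>2"
    using norm_frac_pow_sums[OF frac_dom_half[OF d(1)]] by (simp add: P_def)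
  have s3: "(\<lambda>k. \<xi> k * (cmod (\<gamma> *\<^sub>R cinner v (\<Psi> k) - cinner p (\<Psi> k)))\<^sup>2) sums (norm (\<gamma> *\<^sub>R P (1/2) v - P (1/2) p))\<^sup>2"
  proof -
    have "(cmod (cinner (\<gamma> *\<^sub>R P (1/2) v - P (1/2) p) (\<Psi> k)))\<^sup>2 = \<xi> k * (cmod (\<gamma> *\<^sub>R cinner v (\<Psi> k) - cinner p (\<Psi> k)))\<^sup>2" for k
    proof -
      have "cinner (\<gamma> *\<^sub>R P (1/2) v - P (1/2) p) (\<Psi> k) =
        \<gamma> *\<^sub>R (of_real (\<xi> k powr (1/2)) * cinner v (\<Psi> k)) - of_real (\<xi> k powr (1/2)) * cinner p (\<Psi> k)"
        by (simp add: P_def cinner_diff_left cinner_scaleR_left cinner_frac_pow d scaleR_conv_of_real)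
      then have "(cmod (cinner (\<gamma> *\<^sub>R P (1/2) v - P (1/2) p) (\<Psi> k)))\<^sup>2 =
          (\<xi> k powr (1/2))\<^sup>2 * (cmod (\<gamma> *\<^sub>R cinner v (\<Psi> k) - cinner p (\<Psi> k)))\<^sup>2"
        by (simp only: cn powr_ge_zero power_mult_distrib)
      then show ?thesis using eigenvalue_pos[of k] by (simp add: powr_half_sqrt)
    qed
    then show ?thesis using parseval[of "\<gamma> *\<^sub>R P (1/2) v - P (1/2) p"] by simp
  qed
  have s4: "(\<lambda>k. \<xi> k powr a * mode_h k X) sums (\<integral>s. memory_weight (\<eta> s) \<partial>G)"
    using L2_memory_sums[OF d(3)] by (simp add: mode_h_def mode_memory_def X_def)
  have "(LINT s:{0<..}|lebesgue. complex_of_real (g s) * cinner (P (a/2) (\<eta> s)) (P (a/2) (\<eta> s))) =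
    (\<integral>s. complex_of_real (g s *\<^sub>R memory_weight (\<eta> s)) \<partial>pos_line)"
    unfolding set_lebesgue_integral_pos_line using d(3)
    by (intro Bochner_Integration.integral_cong) (auto simp: space_pos_line L2_memory_iff memory_weight_sums cinner_self P_def)
  also have "\<dots> = complex_of_real (\<integral>s. g s *\<^sub>R memory_weight (\<eta> s) \<partial>pos_line)" by (rule integral_complex_of_real)
  also have "\<dots> = complex_of_real (\<integral>s. memory_weight (\<eta> s) \<partial>G)"
    using d(3) memory_weight_measurable[of \<eta>] by (simp add: integral_memory_measure(2) L2_memory_iff)
  finally have mem: "(LINT s:{0<..}|lebesgue. complex_of_real (g s) * cinner (P (a/2) (\<eta> s)) (P (a/2) (\<eta> s))) =
     complex_of_real (\<integral>s. memory_weight (\<eta> s) \<partial>G)" .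
  define R where "R = Re (state_inner \<xi> \<Psi> a \<rho> \<mu> \<alpha> \<beta> \<gamma> g X X)"
  have "R = (\<alpha> - \<gamma>\<^sup>2 * \<beta>) * (norm (P (1/2) v))\<^sup>2 - kernel_mass g * (norm (P (a/2) v))\<^sup>2
     + \<rho> * (norm u)\<^sup>2 + \<beta> * (norm (\<gamma> *\<^sub>R P (1/2) v - P (1/2) p))\<^sup>2 + \<mu> * (norm q)\<^sup>2
     + (\<integral>s. memory_weight (\<eta> s) \<partial>G)"
    unfolding R_def X_def state_inner.simps Let_def P_def[symmetric]
    unfolding mem unfolding cinner_self by simp
  moreover have "(\<lambda>k. (\<alpha> - \<gamma>\<^sup>2 * \<beta>) * (\<xi> k * (cmod (cinner v (\<Psi> k)))\<^sup>2) - kernel_mass g * (\<xi> k powr a * (cmod (cinner v (\<Psi> k)))\<^sup>2)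
     + \<rho> * (cmod (cinner u (\<Psi> k)))\<^sup>2 + \<beta> * (\<xi> k * (cmod (\<gamma> *\<^sub>R cinner v (\<Psi> k) - cinner p (\<Psi> k)))\<^sup>2)
     + \<mu> * (cmod (cinner q (\<Psi> k)))\<^sup>2 + \<xi> k powr a * mode_h k X) sums
     ((\<alpha> - \<gamma>\<^sup>2 * \<beta>) * (norm (P (1/2) v))\<^sup>2 - kernel_mass g * (norm (P (a/2) v))\<^sup>2
     + \<rho> * (norm u)\<^sup>2 + \<beta> * (norm (\<gamma> *\<^sub>R P (1/2) v - P (1/2) p))\<^sup>2 + \<mu> * (norm q)\<^sup>2
     + (\<integral>s. memory_weight (\<eta> s) \<partial>G))"
    by (intro sums_add sums_diff sums_mult s1 s2 s3 s4 parseval)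
  moreover have "mode_E k X = (\<alpha> - \<gamma>\<^sup>2 * \<beta>) * (\<xi> k * (cmod (cinner v (\<Psi> k)))\<^sup>2) - kernel_mass g * (\<xi> k powr a * (cmod (cinner v (\<Psi> k)))\<^sup>2)
     + \<rho> * (cmod (cinner u (\<Psi> k)))\<^sup>2 + \<beta> * (\<xi> k * (cmod (\<gamma> *\<^sub>R cinner v (\<Psi> k) - cinner p (\<Psi> k)))\<^sup>2)
     + \<mu> * (cmod (cinner q (\<Psi> k)))\<^sup>2 + \<xi> k powr a * mode_h k X" for k
    unfolding mode_E_def mode.mode_energy_def by (simp add: mode_defs X_def algebra_simps)
  ultimately have E: "(\<lambda>k. mode_E k X) sums R" by simp
  then have R: "0 \<le> R" using mode_E_nonneg by (intro sums_le[OF _ sums_zero E]) auto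
  have NR: "N X = sqrt R" by (simp add: state_norm_def R_def)
  show "(\<lambda>k. mode_E k X) sums (N X)\<^sup>2" "0 \<le> N X" using E R by (auto simp: NR)
qed

lemma mode_E_le: "X \<in> V \<Longrightarrow> mode_E k X \<le> (N X)\<^sup>2"
proof -
  assume "X \<in> V"
  note s = norm_sums(1)[OF this]
  have "(\<Sum>k\<in>{k}. mode_E k X) \<le> (\<Sum>k. mode_E k X)"
    by (rule sum_le_suminf[OF sums_summable[OF s]]) (auto simp: mode_E_nonneg)
  then show ?thesis using s by (simp add: sums_iff)
qed

end

context memory_system
begin

subsection \<open>Linear structure and distances\<close>

lemma state_diff_simp [simp]:
  "state_diff (v, u, p, q, \<eta>) (v', u', p', q', \<eta>' :: real \<Rightarrow> 'h) = (v - v', u - u', p - p', q - q', \<lambda>s. \<eta> s - \<eta>' s)"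
  by (simp add: state_diff_def scaleC_minus_one)

lemma V_add: "X \<in> V \<Longrightarrow> Y \<in> V \<Longrightarrow> state_add X Y \<in> V"
  by (cases X; cases Y) (auto simp: state_space_def frac_dom_add L2_memory_add)

lemma V_scale: "X \<in> V \<Longrightarrow> state_scale c X \<in> V"
  by (cases X) (auto simp: state_space_def frac_dom_scaleC L2_memory_scale)

lemma V_diff: "X \<in> V \<Longrightarrow> Y \<in> V \<Longrightarrow> state_diff X Y \<in> V"
  unfolding state_diff_def by (intro V_add V_scale)

lemma mode_add:
  "mode_v k (state_add X Y) = mode_v k X + mode_v k Y"
  "mode_u k (state_add X Y) = mode_u k X + mode_u k Y"
  "mode_w k (state_add X Y) = mode_w k X + mode_w k Y"
  "mode_q k (state_add X Y) = mode_q k X + mode_q k Y"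
  "mode_memory k (state_add X Y) s = mode_memory k X s + mode_memory k Y s"
  by (cases X; cases Y; simp add: mode_defs cinner_add_left scaleR_add_right)+

lemma mode_scale:
  "mode_v k (state_scale c X) = c * mode_v k X"
  "mode_u k (state_scale c X) = c * mode_u k X"
  "mode_w k (state_scale c X) = c * mode_w k X"
  "mode_q k (state_scale c X) = c * mode_q k X"
  "mode_memory k (state_scale c X) s = c * mode_memory k X s"
  by (cases X; simp add: mode_defs cinner_scaleC_left scaleR_conv_of_real algebra_simps)+

lemma mode_memory_square_integrable: "X \<in> V \<Longrightarrow> square_integrable G (mode_memory k X)"
  by (cases X) (auto simp: state_space_def mode_memory_def L2_memory_square_integrable)

lemma mode_m_bound: "X \<in> V \<Longrightarrow> (cmod (mode_m k X))\<^sup>2 \<le> kernel_mass g * mode_h k X"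
  unfolding mode_m_def mode_h_def measure_G[symmetric]
  by (rule cmod_integral_sq_le[OF finite_G mode_memory_square_integrable])

lemma mode_h_add:
  assumes "X \<in> V" "Y \<in> V"
  shows "mode_h k (state_add X Y) = mode_h k X + mode_h k Y + 2 * Re (\<integral>s. mode_memory k X s * cnj (mode_memory k Y s) \<partial>G)"
proof -
  note X = mode_memory_square_integrable[OF assms(1), of k] and Y = mode_memory_square_integrable[OF assms(2), of k]
  note XY = square_integrable_mult_cnj[OF X Y]
  have "mode_h k (state_add X Y) = (\<integral>s. (cmod (mode_memory k X s))\<^sup>2 + (cmod (mode_memory k Y s))\<^sup>2
      + 2 * Re (mode_memory k X s * cnj (mode_memory k Y s)) \<partial>G)"
    unfolding mode_h_def sq_norm_def mode_add
    by (intro Bochner_Integration.integral_cong refl) (simp add: cmod_power2, simp add: power2_eq_square algebra_simps)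
  also have "\<dots> = mode_h k X + mode_h k Y + (\<integral>s. 2 * Re (mode_memory k X s * cnj (mode_memory k Y s)) \<partial>G)"
    using X Y XY unfolding mode_h_def sq_norm_def square_integrable_def
    by (subst Bochner_Integration.integral_add)
      (auto simp del: complex_cnj times_complex.sel complex_mult_cnj intro!: Bochner_Integration.integrable_add integrable_mult_right integrable_Re)
  also have "(\<integral>s. 2 * Re (mode_memory k X s * cnj (mode_memory k Y s)) \<partial>G) =
     2 * Re (\<integral>s. mode_memory k X s * cnj (mode_memory k Y s) \<partial>G)"
    by (simp only: integral_Re[OF XY] integral_mult_right_zero)
  finally show ?thesis .
qed

lemma mode_h_scale: "mode_h k (state_scale c X) = (cmod c)\<^sup>2 * mode_h k X"
  by (simp add: mode_h_def sq_norm_def mode_scale norm_mult power_mult_distrib)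

text \<open>The parallelogram argument: the mixed term changes sign in the difference, whose
  \<open>mode_h\<close> is nonnegative.\<close>

lemma mode_h_add_le:
  assumes "X \<in> V" "Y \<in> V"
  shows "mode_h k (state_add X Y) \<le> 2 * mode_h k X + 2 * mode_h k Y"
proof -
  have "0 \<le> mode_h k (state_add X (state_scale (- 1) Y))" by simp
  also have "\<dots> = mode_h k X + mode_h k Y + 2 * Re (\<integral>s. mode_memory k X s * cnj (mode_memory k (state_scale (- 1) Y) s) \<partial>G)"
    using mode_h_add[OF assms(1) V_scale[OF assms(2), of "- 1"]] by (simp add: mode_h_scale)
  also have "(\<integral>s. mode_memory k X s * cnj (mode_memory k (state_scale (- 1) Y) s) \<partial>G) =
      - (\<integral>s. mode_memory k X s * cnj (mode_memory k Y s) \<partial>G)"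
    by (simp add: mode_scale)
  finally show ?thesis using mode_h_add[OF assms, of k] by simp
qed

lemma B_nonneg: "0 \<le> B k"
proof -
  have "0 \<le> \<kappa> * \<xi> k" using pos eigenvalue_pos[of k] by simp
  then show ?thesis using gap[of k] by linarith
qed

lemma mode_E_add_le:
  assumes "X \<in> V" "Y \<in> V"
  shows "mode_E k (state_add X Y) \<le> 2 * mode_E k X + 2 * mode_E k Y"
proof -
  have "mode_E k (state_add X Y) \<le>
    B k * (2 * (cmod (mode_v k X))\<^sup>2 + 2 * (cmod (mode_v k Y))\<^sup>2)
    + \<beta> * \<xi> k * (2 * (cmod (mode_w k X))\<^sup>2 + 2 * (cmod (mode_w k Y))\<^sup>2)
    + \<rho> * (2 * (cmod (mode_u k X))\<^sup>2 + 2 * (cmod (mode_u k Y))\<^sup>2)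
    + \<mu> * (2 * (cmod (mode_q k X))\<^sup>2 + 2 * (cmod (mode_q k Y))\<^sup>2)
    + \<xi> k powr a * (2 * mode_h k X + 2 * mode_h k Y)"
    unfolding mode_E_def mode.mode_energy_def mode_add
    using B_nonneg[of k] pos eigenvalue_pos[of k]
    by (intro add_mono mult_left_mono norm_add_sq_le mode_h_add_le assms) (auto simp: less_imp_le)
  also have "\<dots> = 2 * mode_E k X + 2 * mode_E k Y"
    unfolding mode_E_def mode.mode_energy_def by (simp add: algebra_simps)
  finally show ?thesis .
qed

lemma mode_E_scale: "mode_E k (state_scale c X) = (cmod c)\<^sup>2 * mode_E k X"
  unfolding mode_E_def mode.mode_energy_def mode_scale mode_h_scale
  by (simp add: norm_mult power_mult_distrib algebra_simps)

lemma N_add_le: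
  assumes "X \<in> V" "Y \<in> V"
  shows "(N (state_add X Y))\<^sup>2 \<le> 2 * (N X)\<^sup>2 + 2 * (N Y)\<^sup>2"
  by (rule sums_le[OF _ norm_sums(1)[OF V_add[OF assms]]
        sums_add[OF sums_mult[OF norm_sums(1)[OF assms(1)]] sums_mult[OF norm_sums(1)[OF assms(2)]]]])
    (rule mode_E_add_le[OF assms])

lemma N_scale:
  assumes "X \<in> V"
  shows "(N (state_scale c X))\<^sup>2 = (cmod c)\<^sup>2 * (N X)\<^sup>2"
  using norm_sums(1)[OF V_scale[OF assms], of c] sums_mult[OF norm_sums(1)[OF assms], of "(cmod c)\<^sup>2"]
  unfolding mode_E_scale by (rule sums_unique2)

text \<open>Squares are sums over the modes, so estimates are obtained termwise. The factor
  \<open>2\<close> in the triangle inequality is harmless, since \<open>dist2\<close> serves only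
  for limits and for null distance.\<close>

definition dist2 :: "'h state \<Rightarrow> 'h state \<Rightarrow> real" where
  "dist2 X Y = (N (state_diff X Y))\<^sup>2"

lemma dist2_nonneg [simp]: "0 \<le> dist2 X Y"
  by (simp add: dist2_def)

lemma dist2_zero_iff: "dist2 X Y = 0 \<longleftrightarrow> N (state_diff X Y) = 0"
  by (simp add: dist2_def)

lemma dist2_triangle:
  assumes "X \<in> V" "Y \<in> V" "Z \<in> V"
  shows "dist2 X Z \<le> 2 * dist2 X Y + 2 * dist2 Y Z"
proof -
  have "state_diff X Z = state_add (state_diff X Y) (state_diff Y Z)"
    by (cases X; cases Y; cases Z) simp
  then show ?thesis
    unfolding dist2_def using N_add_le[OF V_diff[OF assms(1,2)] V_diff[OF assms(2,3)]] by simp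
qed

lemma dist2_commute:
  assumes "X \<in> V" "Y \<in> V"
  shows "dist2 X Y = dist2 Y X"
proof -
  have "state_diff X Y = state_scale (- 1) (state_diff Y X)"
    by (cases X; cases Y) (simp add: scaleC_minus_one)
  then show ?thesis unfolding dist2_def using N_scale[OF V_diff[OF assms(2,1)], of "- 1"] by simp
qed

lemma dist2_self: "X \<in> V \<Longrightarrow> dist2 X X = 0"
proof -
  assume X: "X \<in> V"
  have "state_diff X X = state_scale 0 X" by (cases X) simp
  then show ?thesis unfolding dist2_def using N_scale[OF X, of 0] by simp
qed

lemma dist2_scale:
  assumes "X \<in> V" "Y \<in> V"
  shows "dist2 (state_scale c X) (state_scale c Y) = (cmod c)\<^sup>2 * dist2 X Y"
proof -
  have "state_diff (state_scale c X) (state_scale c Y) = state_scale c (state_diff X Y)"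
    by (cases X; cases Y) (simp add: linear_diff[OF bounded_linear.linear[OF bounded_linear_scaleC_right]])
  then show ?thesis unfolding dist2_def using N_scale[OF V_diff[OF assms]] by simp
qed

lemma dist2_add:
  assumes "X \<in> V" "X' \<in> V" "Y \<in> V" "Y' \<in> V"
  shows "dist2 (state_add X X') (state_add Y Y') \<le> 2 * dist2 X Y + 2 * dist2 X' Y'"
proof -
  have "state_diff (state_add X X') (state_add Y Y') = state_add (state_diff X Y) (state_diff X' Y')"
    by (cases X; cases Y; cases X'; cases Y') (simp add: add_diff_add)
  then show ?thesis
    unfolding dist2_def using N_add_le[OF V_diff[OF assms(1,3)] V_diff[OF assms(2,4)]] by simp
qed

lemma dist2_diff:
  assumes "X \<in> V" "X' \<in> V" "Y \<in> V" "Y' \<in> V"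
  shows "dist2 (state_diff X X') (state_diff Y Y') \<le> 2 * dist2 X Y + 2 * dist2 X' Y'"
  unfolding state_diff_def[of X X'] state_diff_def[of Y Y']
  using dist2_add[OF assms(1) V_scale[OF assms(2), of "- 1"] assms(3) V_scale[OF assms(4), of "- 1"]]
  by (simp add: dist2_scale[OF assms(2,4)])

lemma N_le_dist2:
  assumes "X \<in> V" "Y \<in> V"
  shows "(N X)\<^sup>2 \<le> 2 * (N Y)\<^sup>2 + 2 * dist2 X Y"
proof -
  have "X = state_add Y (state_diff X Y)" by (cases X; cases Y) simp
  then show ?thesis using N_add_le[OF assms(2) V_diff[OF assms]] by (simp add: dist2_def)
qed

text \<open>Membership in \<open>V\<close> is asked only eventually, to cover difference quotients
  along \<open>at_right 0\<close>, which lie in \<open>V\<close> for positive increments.\<close>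

definition tends :: "('i \<Rightarrow> 'h state) \<Rightarrow> 'h state \<Rightarrow> 'i filter \<Rightarrow> bool" where
  "tends Z X F \<longleftrightarrow> X \<in> V \<and> (\<forall>\<^sub>F i in F. Z i \<in> V) \<and> ((\<lambda>i. dist2 (Z i) X) \<longlongrightarrow> 0) F"

text \<open>The bound by \<open>N\<close> makes the value insensitive to a change of null distance,
  as \<open>functional_cong\<close> shows. Numbers obtained this way can be compared by true
  equations although states cannot.\<close>

definition bounded_functional :: "('h state \<Rightarrow> complex) \<Rightarrow> bool" where
  "bounded_functional f \<longleftrightarrow> (\<forall>X\<in>V. \<forall>Y\<in>V. f (state_add X Y) = f X + f Y) \<and>
     (\<forall>c. \<forall>X\<in>V. f (state_scale c X) = c * f X) \<and> (\<exists>C. \<forall>X\<in>V. (cmod (f X))\<^sup>2 \<le> C * (N X)\<^sup>2)"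

section \<open>Continuity of functionals and of the mode energies\<close>

lemma functional_diff:
  assumes "bounded_functional f" "X \<in> V" "Y \<in> V"
  shows "f (state_diff X Y) = f X - f Y"
  using assms V_scale[OF assms(3), of "- 1"] unfolding bounded_functional_def state_diff_def by simp

lemma functional_tendsto:
  assumes f: "bounded_functional f" and Z: "tends Z X F"
  shows "((\<lambda>i. f (Z i)) \<longlongrightarrow> f X) F"
proof -
  obtain C where C: "\<And>X. X \<in> V \<Longrightarrow> (cmod (f X))\<^sup>2 \<le> C * (N X)\<^sup>2"
    using f unfolding bounded_functional_def by blast
  have X: "X \<in> V" and ev: "\<forall>\<^sub>F i in F. Z i \<in> V" and lim: "((\<lambda>i. dist2 (Z i) X) \<longlongrightarrow> 0) F"
    using Z by (auto simp: tends_def)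
  have "((\<lambda>i. (cmod (f (Z i) - f X))\<^sup>2) \<longlongrightarrow> 0) F"
  proof (rule tendsto_sandwich)
    show "\<forall>\<^sub>F i in F. 0 \<le> (cmod (f (Z i) - f X))\<^sup>2" by simp
    show "\<forall>\<^sub>F i in F. (cmod (f (Z i) - f X))\<^sup>2 \<le> C * dist2 (Z i) X"
      using ev
    proof eventually_elim
      case (elim i)
      from C[OF V_diff[OF elim X]] show ?case by (simp add: functional_diff[OF f elim X] dist2_def)
    qed
    show "((\<lambda>i. C * dist2 (Z i) X) \<longlongrightarrow> 0) F" using tendsto_mult_right_zero[OF lim] .
  qed auto
  then have "((\<lambda>i. sqrt ((cmod (f (Z i) - f X))\<^sup>2)) \<longlongrightarrow> sqrt 0) F" by (rule tendsto_real_sqrt)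
  then have "((\<lambda>i. f (Z i) - f X) \<longlongrightarrow> 0) F" by (simp add: tendsto_norm_zero_iff)
  then show ?thesis by (rule LIM_zero_cancel)
qed

lemma mode_energy_components:
  assumes "X \<in> V"
  shows "(cmod (mode_v k X))\<^sup>2 \<le> 1 / (\<kappa> * \<xi> k) * (N X)\<^sup>2"
    and "(cmod (mode_w k X))\<^sup>2 \<le> 1 / (\<beta> * \<xi> k) * (N X)\<^sup>2"
    and "(cmod (mode_u k X))\<^sup>2 \<le> 1 / \<rho> * (N X)\<^sup>2"
    and "(cmod (mode_q k X))\<^sup>2 \<le> 1 / \<mu> * (N X)\<^sup>2"
    and "mode_h k X \<le> 1 / \<xi> k powr a * (N X)\<^sup>2"
proof -
  note x = eigenvalue_pos[of k]
  have nn: "0 \<le> B k * (cmod (mode_v k X))\<^sup>2" "0 \<le> \<beta> * \<xi> k * (cmod (mode_w k X))\<^sup>2" "0 \<le> \<rho> * (cmod (mode_u k X))\<^sup>2"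
    "0 \<le> \<mu> * (cmod (mode_q k X))\<^sup>2" "0 \<le> \<xi> k powr a * mode_h k X"
    using B_nonneg[of k] pos x by auto
  have "\<kappa> * \<xi> k * (cmod (mode_v k X))\<^sup>2 \<le> B k * (cmod (mode_v k X))\<^sup>2"
    using gap[of k] by (intro mult_right_mono) auto
  then have le: "\<kappa> * \<xi> k * (cmod (mode_v k X))\<^sup>2 \<le> (N X)\<^sup>2" "\<beta> * \<xi> k * (cmod (mode_w k X))\<^sup>2 \<le> (N X)\<^sup>2"
    "\<rho> * (cmod (mode_u k X))\<^sup>2 \<le> (N X)\<^sup>2" "\<mu> * (cmod (mode_q k X))\<^sup>2 \<le> (N X)\<^sup>2" "\<xi> k powr a * mode_h k X \<le> (N X)\<^sup>2"
    using nn mode_E_le[OF assms, of k] unfolding mode_E_def mode.mode_energy_def by linarith+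
  have dv: "y \<le> 1 / r * n" if "0 < r" "r * y \<le> n" for r y n :: real
    using that by (simp add: field_simps)
  show "(cmod (mode_v k X))\<^sup>2 \<le> 1 / (\<kappa> * \<xi> k) * (N X)\<^sup>2"
    "(cmod (mode_w k X))\<^sup>2 \<le> 1 / (\<beta> * \<xi> k) * (N X)\<^sup>2" "(cmod (mode_u k X))\<^sup>2 \<le> 1 / \<rho> * (N X)\<^sup>2"
    "(cmod (mode_q k X))\<^sup>2 \<le> 1 / \<mu> * (N X)\<^sup>2" "mode_h k X \<le> 1 / \<xi> k powr a * (N X)\<^sup>2"
    by (rule dv; use le pos x in simp)+
qed

lemma bounded_functional_modes:
  "bounded_functional (mode_v k)" "bounded_functional (mode_w k)" "bounded_functional (mode_u k)"
  "bounded_functional (mode_q k)"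
  unfolding bounded_functional_def mode_add mode_scale using mode_energy_components by blast+

text \<open>Needed in two instances: \<open>f = 1\<close> gives \<open>mode_m\<close>, and for
  \<open>f\<close> the memory mode of a fixed state it is the linear part of \<open>mode_h\<close>
  around that state.\<close>

lemma bounded_functional_memory:
  assumes W: "square_integrable G f"
  shows "bounded_functional (\<lambda>X. \<integral>s. mode_memory k X s * cnj (f s) \<partial>G)"
  unfolding bounded_functional_def
proof (intro conjI ballI allI exI)
  fix X assume X: "X \<in> V"
  note i = square_integrable_mult_cnj[OF mode_memory_square_integrable W]
  show "(\<integral>s. mode_memory k (state_add X Y) s * cnj (f s) \<partial>G) =
    (\<integral>s. mode_memory k X s * cnj (f s) \<partial>G) + (\<integral>s. mode_memory k Y s * cnj (f s) \<partial>G)" if "Y \<in> V" for Y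
    unfolding mode_add distrib_right by (rule Bochner_Integration.integral_add[OF i[OF X] i[OF that]])
  show "(\<integral>s. mode_memory k (state_scale c X) s * cnj (f s) \<partial>G) = c * (\<integral>s. mode_memory k X s * cnj (f s) \<partial>G)" for c
    unfolding mode_scale mult.assoc by (rule integral_mult_right_zero)
  have "(cmod (\<integral>s. mode_memory k X s * cnj (f s) \<partial>G))\<^sup>2 \<le> (sqrt (mode_h k X) * sqrt (sq_norm G f))\<^sup>2"
    unfolding mode_h_def by (intro power_mono cmod_integral_mult_cnj_le mode_memory_square_integrable X W) simp
  also have "\<dots> = mode_h k X * sq_norm G f" by (simp add: power_mult_distrib)
  also have "\<dots> \<le> (1 / \<xi> k powr a * (N X)\<^sup>2) * sq_norm G f"
    by (intro mult_right_mono mode_energy_components X) simp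
  finally show "(cmod (\<integral>s. mode_memory k X s * cnj (f s) \<partial>G))\<^sup>2 \<le> (1 / \<xi> k powr a * sq_norm G f) * (N X)\<^sup>2"
    by (simp add: mult_ac)
qed

lemma bounded_functional_m: "bounded_functional (mode_m k)"
  using bounded_functional_memory[OF square_integrable_const[OF finite_G, of 1], of k]
  by (simp add: mode_m_def[abs_def])

text \<open>The exact expansion of the quadratic \<open>mode_h\<close> around \<open>X\<close>. It
  reduces limits and time derivatives of \<open>mode_h\<close> to those of a bounded functional plus
  a remainder of second order.\<close>

lemma mode_h_expand:
  fixes k :: nat
  assumes "X \<in> V" "Z \<in> V"
  defines "f \<equiv> \<lambda>X'. \<integral>s. mode_memory k X' s * cnj (mode_memory k X s) \<partial>G"
  shows "mode_h k Z = mode_h k X + 2 * Re (f Z - f X) + mode_h k (state_diff Z X)"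
proof -
  have f: "bounded_functional f"
    unfolding f_def by (rule bounded_functional_memory[OF mode_memory_square_integrable[OF assms(1)]])
  have "Z = state_add (state_diff Z X) X" by (cases X; cases Z) simp
  then have "mode_h k Z = mode_h k (state_add (state_diff Z X) X)" by simp
  also have "\<dots> = mode_h k (state_diff Z X) + mode_h k X + 2 * Re (f (state_diff Z X))"
    unfolding f_def by (rule mode_h_add[OF V_diff[OF assms(2,1)] assms(1)])
  also have "f (state_diff Z X) = f Z - f X" by (rule functional_diff[OF f assms(2,1)])
  finally show ?thesis by simp
qed

lemma mode_h_tendsto:
  assumes Z: "tends Z X F"
  shows "((\<lambda>i. mode_h k (Z i)) \<longlongrightarrow> mode_h k X) F"
proof -
  have X: "X \<in> V" and ev: "\<forall>\<^sub>F i in F. Z i \<in> V" and lim: "((\<lambda>i. dist2 (Z i) X) \<longlongrightarrow> 0) F"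
    using Z by (auto simp: tends_def)
  define f where "f = (\<lambda>X'. \<integral>s. mode_memory k X' s * cnj (mode_memory k X s) \<partial>G)"
  have f: "bounded_functional f"
    unfolding f_def by (rule bounded_functional_memory[OF mode_memory_square_integrable[OF X]])
  have "((\<lambda>i. mode_h k (state_diff (Z i) X)) \<longlongrightarrow> 0) F"
  proof (rule tendsto_sandwich)
    show "\<forall>\<^sub>F i in F. 0 \<le> mode_h k (state_diff (Z i) X)" by simp
    show "\<forall>\<^sub>F i in F. mode_h k (state_diff (Z i) X) \<le> 1 / \<xi> k powr a * dist2 (Z i) X"
      using ev by eventually_elim (unfold dist2_def, rule mode_energy_components(5)[OF V_diff[OF _ X]])
    show "((\<lambda>i. 1 / \<xi> k powr a * dist2 (Z i) X) \<longlongrightarrow> 0) F" using tendsto_mult_right_zero[OF lim] .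
  qed auto
  then have "((\<lambda>i. mode_h k X + 2 * Re (f (Z i) - f X) + mode_h k (state_diff (Z i) X)) \<longlongrightarrow> mode_h k X + 2 * Re (f X - f X) + 0) F"
    by (intro tendsto_intros functional_tendsto[OF f Z])
  then have "((\<lambda>i. mode_h k X + 2 * Re (f (Z i) - f X) + mode_h k (state_diff (Z i) X)) \<longlongrightarrow> mode_h k X) F" by simp
  then show ?thesis
  proof (rule Lim_transform_eventually)
    show "\<forall>\<^sub>F i in F. mode_h k X + 2 * Re (f (Z i) - f X) + mode_h k (state_diff (Z i) X) = mode_h k (Z i)"
      using ev by eventually_elim (unfold f_def, rule mode_h_expand[OF X, symmetric])
  qed
qed

lemma mode_E_tendsto:
  assumes Z: "tends Z X F"
  shows "((\<lambda>i. mode_E k (Z i)) \<longlongrightarrow> mode_E k X) F"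
  unfolding mode_E_def mode.mode_energy_def
  by (intro tendsto_intros functional_tendsto[OF _ Z] mode_h_tendsto[OF Z] bounded_functional_modes)

lemma tends_const: "X \<in> V \<Longrightarrow> Y \<in> V \<Longrightarrow> dist2 X Y = 0 \<Longrightarrow> tends (\<lambda>_. X) Y F"
  by (simp add: tends_def)

lemma functional_cong:
  assumes "bounded_functional f" "X \<in> V" "Y \<in> V" "dist2 X Y = 0"
  shows "f X = f Y"
  using functional_tendsto[OF assms(1) tends_const[OF assms(2-4)], of sequentially]
  by (rule LIMSEQ_unique[OF tendsto_const])

lemma mode_E_cong:
  assumes "X \<in> V" "Y \<in> V" "dist2 X Y = 0"
  shows "mode_E k X = mode_E k Y"
  using mode_E_tendsto[OF tends_const[OF assms], of k sequentially]
  by (rule LIMSEQ_unique[OF tendsto_const])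

lemma N_cong:
  assumes "X \<in> V" "Y \<in> V" "dist2 X Y = 0"
  shows "N X = N Y"
proof -
  have "(N X)\<^sup>2 = (N Y)\<^sup>2"
    using norm_sums(1)[OF assms(1)] norm_sums(1)[OF assms(2)] mode_E_cong[OF assms] by (simp add: sums_unique2)
  then show ?thesis using norm_sums(2)[OF assms(1)] norm_sums(2)[OF assms(2)] by (simp add: power2_eq_iff_nonneg)
qed

end

section \<open>The mode equations on the graph of the operator\<close>

lemma weak_deriv_bounded_linear:
  fixes f f' :: "real \<Rightarrow> 'b::{banach, second_countable_topology}"
    and L :: "'b \<Rightarrow> 'c::{banach, second_countable_topology}"
  assumes L: "bounded_linear L" and f: "weak_deriv_on_pos f f'"
  shows "weak_deriv_on_pos (\<lambda>s. L (f s)) (\<lambda>s. L (f' s))"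
  unfolding weak_deriv_on_pos_def
proof (intro allI impI)
  fix s t :: real
  assume st: "0 < s \<and> s \<le> t"
  have i: "set_integrable lebesgue {s..t} f'" and d: "f t - f s = (LINT r:{s..t}|lebesgue. f' r)"
    using f st unfolding weak_deriv_on_pos_def by auto
  have c: "indicator {s..t} r *\<^sub>R L (f' r) = L (indicator {s..t} r *\<^sub>R f' r)" for r :: real
    by (rule linear_scale[OF bounded_linear.linear[OF L], symmetric])
  have "L (f t) - L (f s) = L (f t - f s)" by (rule linear_diff[OF bounded_linear.linear[OF L], symmetric])
  also have "\<dots> = (LINT r:{s..t}|lebesgue. L (f' r))"
    using i unfolding d set_lebesgue_integral_def set_integrable_def c
    by (rule integral_bounded_linear[OF L, symmetric])
  finally have "L (f t) - L (f s) = (LINT r:{s..t}|lebesgue. L (f' r))" .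
  moreover have "set_integrable lebesgue {s..t} (\<lambda>r. L (f' r))"
    using i unfolding set_integrable_def c by (rule integrable_bounded_linear[OF L])
  ultimately show "set_integrable lebesgue {s..t} (\<lambda>r. L (f' r)) \<and>
      L (f t) - L (f s) = (LINT r:{s..t}|lebesgue. L (f' r))" by simp
qed

context memory_system
begin

abbreviation Dom :: "'h state set" where
  "Dom \<equiv> op_dom D \<xi> \<Psi> a g"

abbreviation Op :: "'h state \<Rightarrow> 'h state" where
  "Op \<equiv> op_A A \<xi> \<Psi> a \<rho> \<mu> \<alpha> \<beta> \<gamma> g"

lemma Dom_subset_V: "Z \<in> Dom \<Longrightarrow> Z \<in> V"
  by (auto simp: op_dom_def state_space_def operator_domain_subset)

lemma memory_deriv:
  assumes "(v, u, p, q, \<eta>) \<in> Dom"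
  shows "weak_deriv_on_pos \<eta> (memory_deriv \<xi> \<Psi> a g \<eta>)" "memory_deriv \<xi> \<Psi> a g \<eta> \<in> L2_memory \<xi> \<Psi> a g"
proof -
  have "\<exists>w. has_memory_deriv \<xi> \<Psi> a g \<eta> w" using assms by (auto simp: op_dom_def)
  then have "has_memory_deriv \<xi> \<Psi> a g \<eta> (memory_deriv \<xi> \<Psi> a g \<eta>)"
    unfolding memory_deriv_def by (rule someI_ex)
  then show "weak_deriv_on_pos \<eta> (memory_deriv \<xi> \<Psi> a g \<eta>)" "memory_deriv \<xi> \<Psi> a g \<eta> \<in> L2_memory \<xi> \<Psi> a g"
    by (auto simp: has_memory_deriv_def)
qed

lemma Op_in_V:
  assumes "Z \<in> Dom"
  shows "Op Z \<in> V"
proof -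
  obtain v u p q \<eta> where Z: "Z = (v, u, p, q, \<eta>)" by (cases Z)
  have u: "u \<in> frac_dom \<xi> \<Psi> (1/2)" "q \<in> frac_dom \<xi> \<Psi> (1/2)" using assms by (auto simp: Z op_dom_def)
  have "(\<lambda>s. u + (- 1) *\<^sub>C memory_deriv \<xi> \<Psi> a g \<eta> s) \<in> L2_memory \<xi> \<Psi> a g"
    using assms by (intro L2_memory_add L2_memory_const L2_memory_scale memory_deriv(2) frac_dom_half u) (simp add: Z)
  then have "(\<lambda>s. u - memory_deriv \<xi> \<Psi> a g \<eta> s) \<in> L2_memory \<xi> \<Psi> a g" by (simp add: scaleC_minus_one)
  then show ?thesis using u by (simp add: Z state_space_def)
qed

text \<open>For states in \<open>V\<close>, the left side of the last line is twice the real part of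
  the inner product of the two memory modes, that is, the derivative of \<open>mode_h\<close> at
  \<open>X\<close> in the direction \<open>Y\<close>. Written with \<open>mode_h\<close> alone, it
  passes to limits by \<open>mode_h_tendsto\<close>. The memory relations are inequalities because
  for limit pairs no weak derivative of the memory is at hand.\<close>

definition mode_relations :: "nat \<Rightarrow> 'h state \<Rightarrow> 'h state \<Rightarrow> bool" where
  "mode_relations k X Y \<longleftrightarrow>
     mode_v k Y = mode_u k X \<and>
     \<rho> *\<^sub>R mode_u k Y = - B k *\<^sub>R mode_v k X - (\<gamma> * \<beta> * \<xi> k) *\<^sub>R mode_w k X - (\<xi> k powr a) *\<^sub>R mode_m k X \<and>
     mode_w k Y = \<gamma> *\<^sub>R mode_u k X - mode_q k X \<and>
     \<mu> *\<^sub>R mode_q k Y = (\<beta> * \<xi> k) *\<^sub>R mode_w k X \<and>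
     (cmod (mode_m k Y - kernel_mass g *\<^sub>R mode_u k X))\<^sup>2 \<le> k0\<^sup>2 * kernel_mass g * mode_h k X \<and>
     mode_h k (state_add X Y) - mode_h k X - mode_h k Y \<le> 2 * inner (mode_m k X) (mode_u k X) - k1 * mode_h k X"

lemma cinner_memory_mean:
  assumes "\<eta> \<in> L2_memory \<xi> \<Psi> a g"
  shows "cinner (memory_mean g \<eta>) (\<Psi> k) = (\<integral>s. cinner (\<eta> s) (\<Psi> k) \<partial>G)"
proof -
  have \<eta>: "\<eta> \<in> borel_measurable pos_line" using assms by (simp add: L2_memory_iff)
  have "memory_mean g \<eta> = (\<integral>s. \<eta> s \<partial>G)"
    unfolding memory_mean_def set_lebesgue_integral_pos_line integral_memory_measure(2)[OF \<eta>] ..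
  then show ?thesis
    using integral_bounded_linear[OF bounded_linear_cinner_left L2_memory_integrable[OF assms]] by simp
qed

lemma mode_relations_Op:
  assumes "Z \<in> Dom"
  shows "mode_relations k Z (Op Z)"
proof -
  obtain v u p q \<eta> where Z: "Z = (v, u, p, q, \<eta>)" by (cases Z)
  note dom = assms[unfolded Z]
  have d: "v \<in> D" "p \<in> D" "\<eta> \<in> L2_memory \<xi> \<Psi> a g" "(\<eta> \<longlongrightarrow> 0) (at_right 0)" "memory_mean g \<eta> \<in> frac_dom \<xi> \<Psi> a"
    using dom by (auto simp: op_dom_def)
  define w where "w = memory_deriv \<xi> \<Psi> a g \<eta>"
  have w: "weak_deriv_on_pos \<eta> w" "w \<in> L2_memory \<xi> \<Psi> a g"
    using memory_deriv[OF dom] by (auto simp: w_def)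
  define \<eta>' where "\<eta>' s = cinner (\<eta> s) (\<Psi> k)" for s
  define w' where "w' s = cinner (w s) (\<Psi> k)" for s
  define u' where "u' = cinner u (\<Psi> k)"
  have L2: "square_integrable G \<eta>'" "square_integrable G w'"
    unfolding \<eta>'_def[abs_def] w'_def[abs_def] using L2_memory_square_integrable d w by auto
  have wd: "weak_deriv_on_pos \<eta>' w'"
    unfolding \<eta>'_def[abs_def] w'_def[abs_def] by (rule weak_deriv_bounded_linear[OF bounded_linear_cinner_left w(1)])
  have "((\<lambda>s. cinner (\<eta> s) (\<Psi> k)) \<longlongrightarrow> cinner 0 (\<Psi> k)) (at_right 0)"
    by (rule bounded_linear.tendsto[OF bounded_linear_cinner_left d(4)])
  then have lim: "(\<eta>' \<longlongrightarrow> 0) (at_right 0)" by (simp add: \<eta>'_def[abs_def])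
  note gen = memory_generator[OF L2 wd lim, of u']
  have mem: "mode_memory k Z = \<eta>'" "mode_memory k (Op Z) = (\<lambda>s. u' - w' s)"
    by (auto simp: mode_memory_def Z \<eta>'_def u'_def w'_def w_def cinner_diff_left)
  have m: "cinner (memory_mean g \<eta>) (\<Psi> k) = mode_m k Z"
    unfolding cinner_memory_mean[OF d(3)] mode_m_def mem \<eta>'_def ..
  have "\<rho> *\<^sub>R mode_u k (Op Z) = - \<alpha> *\<^sub>R cinner (A v) (\<Psi> k) + (\<gamma> * \<beta>) *\<^sub>R cinner (A p) (\<Psi> k)
      + kernel_mass g *\<^sub>R cinner (frac_pow \<xi> \<Psi> a v) (\<Psi> k) - cinner (frac_pow \<xi> \<Psi> a (memory_mean g \<eta>)) (\<Psi> k)"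
    using pos by (simp add: mode_u_def Z cinner_scaleR_left cinner_diff_left cinner_add_left cinner_minus_left scaleR_conv_of_real)
  also have "\<dots> = - \<alpha> *\<^sub>R (of_real (\<xi> k) * cinner v (\<Psi> k)) + (\<gamma> * \<beta>) *\<^sub>R (of_real (\<xi> k) * cinner p (\<Psi> k))
      + kernel_mass g *\<^sub>R (of_real (\<xi> k powr a) * cinner v (\<Psi> k)) - of_real (\<xi> k powr a) * mode_m k Z"
    using a d by (simp add: cinner_operator cinner_frac_pow operator_domain_subset m)
  \<comment> \<open>Replacing \<open>p\<close> by \<open>\<gamma> v - w\<close> moves
    \<open>\<gamma>\<^sup>2 * \<beta> * \<xi> k\<close> out of the coefficient of \<open>v\<close>,
    which then is \<open>- B k\<close>.\<close>
  also have "\<dots> = - B k *\<^sub>R mode_v k Z - (\<gamma> * \<beta> * \<xi> k) *\<^sub>R mode_w k Z - (\<xi> k powr a) *\<^sub>R mode_m k Z"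
    by (simp add: mode_v_def mode_w_def Z scaleR_conv_of_real algebra_simps power2_eq_square)
  finally have r2: "\<rho> *\<^sub>R mode_u k (Op Z) = - B k *\<^sub>R mode_v k Z - (\<gamma> * \<beta> * \<xi> k) *\<^sub>R mode_w k Z - (\<xi> k powr a) *\<^sub>R mode_m k Z" .
  have "\<mu> *\<^sub>R mode_q k (Op Z) = - \<beta> *\<^sub>R cinner (A p) (\<Psi> k) + (\<gamma> * \<beta>) *\<^sub>R cinner (A v) (\<Psi> k)"
    using pos by (simp add: mode_q_def Z cinner_scaleR_left cinner_diff_left cinner_add_left cinner_minus_left scaleR_conv_of_real)
  also have "\<dots> = (\<beta> * \<xi> k) *\<^sub>R mode_w k Z"
    using d by (simp add: cinner_operator mode_w_def Z scaleR_conv_of_real algebra_simps)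
  finally have r4: "\<mu> *\<^sub>R mode_q k (Op Z) = (\<beta> * \<xi> k) *\<^sub>R mode_w k Z" .
  have h: "mode_h k Z = sq_norm G \<eta>'" by (simp add: mode_h_def mem)
  have r5: "(cmod (mode_m k (Op Z) - kernel_mass g *\<^sub>R mode_u k Z))\<^sup>2 \<le> k0\<^sup>2 * kernel_mass g * mode_h k Z"
    using gen(1) unfolding h mode_m_def mem by (simp add: mode_u_def Z u'_def scaleR_conv_of_real)
  have "mode_h k (state_add Z (Op Z)) - mode_h k Z - mode_h k (Op Z) = 2 * Re (\<integral>s. \<eta>' s * cnj (u' - w' s) \<partial>G)"
    using mode_h_add[OF Dom_subset_V[OF assms] Op_in_V[OF assms], of k] unfolding mem by simp
  also have "\<dots> \<le> 2 * Re ((\<integral>s. \<eta>' s \<partial>G) * cnj u') - k1 * sq_norm G \<eta>'" by (rule gen(2))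
  also have "\<dots> = 2 * inner (mode_m k Z) (mode_u k Z) - k1 * mode_h k Z"
    unfolding h mode_m_def mem by (simp add: mode_u_def Z u'_def inner_complex_def)
  finally have r6: "mode_h k (state_add Z (Op Z)) - mode_h k Z - mode_h k (Op Z) \<le>
      2 * inner (mode_m k Z) (mode_u k Z) - k1 * mode_h k Z" .
  show ?thesis
    unfolding mode_relations_def using r2 r4 r5 r6 by (simp add: mode_v_def mode_u_def mode_w_def mode_q_def Z)
qed

lemma tends_add:
  assumes "tends X X' F" "tends Y Y' F"
  shows "tends (\<lambda>i. state_add (X i) (Y i)) (state_add X' Y') F"
  unfolding tends_def
proof (intro conjI)
  have X: "X' \<in> V" "Y' \<in> V" "\<forall>\<^sub>F i in F. X i \<in> V \<and> Y i \<in> V" and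
    lim: "((\<lambda>i. dist2 (X i) X') \<longlongrightarrow> 0) F" "((\<lambda>i. dist2 (Y i) Y') \<longlongrightarrow> 0) F"
    using assms by (auto simp: tends_def eventually_conj_iff)
  show "state_add X' Y' \<in> V" using X by (simp add: V_add)
  show "\<forall>\<^sub>F i in F. state_add (X i) (Y i) \<in> V" using X(3) by eventually_elim (simp add: V_add)
  show "((\<lambda>i. dist2 (state_add (X i) (Y i)) (state_add X' Y')) \<longlongrightarrow> 0) F"
  proof (rule tendsto_sandwich)
    show "\<forall>\<^sub>F i in F. 0 \<le> dist2 (state_add (X i) (Y i)) (state_add X' Y')" by simp
    show "\<forall>\<^sub>F i in F. dist2 (state_add (X i) (Y i)) (state_add X' Y') \<le> 2 * dist2 (X i) X' + 2 * dist2 (Y i) Y'"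
      using X(3) by eventually_elim (auto intro!: dist2_add X(1,2))
    show "((\<lambda>i. 2 * dist2 (X i) X' + 2 * dist2 (Y i) Y') \<longlongrightarrow> 0) F"
      using tendsto_add[OF tendsto_mult_right_zero[OF lim(1), of 2] tendsto_mult_right_zero[OF lim(2), of 2]] by simp
  qed auto
qed

lemma mode_relations_closure:
  assumes "(X, Y) \<in> closure_graph V N Dom Op"
  shows "mode_relations k X Y"
proof -
  have X: "X \<in> V" "Y \<in> V" and ap: "\<And>e. 0 < e \<Longrightarrow> \<exists>Z\<in>Dom. N (state_diff Z X) < e \<and> N (state_diff (Op Z) Y) < e"
    using assms by (auto simp: closure_graph_def)
  have "\<forall>n. \<exists>Z\<in>Dom. N (state_diff Z X) < 1 / real (Suc n) \<and> N (state_diff (Op Z) Y) < 1 / real (Suc n)"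
    using ap by simp
  then obtain Z where Z: "\<And>n. Z n \<in> Dom" and ZX: "\<And>n. N (state_diff (Z n) X) < 1 / real (Suc n)"
    and ZY: "\<And>n. N (state_diff (Op (Z n)) Y) < 1 / real (Suc n)"
    by metis
  have tn: "tends W U sequentially"
    if U: "U \<in> V" and W: "\<And>n. W n \<in> V" and le: "\<And>n. N (state_diff (W n) U) < 1 / real (Suc n)" for W U
    unfolding tends_def
  proof (intro conjI)
    show "(\<lambda>n. dist2 (W n) U) \<longlonglongrightarrow> 0"
    proof (rule tendsto_sandwich)
      show "\<forall>\<^sub>F n in sequentially. 0 \<le> dist2 (W n) U" by simp
      show "\<forall>\<^sub>F n in sequentially. dist2 (W n) U \<le> (1 / real (Suc n))\<^sup>2"
      proof (intro always_eventually allI)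
        fix n
        show "dist2 (W n) U \<le> (1 / real (Suc n))\<^sup>2"
          unfolding dist2_def by (intro power_mono less_imp_le le norm_sums(2) V_diff W U)
      qed
      show "(\<lambda>n. (1 / real (Suc n))\<^sup>2) \<longlonglongrightarrow> 0"
        using tendsto_power[OF LIMSEQ_inverse_real_of_nat, of 2] by (simp add: inverse_eq_divide del: of_nat_Suc)
    qed auto
  qed (use U W in auto)
  have tX: "tends Z X sequentially" by (rule tn[OF X(1) Dom_subset_V[OF Z] ZX])
  have tY: "tends (\<lambda>n. Op (Z n)) Y sequentially" by (rule tn[OF X(2) Op_in_V[OF Z] ZY])
  note f = functional_tendsto[OF _ tX] functional_tendsto[OF _ tY] bounded_functional_modes bounded_functional_m
    mode_h_tendsto[OF tX] mode_h_tendsto[OF tY] mode_h_tendsto[OF tends_add[OF tX tY]]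
  have rel: "mode_v k (Op (Z n)) = mode_u k (Z n)"
     "\<rho> *\<^sub>R mode_u k (Op (Z n)) = - B k *\<^sub>R mode_v k (Z n) - (\<gamma> * \<beta> * \<xi> k) *\<^sub>R mode_w k (Z n) - (\<xi> k powr a) *\<^sub>R mode_m k (Z n)"
     "mode_w k (Op (Z n)) = \<gamma> *\<^sub>R mode_u k (Z n) - mode_q k (Z n)"
     "\<mu> *\<^sub>R mode_q k (Op (Z n)) = (\<beta> * \<xi> k) *\<^sub>R mode_w k (Z n)"
     "(cmod (mode_m k (Op (Z n)) - kernel_mass g *\<^sub>R mode_u k (Z n)))\<^sup>2 \<le> k0\<^sup>2 * kernel_mass g * mode_h k (Z n)"
     "mode_h k (state_add (Z n) (Op (Z n))) - mode_h k (Z n) - mode_h k (Op (Z n)) \<le>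
       2 * inner (mode_m k (Z n)) (mode_u k (Z n)) - k1 * mode_h k (Z n)" for n
    using mode_relations_Op[OF Z, of k n] unfolding mode_relations_def by blast+
  show ?thesis
    unfolding mode_relations_def
  proof (intro conjI)
    have "(\<lambda>n. mode_v k (Op (Z n))) \<longlonglongrightarrow> mode_u k X" unfolding rel by (intro f)
    then show "mode_v k Y = mode_u k X" by (rule LIMSEQ_unique[rotated]) (intro f)
    have "(\<lambda>n. \<rho> *\<^sub>R mode_u k (Op (Z n))) \<longlonglongrightarrow>
        - B k *\<^sub>R mode_v k X - (\<gamma> * \<beta> * \<xi> k) *\<^sub>R mode_w k X - (\<xi> k powr a) *\<^sub>R mode_m k X"
      unfolding rel by (intro tendsto_intros f)
    then show "\<rho> *\<^sub>R mode_u k Y = - B k *\<^sub>R mode_v k X - (\<gamma> * \<beta> * \<xi> k) *\<^sub>R mode_w k X - (\<xi> k powr a) *\<^sub>R mode_m k X"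
      by (rule LIMSEQ_unique[rotated]) (intro tendsto_intros f)
    have "(\<lambda>n. mode_w k (Op (Z n))) \<longlonglongrightarrow> \<gamma> *\<^sub>R mode_u k X - mode_q k X" unfolding rel by (intro tendsto_intros f)
    then show "mode_w k Y = \<gamma> *\<^sub>R mode_u k X - mode_q k X" by (rule LIMSEQ_unique[rotated]) (intro f)
    have "(\<lambda>n. \<mu> *\<^sub>R mode_q k (Op (Z n))) \<longlonglongrightarrow> (\<beta> * \<xi> k) *\<^sub>R mode_w k X" unfolding rel by (intro tendsto_intros f)
    then show "\<mu> *\<^sub>R mode_q k Y = (\<beta> * \<xi> k) *\<^sub>R mode_w k X" by (rule LIMSEQ_unique[rotated]) (intro tendsto_intros f)
    show "(cmod (mode_m k Y - kernel_mass g *\<^sub>R mode_u k X))\<^sup>2 \<le> k0\<^sup>2 * kernel_mass g * mode_h k X"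
    proof (rule LIMSEQ_le)
      show "(\<lambda>n. (cmod (mode_m k (Op (Z n)) - kernel_mass g *\<^sub>R mode_u k (Z n)))\<^sup>2) \<longlonglongrightarrow>
          (cmod (mode_m k Y - kernel_mass g *\<^sub>R mode_u k X))\<^sup>2" by (intro tendsto_intros f)
      show "(\<lambda>n. k0\<^sup>2 * kernel_mass g * mode_h k (Z n)) \<longlonglongrightarrow> k0\<^sup>2 * kernel_mass g * mode_h k X"
        by (intro tendsto_intros f)
    qed (use rel in auto)
    show "mode_h k (state_add X Y) - mode_h k X - mode_h k Y \<le> 2 * inner (mode_m k X) (mode_u k X) - k1 * mode_h k X"
    proof (rule LIMSEQ_le)
      show "(\<lambda>n. mode_h k (state_add (Z n) (Op (Z n))) - mode_h k (Z n) - mode_h k (Op (Z n))) \<longlonglongrightarrow>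
         mode_h k (state_add X Y) - mode_h k X - mode_h k Y" by (intro tendsto_intros f)
      show "(\<lambda>n. 2 * inner (mode_m k (Z n)) (mode_u k (Z n)) - k1 * mode_h k (Z n)) \<longlonglongrightarrow>
         2 * inner (mode_m k X) (mode_u k X) - k1 * mode_h k X" by (intro tendsto_intros f)
    qed (use rel in auto)
  qed
qed

lemma Op_in_closure: "X \<in> Dom \<Longrightarrow> (X, Op X) \<in> closure_graph V N Dom Op"
proof -
  assume X: "X \<in> Dom"
  have "N (state_diff X X) = 0" "N (state_diff (Op X) (Op X)) = 0"
    using dist2_self[OF Dom_subset_V[OF X]] dist2_self[OF Op_in_V[OF X]] dist2_zero_iff by blast+
  then show ?thesis
    unfolding closure_graph_def using X Dom_subset_V[OF X] Op_in_V[OF X] by (auto intro!: bexI[of _ X])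
qed

end

section \<open>The semigroup\<close>

locale memory_semigroup = memory_system \<Psi> D A \<xi> g g' k0 k1 a \<rho> \<mu> \<alpha> \<beta> \<gamma> \<kappa>
  for \<Psi> :: "nat \<Rightarrow> 'h::{complex_hilbert, second_countable_topology}"
    and D :: "'h set" and A :: "'h \<Rightarrow> 'h" and \<xi> :: "nat \<Rightarrow> real" and g g' :: "real \<Rightarrow> real" and k0 k1 :: real
    and a \<rho> \<mu> \<alpha> \<beta> \<gamma> \<kappa> :: real +
  fixes T :: "real \<Rightarrow> 'h state \<Rightarrow> 'h state"
  assumes contraction: "contraction_C0_semigroup V N T"
    and gen: "generates V N Dom Op T"
begin

lemma T_V: "0 \<le> t \<Longrightarrow> X \<in> V \<Longrightarrow> T t X \<in> V"
  and T_contract: "0 \<le> t \<Longrightarrow> X \<in> V \<Longrightarrow> N (T t X) \<le> N X"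
  and T_add: "0 \<le> t \<Longrightarrow> X \<in> V \<Longrightarrow> Y \<in> V \<Longrightarrow> dist2 (T t (state_add X Y)) (state_add (T t X) (T t Y)) = 0"
  and T_scale: "0 \<le> t \<Longrightarrow> X \<in> V \<Longrightarrow> dist2 (T t (state_scale c X)) (state_scale c (T t X)) = 0"
  and T_zero: "X \<in> V \<Longrightarrow> dist2 (T 0 X) X = 0"
  and T_plus: "0 \<le> s \<Longrightarrow> 0 \<le> t \<Longrightarrow> X \<in> V \<Longrightarrow> dist2 (T (s + t) X) (T s (T t X)) = 0"
  and T_cont: "X \<in> V \<Longrightarrow> ((\<lambda>t. N (state_diff (T t X) X)) \<longlongrightarrow> 0) (at_right 0)"
  using contraction unfolding contraction_C0_semigroup_def dist2_zero_iff by blast+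

text \<open>The semigroup laws hold only up to null distance, so this replaces transitivity of
  equality in the computations with \<open>T\<close>.\<close>

lemma dist2_zero_trans:
  assumes "dist2 X Y = 0" "dist2 Y Z = 0" "X \<in> V" "Y \<in> V" "Z \<in> V"
  shows "dist2 X Z = 0"
  using dist2_triangle[OF assms(3-5)] assms(1,2) dist2_nonneg[of X Z] by linarith

lemma T_diff:
  assumes "0 \<le> t" "X \<in> V" "Y \<in> V"
  shows "dist2 (T t (state_diff X Y)) (state_diff (T t X) (T t Y)) = 0"
  unfolding state_diff_def
proof (rule dist2_zero_trans)
  show "dist2 (T t (state_add X (state_scale (- 1) Y))) (state_add (T t X) (T t (state_scale (- 1) Y))) = 0"
    by (intro T_add V_scale assms)
  have "dist2 (state_add (T t X) (T t (state_scale (- 1) Y))) (state_add (T t X) (state_scale (- 1) (T t Y)))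
      \<le> 2 * dist2 (T t X) (T t X) + 2 * dist2 (T t (state_scale (- 1) Y)) (state_scale (- 1) (T t Y))"
    by (intro dist2_add T_V V_scale assms)
  then show "dist2 (state_add (T t X) (T t (state_scale (- 1) Y))) (state_add (T t X) (state_scale (- 1) (T t Y))) = 0"
    using dist2_self[OF T_V[OF assms(1,2)]] T_scale[OF assms(1,3), of "- 1"] by (simp add: order_antisym)
qed (intro T_V V_add V_scale assms)+

lemma T_dist2:
  assumes "0 \<le> t" "X \<in> V" "Y \<in> V"
  shows "dist2 (T t X) (T t Y) \<le> dist2 X Y"
proof -
  have "N (state_diff (T t X) (T t Y)) = N (T t (state_diff X Y))"
    by (rule N_cong[symmetric]) (intro T_diff T_V V_diff assms)+
  also have "\<dots> \<le> N (state_diff X Y)" by (intro T_contract V_diff assms)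
  finally show ?thesis
    unfolding dist2_def by (intro power_mono norm_sums(2) V_diff T_V assms)
qed

lemma T_tends: "X \<in> V \<Longrightarrow> tends (\<lambda>\<delta>. T \<delta> X) X (at_right 0)"
  unfolding tends_def dist2_def
  using tendsto_power[OF T_cont, of X 2] eventually_at_right_less[of "0::real"]
  by (auto elim!: eventually_mono intro!: T_V)

section \<open>Difference quotients and invariance of the generator\<close>

definition quot :: "'h state \<Rightarrow> real \<Rightarrow> 'h state" where
  "quot X \<delta> = state_scale (complex_of_real (1 / \<delta>)) (state_diff (T \<delta> X) X)"

abbreviation generator :: "('h state \<times> 'h state) set" where
  "generator \<equiv> generator_graph V N T"

lemma quot_V: "0 < \<delta> \<Longrightarrow> X \<in> V \<Longrightarrow> quot X \<delta> \<in> V"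
  unfolding quot_def by (intro V_scale V_diff T_V) auto

lemma generator_iff: "(X, Y) \<in> generator \<longleftrightarrow> X \<in> V \<and> tends (quot X) Y (at_right 0)"
proof -
  have ev: "\<forall>\<^sub>F \<delta> in at_right 0. quot X \<delta> \<in> V" if "X \<in> V"
    using eventually_at_right_less[of "0::real"] by eventually_elim (rule quot_V[OF _ that])
  have "((\<lambda>\<delta>. N (state_diff (quot X \<delta>) Y)) \<longlongrightarrow> 0) (at_right 0) \<longleftrightarrow> ((\<lambda>\<delta>. dist2 (quot X \<delta>) Y) \<longlongrightarrow> 0) (at_right 0)"
    if X: "X \<in> V" "Y \<in> V"
  proof
    assume "((\<lambda>\<delta>. N (state_diff (quot X \<delta>) Y)) \<longlongrightarrow> 0) (at_right 0)"
    from tendsto_power[OF this, of 2] show "((\<lambda>\<delta>. dist2 (quot X \<delta>) Y) \<longlongrightarrow> 0) (at_right 0)"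
      by (simp add: dist2_def)
  next
    assume "((\<lambda>\<delta>. dist2 (quot X \<delta>) Y) \<longlongrightarrow> 0) (at_right 0)"
    from tendsto_real_sqrt[OF this]
    have "((\<lambda>\<delta>. sqrt (dist2 (quot X \<delta>) Y)) \<longlongrightarrow> 0) (at_right 0)" by simp
    moreover have "\<forall>\<^sub>F \<delta> in at_right 0. sqrt (dist2 (quot X \<delta>) Y) = N (state_diff (quot X \<delta>) Y)"
      using ev[OF X(1)] by eventually_elim (simp add: dist2_def norm_sums(2) V_diff X)
    ultimately show "((\<lambda>\<delta>. N (state_diff (quot X \<delta>) Y)) \<longlongrightarrow> 0) (at_right 0)"
      by (rule Lim_transform_eventually)
  qed
  then show ?thesis
    unfolding generator_graph_def tends_def quot_def[symmetric] using ev by auto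
qed

lemma generator_V: "(X, Y) \<in> generator \<Longrightarrow> X \<in> V" "(X, Y) \<in> generator \<Longrightarrow> Y \<in> V"
  by (auto simp: generator_graph_def)

lemma generator_relations: "(X, Y) \<in> generator \<Longrightarrow> mode_relations k X Y"
  using gen by (auto simp: generates_def intro: mode_relations_closure)

lemma tends_dominated:
  assumes "tends Z X F" "Y \<in> V" "\<forall>\<^sub>F i in F. W i \<in> V"
    and "\<forall>\<^sub>F i in F. dist2 (W i) Y \<le> C * dist2 (Z i) X"
  shows "tends W Y F"
  unfolding tends_def
proof (intro conjI assms)
  have "((\<lambda>i. C * dist2 (Z i) X) \<longlongrightarrow> 0) F"
    using assms(1) unfolding tends_def by (intro tendsto_mult_right_zero) auto
  then show "((\<lambda>i. dist2 (W i) Y) \<longlongrightarrow> 0) F"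
    by (rule tendsto_sandwich[OF _ assms(4) tendsto_const, rotated]) simp
qed

lemma T_increment:
  assumes "0 \<le> t" "0 \<le> \<delta>" "X \<in> V"
  shows "dist2 (T \<delta> (T t X)) (T t (T \<delta> X)) = 0"
proof (rule dist2_zero_trans)
  show "dist2 (T \<delta> (T t X)) (T (\<delta> + t) X) = 0"
    using T_plus[OF assms(2,1,3)] dist2_commute T_V assms by (simp add: add_nonneg_nonneg)
  show "dist2 (T (\<delta> + t) X) (T t (T \<delta> X)) = 0"
    using T_plus[OF assms(1,2,3)] by (simp add: add.commute)
qed (use assms in \<open>auto intro!: T_V\<close>)

lemma quot_T:
  assumes "0 \<le> t" "0 < \<delta>" "X \<in> V"
  shows "dist2 (quot (T t X) \<delta>) (T t (quot X \<delta>)) = 0"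
proof -
  define c where "c = complex_of_real (1 / \<delta>)"
  have d: "0 \<le> \<delta>" using assms by simp
  note V = T_V[OF assms(1)] T_V[OF d] assms(3) V_diff V_scale
  have "dist2 (state_diff (T \<delta> (T t X)) (T t X)) (state_diff (T t (T \<delta> X)) (T t X)) \<le>
      2 * dist2 (T \<delta> (T t X)) (T t (T \<delta> X)) + 2 * dist2 (T t X) (T t X)"
    by (intro dist2_diff V)
  then have 1: "dist2 (state_diff (T \<delta> (T t X)) (T t X)) (state_diff (T t (T \<delta> X)) (T t X)) = 0"
    using T_increment[OF assms(1) d assms(3)] dist2_self[of "T t X"] V
      dist2_nonneg[of "state_diff (T \<delta> (T t X)) (T t X)" "state_diff (T t (T \<delta> X)) (T t X)"] by simp
  have 2: "dist2 (state_diff (T t (T \<delta> X)) (T t X)) (T t (state_diff (T \<delta> X) X)) = 0"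
    using T_diff[OF assms(1), of "T \<delta> X" X] dist2_commute[of "state_diff (T t (T \<delta> X)) (T t X)" "T t (state_diff (T \<delta> X) X)"] V by simp
  have "dist2 (state_diff (T \<delta> (T t X)) (T t X)) (T t (state_diff (T \<delta> X) X)) = 0"
    by (rule dist2_zero_trans[OF 1 2]) (intro V)+
  then have "dist2 (quot (T t X) \<delta>) (state_scale c (T t (state_diff (T \<delta> X) X))) = 0"
    unfolding quot_def c_def by (subst dist2_scale) (auto intro!: V)
  moreover have "dist2 (state_scale c (T t (state_diff (T \<delta> X) X))) (T t (quot X \<delta>)) = 0"
    using T_scale[OF assms(1), of "state_diff (T \<delta> X) X" c]
      dist2_commute[of "state_scale c (T t (state_diff (T \<delta> X) X))" "T t (quot X \<delta>)"] V
    by (simp add: quot_def c_def)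
  ultimately show ?thesis
    by (rule dist2_zero_trans) (auto simp: quot_def c_def intro!: V)
qed

text \<open>\<open>T t\<close> commutes with forming difference quotients up to null distance and is
  a contraction, so the quotients of \<open>T t X\<close> converge along with those of
  \<open>X\<close>.\<close>

lemma generator_T:
  assumes "(X, Y) \<in> generator" "0 \<le> t"
  shows "(T t X, T t Y) \<in> generator"
proof -
  note XY = generator_V[OF assms(1)]
  have lim: "tends (quot X) Y (at_right 0)" using assms(1) by (simp add: generator_iff)
  have "tends (quot (T t X)) (T t Y) (at_right 0)"
  proof (rule tends_dominated[OF lim])
    show "T t Y \<in> V" by (intro T_V assms XY)
    show "\<forall>\<^sub>F \<delta> in at_right 0. quot (T t X) \<delta> \<in> V"
      using eventually_at_right_less[of "0::real"] by eventually_elim (intro quot_V T_V assms XY)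
    show "\<forall>\<^sub>F \<delta> in at_right 0. dist2 (quot (T t X) \<delta>) (T t Y) \<le> 2 * dist2 (quot X \<delta>) Y"
      using eventually_at_right_less[of "0::real"]
    proof eventually_elim
      case (elim \<delta>)
      have "dist2 (quot (T t X) \<delta>) (T t Y) \<le> 2 * dist2 (quot (T t X) \<delta>) (T t (quot X \<delta>)) + 2 * dist2 (T t (quot X \<delta>)) (T t Y)"
        by (intro dist2_triangle quot_V T_V assms XY elim)
      also have "\<dots> \<le> 2 * 0 + 2 * dist2 (quot X \<delta>) Y"
        unfolding quot_T[OF assms(2) elim XY(1)]
        by (intro add_mono mult_left_mono T_dist2 quot_V assms XY elim) auto
      finally show ?case by simp
    qed
  qed
  then show ?thesis unfolding generator_iff using T_V[OF assms(2) XY(1)] by simp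
qed

text \<open>The instance aimed at is the pair \<open>(quot X \<delta>, quot Y \<delta>)\<close>, a
  scaled difference of two pairs on the same orbit.\<close>

lemma generator_diff_scale:
  assumes "(X, Y) \<in> generator" "(X', Y') \<in> generator"
  shows "(state_scale c (state_diff X X'), state_scale c (state_diff Y Y')) \<in> generator"
proof -
  note XY = generator_V[OF assms(1)] generator_V[OF assms(2)]
  have lim: "tends (quot X) Y (at_right 0)" "tends (quot X') Y' (at_right 0)"
    using assms by (auto simp: generator_iff)
  define W where "W = state_scale c (state_diff X X')"
  have W: "W \<in> V" unfolding W_def by (intro V_scale V_diff XY)
  have q: "dist2 (quot W \<delta>) (state_scale c (state_diff (quot X \<delta>) (quot X' \<delta>))) = 0" if d: "0 < \<delta>" for \<delta>
  proof -
    have d0: "0 \<le> \<delta>" using d by simp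
    define W' where "W' = state_scale c (state_diff (T \<delta> X) (T \<delta> X'))"
    have W': "W' \<in> V" unfolding W'_def by (intro V_scale V_diff T_V XY d0)
    have TW: "dist2 (T \<delta> W) W' = 0"
    proof (rule dist2_zero_trans)
      show "dist2 (T \<delta> W) (state_scale c (T \<delta> (state_diff X X'))) = 0"
        unfolding W_def by (intro T_scale d0 V_diff XY)
      show "dist2 (state_scale c (T \<delta> (state_diff X X'))) W' = 0"
        unfolding W'_def by (subst dist2_scale) (auto intro!: T_V V_diff XY d0 simp: T_diff[OF d0 XY(1,3)])
    qed (intro T_V W W' V_scale V_diff XY d0)+
    have "dist2 (state_diff (T \<delta> W) W) (state_diff W' W) \<le> 2 * dist2 (T \<delta> W) W' + 2 * dist2 W W"
      by (intro dist2_diff T_V d0 W W')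
    then have "dist2 (state_diff (T \<delta> W) W) (state_diff W' W) = 0"
      using TW dist2_self[OF W] dist2_nonneg[of "state_diff (T \<delta> W) W" "state_diff W' W"] by simp
    then have "dist2 (quot W \<delta>) (state_scale (complex_of_real (1 / \<delta>)) (state_diff W' W)) = 0"
      unfolding quot_def by (subst dist2_scale) (auto intro!: V_diff T_V d0 W W')
    also have "state_scale (complex_of_real (1 / \<delta>)) (state_diff W' W) = state_scale c (state_diff (quot X \<delta>) (quot X' \<delta>))"
      unfolding quot_def W_def W'_def
      by (cases "T \<delta> X"; cases "T \<delta> X'"; cases X; cases X')
        (simp add: linear_diff[OF bounded_linear.linear[OF bounded_linear_scaleC_right]] scaleC_scaleC mult.commute,
          simp add: fun_eq_iff algebra_simps)
    finally show ?thesis .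
  qed
  have "tends (quot W) (state_scale c (state_diff Y Y')) (at_right 0)"
    unfolding tends_def
  proof (intro conjI)
    show cY: "state_scale c (state_diff Y Y') \<in> V" by (intro V_scale V_diff XY)
    show "\<forall>\<^sub>F \<delta> in at_right 0. quot W \<delta> \<in> V"
      using eventually_at_right_less[of "0::real"] by eventually_elim (intro quot_V W)
    show "((\<lambda>\<delta>. dist2 (quot W \<delta>) (state_scale c (state_diff Y Y'))) \<longlongrightarrow> 0) (at_right 0)"
    proof (rule tendsto_sandwich)
      show "\<forall>\<^sub>F \<delta> in at_right 0. 0 \<le> dist2 (quot W \<delta>) (state_scale c (state_diff Y Y'))" by simp
      show "\<forall>\<^sub>F \<delta> in at_right 0. dist2 (quot W \<delta>) (state_scale c (state_diff Y Y')) \<le>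
          2 * (cmod c)\<^sup>2 * (2 * dist2 (quot X \<delta>) Y + 2 * dist2 (quot X' \<delta>) Y')"
        using eventually_at_right_less[of "0::real"]
      proof eventually_elim
        case (elim \<delta>)
        note V' = quot_V[OF elim] XY W V_diff V_scale
        have "dist2 (quot W \<delta>) (state_scale c (state_diff Y Y')) \<le>
            2 * dist2 (quot W \<delta>) (state_scale c (state_diff (quot X \<delta>) (quot X' \<delta>)))
            + 2 * dist2 (state_scale c (state_diff (quot X \<delta>) (quot X' \<delta>))) (state_scale c (state_diff Y Y'))"
          by (intro dist2_triangle V')
        also have "dist2 (state_scale c (state_diff (quot X \<delta>) (quot X' \<delta>))) (state_scale c (state_diff Y Y')) =
            (cmod c)\<^sup>2 * dist2 (state_diff (quot X \<delta>) (quot X' \<delta>)) (state_diff Y Y')"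
          by (intro dist2_scale V')
        also have "2 * dist2 (quot W \<delta>) (state_scale c (state_diff (quot X \<delta>) (quot X' \<delta>))) +
            2 * ((cmod c)\<^sup>2 * dist2 (state_diff (quot X \<delta>) (quot X' \<delta>)) (state_diff Y Y'))
            \<le> 2 * 0 + 2 * ((cmod c)\<^sup>2 * (2 * dist2 (quot X \<delta>) Y + 2 * dist2 (quot X' \<delta>) Y'))"
          unfolding q[OF elim] by (intro add_mono mult_left_mono dist2_diff V') auto
        finally show ?case by (simp add: mult.assoc)
      qed
      have "((\<lambda>\<delta>. 2 * (cmod c)\<^sup>2 * (2 * dist2 (quot X \<delta>) Y + 2 * dist2 (quot X' \<delta>) Y')) \<longlongrightarrow>
          2 * (cmod c)\<^sup>2 * (2 * 0 + 2 * 0)) (at_right 0)"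
        using lim unfolding tends_def by (intro tendsto_intros) auto
      then show "((\<lambda>\<delta>. 2 * (cmod c)\<^sup>2 * (2 * dist2 (quot X \<delta>) Y + 2 * dist2 (quot X' \<delta>) Y')) \<longlongrightarrow> 0) (at_right 0)" by simp
    qed auto
  qed
  then show ?thesis unfolding generator_iff W_def[symmetric] using W by simp
qed

subsection \<open>Differentiability of the modes along orbits\<close>

lemma functional_quot:
  assumes "bounded_functional f" "0 \<le> t" "0 < \<delta>" "X \<in> V"
  shows "f (T t (quot X \<delta>)) = (f (T (t + \<delta>) X) - f (T t X)) / of_real \<delta>"
proof -
  have d: "0 \<le> \<delta>" using assms by simp
  have "f (T t (quot X \<delta>)) = f (quot (T t X) \<delta>)"
    by (rule functional_cong[OF assms(1), symmetric]) (intro quot_T quot_V T_V assms)+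
  also have "\<dots> = of_real (1 / \<delta>) * f (state_diff (T \<delta> (T t X)) (T t X))"
    using assms(1) V_diff[OF T_V[OF d T_V[OF assms(2,4)]] T_V[OF assms(2,4)]]
    unfolding quot_def bounded_functional_def by blast
  also have "f (state_diff (T \<delta> (T t X)) (T t X)) = f (T \<delta> (T t X)) - f (T t X)"
    by (intro functional_diff assms T_V d)
  also have "f (T \<delta> (T t X)) = f (T (\<delta> + t) X)"
    by (rule functional_cong[OF assms(1), symmetric]) (intro T_plus T_V add_nonneg_nonneg d assms)+
  finally show ?thesis by (simp add: add.commute)
qed

text \<open>The semigroup runs only forward, so a difference quotient between \<open>t\<close> and
  \<open>y\<close> must start at the earlier time \<open>min t y\<close>. Moving the base point back
  to \<open>t\<close> costs an increment of the orbit of \<open>Y\<close> over the time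
  \<open>\<bar>y - t\<bar>\<close>. The quantifier over \<open>f\<close> lets one \<open>s\<close>
  serve for all functionals together with the distance bounds.\<close>

lemma orbit_step:
  assumes "0 \<le> t" "0 \<le> y" "t \<noteq> y" "X \<in> V" "Y \<in> V"
  obtains s where "0 \<le> s" "\<bar>y - t\<bar> > 0"
    "\<forall>f. bounded_functional f \<longrightarrow> f (T s (quot X \<bar>y - t\<bar>)) = (f (T y X) - f (T t X)) / of_real (y - t)"
    "dist2 (T s (quot X \<bar>y - t\<bar>)) (T t Y) \<le> 2 * dist2 (quot X \<bar>y - t\<bar>) Y + 4 * dist2 (T \<bar>y - t\<bar> Y) Y"
    "dist2 (T y X) (T t X) \<le> 4 * dist2 (T \<bar>y - t\<bar> X) X"
proof (rule that[of "min t y"])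
  define \<delta> where "\<delta> = \<bar>y - t\<bar>"
  define s where "s = min t y"
  have d: "0 < \<delta>" "0 \<le> \<delta>" and s: "0 \<le> s" using assms by (auto simp: \<delta>_def s_def)
  show "0 \<le> min t y" "\<bar>y - t\<bar> > 0" using assms by auto
  have cases: "(t = s \<and> y = s + \<delta>) \<or> (t = s + \<delta> \<and> y = s)" by (auto simp: s_def \<delta>_def)
  note V = T_V[OF s] T_V[OF d(2)] T_V[OF assms(1)] T_V[OF assms(2)] assms(4,5) quot_V[OF d(1)]
  show "\<forall>f. bounded_functional f \<longrightarrow> f (T (min t y) (quot X \<bar>y - t\<bar>)) = (f (T y X) - f (T t X)) / of_real (y - t)"
  proof (intro allI impI)
    fix f assume that: "bounded_functional f"
    have "f (T s (quot X \<delta>)) = (f (T y X) - f (T t X)) / of_real (y - t)"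
      using cases functional_quot[OF that s d(1) assms(4)] d(1)
      by (auto simp: field_simps)
    then show "f (T (min t y) (quot X \<bar>y - t\<bar>)) = (f (T y X) - f (T t X)) / of_real (y - t)"
      by (simp add: s_def \<delta>_def)
  qed
  have st: "dist2 (T s Z) (T r Z) \<le> 2 * dist2 (T \<delta> Z) Z" if Z: "Z \<in> V" and r: "r = t \<or> r = y" for Z r
  proof (cases "r = s")
    case True
    then show ?thesis using dist2_self[OF T_V[OF s Z]] by simp
  next
    case False
    then have r: "r = s + \<delta>" using cases r by auto
    have "dist2 (T s Z) (T r Z) \<le> 2 * dist2 (T s Z) (T s (T \<delta> Z)) + 2 * dist2 (T s (T \<delta> Z)) (T r Z)"
      unfolding r by (intro dist2_triangle T_V s d add_nonneg_nonneg Z)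
    also have "dist2 (T s (T \<delta> Z)) (T r Z) = 0"
      unfolding r using T_plus[OF s d(2) Z] by (subst dist2_commute) (auto intro!: T_V s d add_nonneg_nonneg Z)
    also have "dist2 (T s Z) (T s (T \<delta> Z)) \<le> dist2 Z (T \<delta> Z)" by (intro T_dist2 s T_V d Z)
    also have "dist2 Z (T \<delta> Z) = dist2 (T \<delta> Z) Z" by (intro dist2_commute T_V d Z)
    finally show ?thesis by simp
  qed
  have "dist2 (T s (quot X \<delta>)) (T t Y) \<le> 2 * dist2 (T s (quot X \<delta>)) (T s Y) + 2 * dist2 (T s Y) (T t Y)"
    by (intro dist2_triangle V)
  also have "\<dots> \<le> 2 * dist2 (quot X \<delta>) Y + 2 * (2 * dist2 (T \<delta> Y) Y)"
    by (intro add_mono mult_left_mono T_dist2 V s st) auto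
  finally show "dist2 (T (min t y) (quot X \<bar>y - t\<bar>)) (T t Y) \<le> 2 * dist2 (quot X \<bar>y - t\<bar>) Y + 4 * dist2 (T \<bar>y - t\<bar> Y) Y"
    by (simp add: s_def \<delta>_def)
  have "dist2 (T y X) (T t X) \<le> 4 * dist2 (T \<delta> X) X"
  proof (cases "t = s")
    case True
    then have "dist2 (T y X) (T t X) = dist2 (T s X) (T y X)" using dist2_commute V by metis
    also have "\<dots> \<le> 2 * dist2 (T \<delta> X) X" by (intro st V) simp
    also have "\<dots> \<le> 4 * dist2 (T \<delta> X) X" by simp
    finally show ?thesis .
  next
    case False
    then have "y = s" using cases by auto
    then have "dist2 (T y X) (T t X) \<le> 2 * dist2 (T \<delta> X) X" using st[OF assms(4), of t] by simp
    also have "\<dots> \<le> 4 * dist2 (T \<delta> X) X" by simp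
    finally show ?thesis .
  qed
  then show "dist2 (T y X) (T t X) \<le> 4 * dist2 (T \<bar>y - t\<bar> X) X" by (simp add: \<delta>_def)
qed

lemma filterlim_abs_diff: "filterlim (\<lambda>y. \<bar>y - t\<bar>) (at_right 0) (at t within S)" for t :: real
proof -
  have "((\<lambda>y. \<bar>y - t\<bar>) \<longlongrightarrow> \<bar>t - t\<bar>) (at t within S)" by (intro tendsto_intros)
  then show ?thesis
    unfolding filterlim_at by (auto simp: eventually_at_filter)
qed

lemma has_vector_derivative_within_quotient:
  fixes f :: "real \<Rightarrow> 'b::real_normed_vector"
  assumes "((\<lambda>y. norm ((f y - f t) /\<^sub>R (y - t) - f')) \<longlongrightarrow> 0) (at t within S)"
  shows "(f has_vector_derivative f') (at t within S)"
  unfolding has_vector_derivative_def has_derivative_within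
proof (intro conjI bounded_linear_scaleR_left)
  have "((\<lambda>y. norm ((1 / norm (y - t)) *\<^sub>R (f y - (f t + (y - t) *\<^sub>R f')))) \<longlongrightarrow> 0) (at t within S)"
    using assms
  proof (rule Lim_transform_eventually)
    have "norm ((f y - f t) /\<^sub>R (y - t) - f') = norm ((1 / norm (y - t)) *\<^sub>R (f y - (f t + (y - t) *\<^sub>R f')))" if "y \<noteq> t" for y
    proof -
      have "(f y - f t) /\<^sub>R (y - t) - f' = (1 / (y - t)) *\<^sub>R (f y - (f t + (y - t) *\<^sub>R f'))"
        using that by (simp add: scaleR_diff_right scaleR_add_right inverse_eq_divide)
      then show ?thesis by simp
    qed
    then show "\<forall>\<^sub>F y in at t within S. norm ((f y - f t) /\<^sub>R (y - t) - f') = norm ((1 / norm (y - t)) *\<^sub>R (f y - (f t + (y - t) *\<^sub>R f')))"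
      by (auto simp: eventually_at_filter)
  qed
  then show "((\<lambda>y. (1 / norm (y - t)) *\<^sub>R (f y - (f t + (y - t) *\<^sub>R f'))) \<longlongrightarrow> 0) (at t within S)"
    by (rule tendsto_norm_zero_cancel)
qed

text \<open>The generator supplies right difference quotients at time \<open>0\<close> only;
  \<open>orbit_step\<close> turns them into a derivative at every time, from both sides where
  \<open>t > 0\<close>, as Gronwall's argument needs.\<close>

lemma functional_derivative:
  assumes f: "bounded_functional f" and XY: "(X, Y) \<in> generator" and t: "0 \<le> t"
  shows "((\<lambda>t. f (T t X)) has_vector_derivative f (T t Y)) (at t within {0..})"
proof (rule has_vector_derivative_within_quotient)
  note V = generator_V[OF XY]
  obtain C where C: "\<And>X. X \<in> V \<Longrightarrow> (cmod (f X))\<^sup>2 \<le> C * (N X)\<^sup>2"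
    using f unfolding bounded_functional_def by blast
  \<comment> \<open>\<open>bounded_functional\<close> does not fix the sign of its constant, hence
    the absolute value.\<close>
  define r where "r \<delta> = \<bar>C\<bar> * (2 * dist2 (quot X \<delta>) Y + 4 * dist2 (T \<delta> Y) Y)" for \<delta>
  have "(r \<longlongrightarrow> \<bar>C\<bar> * (2 * 0 + 4 * 0)) (at_right 0)"
    unfolding r_def using XY T_tends[OF V(2)] unfolding generator_iff tends_def by (intro tendsto_intros) auto
  then have "(r \<longlongrightarrow> 0) (at_right 0)" by simp
  from filterlim_compose[OF this filterlim_abs_diff]
  have rl: "((\<lambda>y. sqrt (r \<bar>y - t\<bar>)) \<longlongrightarrow> 0) (at t within {0..})"
    using tendsto_real_sqrt[of "\<lambda>y. r \<bar>y - t\<bar>" 0] by simp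
  show "((\<lambda>y. norm ((f (T y X) - f (T t X)) /\<^sub>R (y - t) - f (T t Y))) \<longlongrightarrow> 0) (at t within {0..})"
  proof (rule tendsto_sandwich[OF _ _ tendsto_const rl])
    have "norm ((f (T y X) - f (T t X)) /\<^sub>R (y - t) - f (T t Y)) \<le> sqrt (r \<bar>y - t\<bar>)" if y: "0 \<le> y" "y \<noteq> t" for y
    proof -
      obtain s where s: "0 \<le> s" "\<bar>y - t\<bar> > 0"
        "\<forall>f. bounded_functional f \<longrightarrow> f (T s (quot X \<bar>y - t\<bar>)) = (f (T y X) - f (T t X)) / of_real (y - t)"
        "dist2 (T s (quot X \<bar>y - t\<bar>)) (T t Y) \<le> 2 * dist2 (quot X \<bar>y - t\<bar>) Y + 4 * dist2 (T \<bar>y - t\<bar> Y) Y"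
        "dist2 (T y X) (T t X) \<le> 4 * dist2 (T \<bar>y - t\<bar> X) X"
        using orbit_step[OF t y(1) y(2)[symmetric] V] .
      note QV = T_V[OF s(1) quot_V[OF s(2) V(1)]] T_V[OF t V(2)]
      have "(f (T y X) - f (T t X)) /\<^sub>R (y - t) = f (T s (quot X \<bar>y - t\<bar>))"
        using s(3) f by (simp add: scaleR_conv_of_real inverse_eq_divide)
      then have "(norm ((f (T y X) - f (T t X)) /\<^sub>R (y - t) - f (T t Y)))\<^sup>2 = (cmod (f (state_diff (T s (quot X \<bar>y - t\<bar>)) (T t Y))))\<^sup>2"
        by (simp add: functional_diff[OF f QV])
      also have "\<dots> \<le> C * dist2 (T s (quot X \<bar>y - t\<bar>)) (T t Y)"
        unfolding dist2_def by (rule C[OF V_diff[OF QV]])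
      also have "\<dots> \<le> \<bar>C\<bar> * dist2 (T s (quot X \<bar>y - t\<bar>)) (T t Y)" by (intro mult_right_mono) auto
      also have "\<dots> \<le> r \<bar>y - t\<bar>" unfolding r_def using s(4) by (intro mult_left_mono) auto
      finally show ?thesis by (rule real_le_rsqrt)
    qed
    then show "\<forall>\<^sub>F y in at t within {0..}. norm ((f (T y X) - f (T t X)) /\<^sub>R (y - t) - f (T t Y)) \<le> sqrt (r \<bar>y - t\<bar>)"
      by (auto simp: eventually_at_filter)
  qed simp
qed

text \<open>In the expansion around \<open>T t X\<close> the linear part is differentiated as a
  bounded functional. The remainder is quadratic in the increment of the orbit, which is of first
  order because the quotients \<open>quot X \<delta>\<close> stay bounded as \<open>\<delta>\<close>
  tends to \<open>0\<close>.\<close>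

lemma mode_h_derivative:
  assumes XY: "(X, Y) \<in> generator" and t: "0 \<le> t"
  shows "((\<lambda>t. mode_h k (T t X)) has_vector_derivative
      mode_h k (state_add (T t X) (T t Y)) - mode_h k (T t X) - mode_h k (T t Y)) (at t within {0..})"
proof -
  note V = generator_V[OF XY]
  note TV = T_V[OF t V(1)] T_V[OF t V(2)]
  define f where "f = (\<lambda>X'. \<integral>s. mode_memory k X' s * cnj (mode_memory k (T t X) s) \<partial>G)"
  have f: "bounded_functional f"
    unfolding f_def by (rule bounded_functional_memory[OF mode_memory_square_integrable[OF TV(1)]])
  define R where "R y = (if 0 \<le> y then mode_h k (state_diff (T y X) (T t X)) else 0)" for y
  have Rt: "R t = 0"
  proof -
    have "state_diff (T t X) (T t X) = state_scale 0 (T t X)" by (cases "T t X") simp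
    then show ?thesis by (simp add: R_def mode_h_scale)
  qed
  have dR: "(R has_vector_derivative 0) (at t within {0..})"
  proof (rule has_vector_derivative_within_quotient)
    define b where "b \<delta> = \<delta> * (4 / \<xi> k powr a * (2 * (N Y)\<^sup>2 + 2 * dist2 (quot X \<delta>) Y))" for \<delta>
    have "(b \<longlongrightarrow> 0 * (4 / \<xi> k powr a * (2 * (N Y)\<^sup>2 + 2 * 0))) (at_right 0)"
      unfolding b_def using XY unfolding generator_iff tends_def by (intro tendsto_intros) auto
    then have "(b \<longlongrightarrow> 0) (at_right 0)" by simp
    from filterlim_compose[OF this filterlim_abs_diff]
    have bl: "((\<lambda>y. b \<bar>y - t\<bar>) \<longlongrightarrow> 0) (at t within {0..})" .
    show "((\<lambda>y. norm ((R y - R t) /\<^sub>R (y - t) - 0)) \<longlongrightarrow> 0) (at t within {0..})"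
    proof (rule tendsto_sandwich[OF _ _ tendsto_const bl])
      have "norm ((R y - R t) /\<^sub>R (y - t) - 0) \<le> b \<bar>y - t\<bar>" if y: "0 \<le> y" "y \<noteq> t" for y
      proof -
        define \<delta> where "\<delta> = \<bar>y - t\<bar>"
        have "\<bar>y - t\<bar> > 0" and st: "dist2 (T y X) (T t X) \<le> 4 * dist2 (T \<bar>y - t\<bar> X) X"
          by (rule orbit_step[OF t y(1) y(2)[symmetric] V], assumption)+
        then have d: "0 < \<delta>" "0 \<le> \<delta>" by (auto simp: \<delta>_def)
        have "R y = mode_h k (state_diff (T y X) (T t X))" using y by (simp add: R_def)
        also have "\<dots> \<le> 1 / \<xi> k powr a * dist2 (T y X) (T t X)"
          unfolding dist2_def by (intro mode_energy_components(5) V_diff T_V y V t)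
        also have "\<dots> \<le> 1 / \<xi> k powr a * (4 * dist2 (T \<delta> X) X)"
          using st unfolding \<delta>_def by (intro mult_left_mono) auto
        also have "dist2 (T \<delta> X) X = \<delta>\<^sup>2 * (N (quot X \<delta>))\<^sup>2"
          using d N_scale[OF V_diff[OF T_V[OF d(2) V(1)] V(1)], of "complex_of_real (1 / \<delta>)"]
          unfolding quot_def dist2_def by (simp add: norm_divide power_divide)
        also have "(N (quot X \<delta>))\<^sup>2 \<le> 2 * (N Y)\<^sup>2 + 2 * dist2 (quot X \<delta>) Y"
          by (intro N_le_dist2 quot_V d V)
        finally have "R y \<le> 1 / \<xi> k powr a * (4 * (\<delta>\<^sup>2 * (2 * (N Y)\<^sup>2 + 2 * dist2 (quot X \<delta>) Y)))"
          by (simp add: mult_left_mono divide_right_mono)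
        also have "\<dots> = \<delta> * b \<delta>" by (simp add: b_def power2_eq_square)
        finally have "R y / \<delta> \<le> b \<delta>" using d by (simp add: pos_divide_le_eq mult.commute)
        moreover have "0 \<le> R y" by (simp add: R_def)
        ultimately show ?thesis by (simp add: Rt \<delta>_def abs_mult divide_inverse mult.commute)
      qed
      then show "\<forall>\<^sub>F y in at t within {0..}. norm ((R y - R t) /\<^sub>R (y - t) - 0) \<le> b \<bar>y - t\<bar>"
        by (auto simp: eventually_at_filter)
    qed simp
  qed
  have df: "((\<lambda>y. Re (f (T y X))) has_vector_derivative Re (f (T t Y))) (at t within {0..})"
    by (rule bounded_linear.has_vector_derivative[OF bounded_linear_Re functional_derivative[OF f XY t]])
  have "((\<lambda>y. mode_h k (T t X) + 2 * (Re (f (T y X)) - Re (f (T t X))) + R y) has_vector_derivative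
      0 + 2 * (Re (f (T t Y)) - 0) + 0) (at t within {0..})"
    by (intro has_vector_derivative_add has_vector_derivative_diff has_vector_derivative_mult_right
        has_vector_derivative_const df dR)
  then have "((\<lambda>y. mode_h k (T y X)) has_vector_derivative 0 + 2 * (Re (f (T t Y)) - 0) + 0) (at t within {0..})"
  proof (rule has_vector_derivative_transform[rotated 2])
    show "t \<in> {0..}" using t by simp
    fix y :: real assume "y \<in> {0..}"
    then have y: "0 \<le> y" by simp
    show "mode_h k (T y X) = mode_h k (T t X) + 2 * (Re (f (T y X)) - Re (f (T t X))) + R y"
      using mode_h_expand[OF TV(1) T_V[OF y V(1)], of k] y unfolding f_def R_def by simp
  qed
  moreover have "2 * Re (f (T t Y)) = mode_h k (state_add (T t X) (T t Y)) - mode_h k (T t X) - mode_h k (T t Y)"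
  proof -
    have "state_add (T t X) (T t Y) = state_add (T t Y) (T t X)"
      by (cases "T t X"; cases "T t Y") (simp add: add.commute)
    then show ?thesis using mode_h_add[OF TV(2,1), of k] unfolding f_def by simp
  qed
  ultimately show ?thesis by simp
qed

section \<open>Decay of the modes along orbits and of the state norm\<close>

lemma mode_balance_generator:
  assumes XY: "(X, Y) \<in> generator"
  shows "mode.mode_balance (\<xi> k) (B k) (mode_v k X) (mode_w k X) (mode_m k X) (mode_h k X) (mode_u k Y) (mode_q k Y)"
proof -
  have "0 \<le> kernel_mass g * \<xi> k powr a" using mass_pos by simp
  then show ?thesis
    using generator_relations[OF XY, of k] eigenvalue_ge[of k] gap[of k] mode_m_bound[OF generator_V(1)[OF XY], of k]
    unfolding mode.mode_balance_def mode_relations_def by simp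
qed

lemma mode_solution_orbit:
  assumes XY: "(X, Y) \<in> generator"
  shows "mode.mode_solution (\<xi> k) (B k) (\<lambda>t. mode_v k (T t X)) (\<lambda>t. mode_w k (T t X)) (\<lambda>t. mode_u k (T t X))
     (\<lambda>t. mode_q k (T t X)) (\<lambda>t. mode_m k (T t X)) (\<lambda>t. mode_h k (T t X))"
  unfolding mode.mode_solution_def
proof (intro allI impI)
  fix t :: real assume t: "0 \<le> t"
  note rel = generator_relations[OF generator_T[OF XY t], of k, unfolded mode_relations_def]
  note d = functional_derivative[OF _ XY t]
  have "half_deriv (\<lambda>t. mode_v k (T t X)) (mode_u k (T t X)) t"
    using d[OF bounded_functional_modes(1)[of k]] rel by simp
  moreover have "half_deriv (\<lambda>t. mode_w k (T t X)) (\<gamma> *\<^sub>R mode_u k (T t X) - mode_q k (T t X)) t"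
    using d[OF bounded_functional_modes(2)[of k]] rel by metis
  ultimately show "half_deriv (\<lambda>t. mode_v k (T t X)) (mode_u k (T t X)) t \<and>
    half_deriv (\<lambda>t. mode_w k (T t X)) (\<gamma> *\<^sub>R mode_u k (T t X) - mode_q k (T t X)) t \<and>
    (\<exists>du dq dm dh. half_deriv (\<lambda>t. mode_u k (T t X)) du t \<and> half_deriv (\<lambda>t. mode_q k (T t X)) dq t \<and>
      half_deriv (\<lambda>t. mode_m k (T t X)) dm t \<and> half_deriv (\<lambda>t. mode_h k (T t X)) dh t \<and>
      mode.mode_balance (\<xi> k) (B k) (mode_v k (T t X)) (mode_w k (T t X)) (mode_m k (T t X)) (mode_h k (T t X)) du dq \<and>
      (cmod (dm - kernel_mass g *\<^sub>R mode_u k (T t X)))\<^sup>2 \<le> k0\<^sup>2 * kernel_mass g * mode_h k (T t X) \<and>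
      dh \<le> 2 * inner (mode_m k (T t X)) (mode_u k (T t X)) - k1 * mode_h k (T t X))"
    using d[OF bounded_functional_modes(3)] d[OF bounded_functional_modes(4)] d[OF bounded_functional_m]
      mode_h_derivative[OF XY t] mode_balance_generator[OF generator_T[OF XY t]] rel by blast
qed

lemma mode_E_decreasing:
  assumes XY: "(X, Y) \<in> generator" and t: "0 \<le> t"
  shows "mode_E k (T t X) \<le> mode_E k X"
proof -
  have "mode_E k (T t X) \<le> exp (- 0 * (t - 0)) * mode_E k (T 0 X)"
  proof (rule gronwall_decay[OF _ order_refl t])
    fix r :: real assume r: "0 \<le> r"
    obtain dE where dE: "half_deriv (\<lambda>t. mode_E k (T t X)) dE r"
      "dE \<le> - k1 * (\<xi> k powr a) * mode_h k (T r X)"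
      using mode.mode_energy_derivative[OF mode_solution_orbit[OF XY, of k] r] unfolding mode_E_def by blast
    have "0 \<le> k1 * (\<xi> k powr a) * mode_h k (T r X)" using k by simp
    then show "\<exists>d. half_deriv (\<lambda>t. mode_E k (T t X)) d r \<and> d \<le> - 0 * mode_E k (T r X)"
      using dE by (intro exI[of _ dE]) auto
  qed
  moreover have "mode_E k (T 0 X) = mode_E k X"
    using generator_V[OF XY] T_zero by (intro mode_E_cong T_V) auto
  ultimately show ?thesis by simp
qed

text \<open>\<open>Y\<close> need not be in the domain of the generator, but difference quotients of the orbit of \<open>X\<close>
  are, and they approximate it.\<close>

lemma mode_E_derivative_decreasing:
  assumes XY: "(X, Y) \<in> generator" and t: "0 \<le> t"
  shows "mode_E k (T t Y) \<le> mode_E k Y"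
proof (rule tendsto_le)
  note V = generator_V[OF XY]
  have lim: "tends (quot X) Y (at_right 0)" using XY by (simp add: generator_iff)
  show "((\<lambda>\<delta>. mode_E k (quot X \<delta>)) \<longlongrightarrow> mode_E k Y) (at_right 0)" by (rule mode_E_tendsto[OF lim])
  have "tends (\<lambda>\<delta>. T t (quot X \<delta>)) (T t Y) (at_right 0)"
  proof (rule tends_dominated[OF lim])
    show "T t Y \<in> V" by (intro T_V t V)
    show "\<forall>\<^sub>F \<delta> in at_right 0. T t (quot X \<delta>) \<in> V"
      using eventually_at_right_less[of "0::real"] by eventually_elim (intro T_V t quot_V V)
    show "\<forall>\<^sub>F \<delta> in at_right 0. dist2 (T t (quot X \<delta>)) (T t Y) \<le> 1 * dist2 (quot X \<delta>) Y"
      using eventually_at_right_less[of "0::real"] by eventually_elim (simp add: T_dist2 t quot_V V)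
  qed
  then show "((\<lambda>\<delta>. mode_E k (T t (quot X \<delta>))) \<longlongrightarrow> mode_E k (T t Y)) (at_right 0)" by (rule mode_E_tendsto)
  show "\<forall>\<^sub>F \<delta> in at_right 0. mode_E k (T t (quot X \<delta>)) \<le> mode_E k (quot X \<delta>)"
    using eventually_at_right_less[of "0::real"]
  proof eventually_elim
    case (elim \<delta>)
    have "(quot X \<delta>, quot Y \<delta>) \<in> generator"
      unfolding quot_def using elim by (intro generator_diff_scale generator_T XY) simp
    then show ?case by (rule mode_E_decreasing[OF _ t])
  qed
qed simp

lemma polynomial_decay:
  obtains C where "0 < C"
    "\<And>X t. X \<in> Dom \<Longrightarrow> 0 < t \<Longrightarrow> N (T t X) \<le> C * t powr (- (1 / (2 - 2 * a))) * (N X + N (Op X))"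
proof -
  obtain C where C: "0 < C" and decay:
    "\<And>x B (v :: real \<Rightarrow> complex) w u q m h dw du dq hY F0 t.
      \<lbrakk>mode.mode_solution x B v w u q m h; 0 < t;
       \<And>t. 0 \<le> t \<Longrightarrow> mode.mode_balance x B (v t) (w t) (m t) (h t) (du t) (dq t) \<and> 0 \<le> hY t \<and> dw t = \<gamma> *\<^sub>R u t - q t;
       \<And>t. 0 \<le> t \<Longrightarrow> mode.mode_energy x B (u t) (dw t) (du t) (dq t) (hY t) \<le> F0\<rbrakk> \<Longrightarrow>
      mode.mode_energy x B (v t) (w t) (u t) (q t) (h t)
        \<le> C * t powr (- (1 / (1 - a))) * (mode.mode_energy x B (v 0) (w 0) (u 0) (q 0) (h 0) + F0)"
    using mode.mode_poly_decay by blast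
  show ?thesis
  \<comment> \<open>\<open>C\<close> belongs to the squared norm, the sum of the mode
    energies.\<close>
  proof (rule that[of "sqrt C"])
    fix X t assume X: "X \<in> Dom" and t: "(0::real) < t"
    have t0: "0 \<le> t" using t by simp
    define Y where "Y = Op X"
    have XY: "(X, Y) \<in> generator"
      using Op_in_closure[OF X] gen by (simp add: generates_def Y_def)
    note V = generator_V[OF XY]
    have E: "mode_E k (T t X) \<le> C * t powr (- (1 / (1 - a))) * (mode_E k X + mode_E k Y)" for k
    proof -
      have rel: "mode_v k (T r Y) = mode_u k (T r X)" "mode_w k (T r Y) = \<gamma> *\<^sub>R mode_u k (T r X) - mode_q k (T r X)" if "0 \<le> r" for r
        using generator_relations[OF generator_T[OF XY that], of k] unfolding mode_relations_def by blast+
      have "mode_E k (T t X) \<le> C * t powr (- (1 / (1 - a))) * (mode_E k (T 0 X) + mode_E k Y)"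
        unfolding mode_E_def[of k "T t X"] mode_E_def[of k "T 0 X"]
      \<comment> \<open>By the mode relations, the time derivatives of the components of
        \<open>T r X\<close> other than the memory are the corresponding modes of
        \<open>T r Y\<close>. So the second energy is \<open>mode_E k (T r Y)\<close>, which never
        exceeds \<open>mode_E k Y\<close>.\<close>
      proof (rule decay[OF mode_solution_orbit[OF XY, of k] t, of "\<lambda>t. mode_u k (T t Y)" "\<lambda>t. mode_q k (T t Y)"
            "\<lambda>t. mode_h k (T t Y)" "\<lambda>t. mode_w k (T t Y)"])
        show "mode.mode_balance (\<xi> k) (B k) (mode_v k (T r X)) (mode_w k (T r X)) (mode_m k (T r X)) (mode_h k (T r X))
            (mode_u k (T r Y)) (mode_q k (T r Y)) \<and> 0 \<le> mode_h k (T r Y) \<and>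
          mode_w k (T r Y) = \<gamma> *\<^sub>R mode_u k (T r X) - mode_q k (T r X)" if "0 \<le> r" for r
          using rel(2)[OF that] mode_balance_generator[OF generator_T[OF XY that]] by simp
        show "mode.mode_energy (\<xi> k) (B k) (mode_u k (T r X)) (mode_w k (T r Y)) (mode_u k (T r Y)) (mode_q k (T r Y)) (mode_h k (T r Y))
          \<le> mode_E k Y" if "0 \<le> r" for r
          using mode_E_derivative_decreasing[OF XY that, of k] rel(1)[OF that] by (simp add: mode_E_def)
      qed
      also have "mode_E k (T 0 X) = mode_E k X" using T_zero V by (intro mode_E_cong T_V) auto
      finally show ?thesis .
    qed
    have "(N (T t X))\<^sup>2 \<le> C * t powr (- (1 / (1 - a))) * ((N X)\<^sup>2 + (N Y)\<^sup>2)"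
      by (rule sums_le[OF E norm_sums(1)[OF T_V[OF t0 V(1)]] sums_mult[OF sums_add[OF norm_sums(1)[OF V(1)] norm_sums(1)[OF V(2)]]]])
    also have "\<dots> \<le> C * t powr (- (1 / (1 - a))) * (N X + N Y)\<^sup>2"
      using C norm_sums(2)[OF V(1)] norm_sums(2)[OF V(2)] by (intro mult_left_mono) (auto simp: power2_sum)
    \<comment> \<open>Passing from the squared norm to the norm halves the exponent
      \<open>1 / (1 - a)\<close>.\<close>
    also have "\<dots> = (sqrt C * t powr (- (1 / (2 - 2 * a))) * (N X + N Y))\<^sup>2"
    proof -
      have "- (1 / (1 - a)) = - (1 / (2 - 2 * a)) + - (1 / (2 - 2 * a))"
        using a by (simp add: field_simps)
      then have "t powr (- (1 / (1 - a))) = (t powr (- (1 / (2 - 2 * a))))\<^sup>2"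
        by (simp only: powr_add power2_eq_square)
      moreover have "(sqrt C)\<^sup>2 = C" using C by simp
      ultimately show ?thesis by (simp only: power_mult_distrib)
    qed
    finally show "N (T t X) \<le> sqrt C * t powr (- (1 / (2 - 2 * a))) * (N X + N (Op X))"
      unfolding Y_def[symmetric]
      by (rule power2_le_imp_le) (intro mult_nonneg_nonneg add_nonneg_nonneg norm_sums(2) V, use C in auto)
  qed (use C in auto)
qed

end

theorem theorem3p1:
  fixes D :: "'h::{complex_hilbert, second_countable_topology} set"
    and A :: "'h \<Rightarrow> 'h"
    and \<xi> :: "nat \<Rightarrow> real" and \<Psi> :: "nat \<Rightarrow> 'h"
    and a \<rho> \<mu> \<alpha> \<beta> \<gamma> :: real
    and g g' :: "real \<Rightarrow> real"
    and T :: "real \<Rightarrow> 'h state \<Rightarrow> 'h state"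
  assumes "self_adjoint D A" and "strictly_positive D A" and "compact_resolvent D A"
    and "eigensystem D A \<xi> \<Psi>"
    and "0 \<le> a" and "a < 1"
    and "\<rho> > 0" and "\<mu> > 0" and "\<alpha> > 0" and "\<beta> > 0" and "\<gamma> > 0"
    and "\<alpha> - \<gamma>\<^sup>2 * \<beta> > 0"
    and "kernel_A1 g g'" and "kernel_A2 g g'"
    and "\<exists>\<kappa>. 0 < \<kappa> \<and> \<kappa> < \<alpha> - \<gamma>\<^sup>2 * \<beta> \<and>
           (\<forall>f \<in> frac_dom \<xi> \<Psi> (1/2). f \<noteq> 0 \<longrightarrow>
              (\<alpha> - \<gamma>\<^sup>2 * \<beta>) * (norm (frac_pow \<xi> \<Psi> (1/2) f))\<^sup>2
                - kernel_mass g * (norm (frac_pow \<xi> \<Psi> (a/2) f))\<^sup>2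
              > \<kappa> * (norm (frac_pow \<xi> \<Psi> (1/2) f))\<^sup>2)"
    and "contraction_C0_semigroup (state_space \<xi> \<Psi> a g) (state_norm \<xi> \<Psi> a \<rho> \<mu> \<alpha> \<beta> \<gamma> g) T"
    and "generates (state_space \<xi> \<Psi> a g) (state_norm \<xi> \<Psi> a \<rho> \<mu> \<alpha> \<beta> \<gamma> g)
           (op_dom D \<xi> \<Psi> a g) (op_A A \<xi> \<Psi> a \<rho> \<mu> \<alpha> \<beta> \<gamma> g) T"
  shows "\<exists>C>0. \<forall>X\<^sub>0 \<in> op_dom D \<xi> \<Psi> a g. \<forall>t\<ge>1.
           state_norm \<xi> \<Psi> a \<rho> \<mu> \<alpha> \<beta> \<gamma> g (T t X\<^sub>0)
             \<le> C * t powr (- (1 / (2 - 2 * a))) *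
               graph_norm (state_norm \<xi> \<Psi> a \<rho> \<mu> \<alpha> \<beta> \<gamma> g) (op_A A \<xi> \<Psi> a \<rho> \<mu> \<alpha> \<beta> \<gamma> g) X\<^sub>0"
proof -
  obtain \<kappa> where \<kappa>: "0 < \<kappa>" and gap: "\<And>f. f \<in> frac_dom \<xi> \<Psi> (1/2) \<Longrightarrow> f \<noteq> 0 \<Longrightarrow>
      \<kappa> * (norm (frac_pow \<xi> \<Psi> (1/2) f))\<^sup>2 < (\<alpha> - \<gamma>\<^sup>2 * \<beta>) * (norm (frac_pow \<xi> \<Psi> (1/2) f))\<^sup>2
        - kernel_mass g * (norm (frac_pow \<xi> \<Psi> (a/2) f))\<^sup>2"
    using assms(15) by blast
  obtain k0 k1 where k: "0 < k0" "0 < k1" and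
    kernel: "\<And>s. 0 < s \<Longrightarrow> - k0 * g s \<le> g' s" "\<And>s. 0 < s \<Longrightarrow> g' s \<le> - k1 * g s"
    using assms(14) unfolding kernel_A2_def by blast
  interpret spectral \<Psi> D A \<xi>
    using assms(1,4) by unfold_locales (auto simp: eigensystem_def)
  \<comment> \<open>On an eigenvector every fractional power acts as multiplication by a number, so
    the coercivity hypothesis at \<open>\<Psi> k\<close> is the scalar inequality
    \<open>gap\<close>.\<close>
  have pw: "(norm (frac_pow \<xi> \<Psi> r (\<Psi> k)))\<^sup>2 = \<xi> k powr (2 * r)" "\<Psi> k \<in> frac_dom \<xi> \<Psi> r" for r k
  proof -
    have s: "(\<lambda>j. \<xi> j powr (2 * r) * (cmod (cinner (\<Psi> k) (\<Psi> j)))\<^sup>2) sums \<xi> k powr (2 * r)"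
      using sums_single[of k "\<lambda>j. \<xi> j powr (2 * r)"]
      by (rule sums_cong[THEN iffD1, rotated]) (auto simp: cinner_basis)
    then show d: "\<Psi> k \<in> frac_dom \<xi> \<Psi> r" by (simp add: frac_dom_def sums_iff)
    show "(norm (frac_pow \<xi> \<Psi> r (\<Psi> k)))\<^sup>2 = \<xi> k powr (2 * r)"
      by (rule sums_unique2[OF norm_frac_pow_sums[OF d] s])
  qed
  interpret memory_semigroup \<Psi> D A \<xi> g g' k0 k1 a \<rho> \<mu> \<alpha> \<beta> \<gamma> \<kappa> T
  proof unfold_locales
    show "\<kappa> * \<xi> k \<le> (\<alpha> - \<gamma>\<^sup>2 * \<beta>) * \<xi> k - kernel_mass g * \<xi> k powr a" for k
    proof -
      have "\<Psi> k \<noteq> 0" using cinner_basis[of k k] by auto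
      from gap[OF pw(2) this] show ?thesis
        using eigenvalue_pos[of k] by (simp add: pw(1))
    qed
  qed (use assms k kernel \<kappa> in auto)
  obtain C where C: "0 < C" and decay: "\<And>X t. X \<in> Dom \<Longrightarrow> 0 < t \<Longrightarrow>
      N (T t X) \<le> C * t powr (- (1 / (2 - 2 * a))) * (N X + N (Op X))"
    by (rule polynomial_decay) blast
  show ?thesis
    unfolding graph_norm_def using C decay by (intro exI[of _ C]) auto
qed

end
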